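(* Let $m,n\ge 1$ be integers, and let $A^0,A^1,\dots,A^n,L$ be real constant $m\times m$ matrices. Assume that conditions (A), (S), (S)$_2$ and (K) (all spelled out in the context; (S) and (S)$_2$ are required for one and the same matrix $S$) hold. Consider the Cauchy problem $$A^0u_t+\sum_{j=1}^nA^ju_{x_j}+Lu=0,\qquad u|_{t=0}=u_0,$$ for $u=u(t,x)\in\mathbb{R}^m$, $t>0$, $x\in\mathbb{R}^n$. Then there are constants $C,c>0$ such that the Fourier image $\hat u$ of the solution $u$ satisfies $$|\hat u(t,\xi)|\le Ce^{-c\,\rho(\xi)t}|\hat u_0(\xi)|,\qquad \rho(\xi):=\frac{|\xi|^2}{1+|\xi|^2},$$ for all $t\ge 0$ and $\xi\in\mathbb{R}^n$. Moreover, let $s\ge 0$ be an integer and suppose $u_0\in H^s(\mathbb{R}^n)\cap L^1(\mathbb{R}^n)$. Then, for all nonnegative integers $k\le s$ and all $t\ge 0$, $$\|\partial_x^ku(t)\|_{L^2}\le C(1+t)^{-n/4-k/2}\|u_0\|_{L^1}+Ce^{-ct}\|\partial_x^ku_0\|_{L^2},$$ where $C,c>0$ are constants independent of $t$ and $u_0$.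
   Context: Notation. $\langle\cdot,\cdot\rangle$ is the standard complex inner product on $\mathbb{C}^m$. For a matrix $X$ and a subspace $V\subset\mathbb{C}^m$, "$X\ge 0$ on $V$" means $\mathrm{Re}\,\langle Xz,z\rangle\ge 0$ for all $z\in V$, and "$X>0$ on $V$" means $\mathrm{Re}\,\langle Xz,z\rangle>0$ for all $0\ne z\in V$. For a real square matrix $X$, $X_1:=(X+X^T)/2$ and $X_2:=(X-X^T)/2$ are its symmetric and skew-symmetric parts. Kernels are taken in $\mathbb{C}^m$. For $\omega\in S^{n-1}$, $A(\omega):=\sum_{j=1}^nA^j\omega_j$. $\partial_x^k$ denotes the totality of all $k$-th order $x$-derivatives, and $H^s$ is the $L^2$-based Sobolev space. $\hat u(t,\xi)$ is the Fourier transform in $x$ of $u$; it solves $A^0\hat u_t+i|\xi|A(\omega)\hat u+L\hat u=0$, $\hat u(0,\xi)=\hat u_0(\xi)$, with $\omega=\xi/|\xi|$. The constants $C,c$ in the pointwise estimate do not depend on $t,\xi,u_0$. Condition (A): $A^0,A^1,\dots,A^n$ are real symmetric, $A^0>0$ on $\mathbb{C}^m$, $L$ is real (not necessarily symmetric) with $L\ge 0$ on $\mathbb{C}^m$, and $\mathrm{Ker}(L)\ne\{0\}$. Condition (S): there is a real constant matrix $S$ such that $(SA^0)^T=SA^0$, $(SL)_1+L_1\ge 0$ on $\mathbb{C}^m$, and $\mathrm{Ker}((SL)_1+L_1)=\mathrm{Ker}(L)$. Condition (S)$_2$: for each $\omega\in S^{n-1}$, the matrix $S$ in condition (S) satisfies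 $i(SA(\omega))_2\ge 0$ on $\mathbb{C}^m$. Condition (K): there is a real matrix-valued function $K(\omega)\in C^\infty(S^{n-1})$ such that for each $\omega\in S^{n-1}$: $K(-\omega)=-K(\omega)$, $(K(\omega)A^0)^T=-K(\omega)A^0$, and $(K(\omega)A(\omega))_1>0$ on $\mathrm{Ker}(L)$. *)

theory Defs
  imports "HOL-Analysis.Analysis"
begin

section \<open>Matrices\<close>

abbreviation cvec :: "real ^ 'm \<Rightarrow> complex ^ 'm" where
  "cvec v \<equiv> (\<chi> i. complex_of_real (v $ i))"

abbreviation cmat :: "real ^ 'm ^ 'm \<Rightarrow> complex ^ 'm ^ 'm" where
  "cmat X \<equiv> map_matrix complex_of_real X"

definition cinner :: "complex ^ 'm \<Rightarrow> complex ^ 'm \<Rightarrow> complex" where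
  "cinner x y = (\<Sum>i\<in>UNIV. x $ i * cnj (y $ i))"

definition nonneg_on :: "complex ^ 'm ^ 'm \<Rightarrow> (complex ^ 'm) set \<Rightarrow> bool" where
  "nonneg_on X V \<longleftrightarrow> (\<forall>z\<in>V. Re (cinner (X *v z) z) \<ge> 0)"

definition pos_on :: "complex ^ 'm ^ 'm \<Rightarrow> (complex ^ 'm) set \<Rightarrow> bool" where
  "pos_on X V \<longleftrightarrow> (\<forall>z\<in>V. z \<noteq> 0 \<longrightarrow> Re (cinner (X *v z) z) > 0)"

definition Ker :: "real ^ 'm ^ 'm \<Rightarrow> (complex ^ 'm) set" where
  "Ker X = {z. cmat X *v z = 0}"

definition sym_part :: "real ^ 'm ^ 'm \<Rightarrow> real ^ 'm ^ 'm" where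
  "sym_part X = (1/2) *\<^sub>R (X + transpose X)"

definition skew_part :: "real ^ 'm ^ 'm \<Rightarrow> real ^ 'm ^ 'm" where
  "skew_part X = (1/2) *\<^sub>R (X - transpose X)"

definition symbol :: "('n::finite \<Rightarrow> real ^ 'm ^ 'm) \<Rightarrow> real ^ 'n \<Rightarrow> real ^ 'm ^ 'm" where
  "symbol A \<omega> = (\<Sum>j\<in>UNIV. (\<omega> $ j) *\<^sub>R A j)"


section \<open>Smooth functions\<close>

text \<open>Only meant for open \<open>U\<close>.\<close>

primrec Ck_on :: "nat \<Rightarrow> 'a::real_normed_vector set \<Rightarrow> ('a \<Rightarrow> 'b::real_normed_vector) \<Rightarrow> bool" where
  "Ck_on 0 U f \<longleftrightarrow> continuous_on U f"
| "Ck_on (Suc k) U f \<longleftrightarrow>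
     f differentiable_on U \<and> (\<forall>v. Ck_on k U (\<lambda>x. frechet_derivative f (at x) v))"

definition smooth_on :: "'a::real_normed_vector set \<Rightarrow> ('a \<Rightarrow> 'b::real_normed_vector) \<Rightarrow> bool" where
  "smooth_on U f \<longleftrightarrow> (\<forall>k. Ck_on k U f)"

text \<open>Smoothness on a submanifold such as the sphere: existence of a smooth extension to an
  open neighbourhood.\<close>

definition smooth_extendable :: "'a::real_normed_vector set \<Rightarrow> ('a \<Rightarrow> 'b::real_normed_vector) \<Rightarrow> bool" where
  "smooth_extendable M f \<longleftrightarrow>
     (\<exists>U g. open U \<and> M \<subseteq> U \<and> smooth_on U g \<and> (\<forall>x\<in>M. g x = f x))"

definition test_function :: "(real ^ 'n \<Rightarrow> real) \<Rightarrow> bool" where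
  "test_function \<phi> \<longleftrightarrow> smooth_on UNIV \<phi> \<and> compact (closure {x. \<phi> x \<noteq> 0})"

definition partial :: "'n \<Rightarrow> (real ^ 'n \<Rightarrow> real) \<Rightarrow> real ^ 'n \<Rightarrow> real" where
  "partial j \<phi> x = frechet_derivative \<phi> (at x) (axis j 1)"

primrec partials :: "'n list \<Rightarrow> (real ^ 'n \<Rightarrow> real) \<Rightarrow> real ^ 'n \<Rightarrow> real" where
  "partials [] \<phi> = \<phi>"
| "partials (j # js) \<phi> = partial j (partials js \<phi>)"


section \<open>The conditions\<close>

definition condition_A ::
  "real ^ 'm ^ 'm \<Rightarrow> ('n::finite \<Rightarrow> real ^ 'm ^ 'm) \<Rightarrow> real ^ 'm ^ 'm \<Rightarrow> bool" where
  "condition_A A0 A L \<longleftrightarrow>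
     transpose A0 = A0 \<and> (\<forall>j. transpose (A j) = A j) \<and>
     pos_on (cmat A0) UNIV \<and> nonneg_on (cmat L) UNIV \<and> Ker L \<noteq> {0}"

definition condition_S ::
  "real ^ 'm ^ 'm \<Rightarrow> real ^ 'm ^ 'm \<Rightarrow> real ^ 'm ^ 'm \<Rightarrow> bool" where
  "condition_S A0 L S \<longleftrightarrow>
     transpose (S ** A0) = S ** A0 \<and>
     nonneg_on (cmat (sym_part (S ** L) + sym_part L)) UNIV \<and>
     Ker (sym_part (S ** L) + sym_part L) = Ker L"

definition condition_S2 :: "('n::finite \<Rightarrow> real ^ 'm ^ 'm) \<Rightarrow> real ^ 'm ^ 'm \<Rightarrow> bool" where
  "condition_S2 A S \<longleftrightarrow>
     (\<forall>\<omega>\<in>sphere 0 1.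
        nonneg_on (map_matrix (\<lambda>a. \<i> * a) (cmat (skew_part (S ** symbol A \<omega>)))) UNIV)"

definition condition_K ::
  "real ^ 'm ^ 'm \<Rightarrow> ('n::finite \<Rightarrow> real ^ 'm ^ 'm) \<Rightarrow> real ^ 'm ^ 'm \<Rightarrow> bool" where
  "condition_K A0 A L \<longleftrightarrow>
     (\<exists>K :: real ^ 'n \<Rightarrow> real ^ 'm ^ 'm. smooth_extendable (sphere 0 1) K \<and>
       (\<forall>\<omega>\<in>sphere 0 1.
          K (- \<omega>) = - K \<omega> \<and>
          transpose (K \<omega> ** A0) = - (K \<omega> ** A0) \<and>
          pos_on (cmat (sym_part (K \<omega> ** symbol A \<omega>))) (Ker L)))"


section \<open>Function spaces on \<open>\<real>\<^sup>n\<close>\<close>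

definition L2_fun :: "(real ^ 'n \<Rightarrow> 'b::euclidean_space) \<Rightarrow> bool" where
  "L2_fun f \<longleftrightarrow> f \<in> borel_measurable lborel \<and> integrable lborel (\<lambda>x. (norm (f x))\<^sup>2)"

definition L2_norm :: "(real ^ 'n \<Rightarrow> 'b::euclidean_space) \<Rightarrow> real" where
  "L2_norm f = sqrt (\<integral>x. (norm (f x))\<^sup>2 \<partial>lborel)"

definition L1_norm :: "(real ^ 'n \<Rightarrow> 'b::euclidean_space) \<Rightarrow> real" where
  "L1_norm f = (\<integral>x. norm (f x) \<partial>lborel)"

text \<open>A list \<open>[j\<^sub>1, \<dots>, j\<^sub>k]\<close> of coordinate indices stands for the \<open>k\<close>-th order derivative
  \<open>\<partial>\<^bsub>j\<^sub>1\<^esub> \<cdots> \<partial>\<^bsub>j\<^sub>k\<^esub>\<close>.\<close>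

definition is_weak_deriv ::
  "('n::finite) list \<Rightarrow> (real ^ 'n \<Rightarrow> real ^ 'm) \<Rightarrow> (real ^ 'n \<Rightarrow> real ^ 'm) \<Rightarrow> bool" where
  "is_weak_deriv js f g \<longleftrightarrow>
     (\<forall>\<phi>. test_function \<phi> \<longrightarrow>
        (\<integral>x. partials js \<phi> x *\<^sub>R f x \<partial>lborel) =
        (-1) ^ length js *\<^sub>R (\<integral>x. \<phi> x *\<^sub>R g x \<partial>lborel))"

definition Sobolev :: "nat \<Rightarrow> (real ^ 'n \<Rightarrow> real ^ 'm) \<Rightarrow> bool" where
  "Sobolev s f \<longleftrightarrow>
     L2_fun f \<and> (\<forall>js. length js \<le> s \<longrightarrow> (\<exists>g. L2_fun g \<and> is_weak_deriv js f g))"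

text \<open>Determined up to null sets, and meaningful only if the weak derivative exists in \<open>L\<^sup>2\<close>.\<close>

definition weak_deriv :: "'n list \<Rightarrow> (real ^ 'n \<Rightarrow> real ^ 'm) \<Rightarrow> real ^ 'n \<Rightarrow> real ^ 'm" where
  "weak_deriv js f = (SOME g. L2_fun g \<and> is_weak_deriv js f g)"

text \<open>The \<open>L\<^sup>2\<close> norm of the tuple of all \<open>k\<close>-th order derivatives.\<close>

definition deriv_L2_norm :: "nat \<Rightarrow> (real ^ 'n \<Rightarrow> real ^ 'm) \<Rightarrow> real" where
  "deriv_L2_norm k f = sqrt (\<Sum>js | length js = k. (L2_norm (weak_deriv js f))\<^sup>2)"


section \<open>Fourier transform\<close>

definition fourier_L1 :: "(real ^ 'n \<Rightarrow> real ^ 'm) \<Rightarrow> real ^ 'n \<Rightarrow> complex ^ 'm" where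
  "fourier_L1 f \<xi> =
     (2 * pi) powr (- real CARD('n) / 2) *\<^sub>R
     (\<integral>x. exp (- \<i> * complex_of_real (x \<bullet> \<xi>)) *s cvec (f x) \<partial>lborel)"

text \<open>For \<open>f\<close> in \<open>L\<^sup>2\<close>: the \<open>L\<^sup>2\<close> limit of the transforms of the truncations of \<open>f\<close> to large balls,
  which are integrable; determined up to null sets.\<close>

definition fourier :: "(real ^ 'n \<Rightarrow> real ^ 'm) \<Rightarrow> real ^ 'n \<Rightarrow> complex ^ 'm" where
  "fourier f = (SOME g. L2_fun g \<and>
     ((\<lambda>R. L2_norm (\<lambda>\<xi>. fourier_L1 (\<lambda>x. indicat_real (cball 0 R) x *\<^sub>R f x) \<xi> - g \<xi>))
        \<longlongrightarrow> 0) at_top)"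


section \<open>The Cauchy problem\<close>

text \<open>Weak solutions in \<open>C([0,\<infinity>); L\<^sup>2)\<close>: for each \<open>t > 0\<close> the equation holds in the sense of
  distributions in \<open>x\<close>, the time derivative being taken after pairing with a test function.\<close>

definition Cauchy_solution ::
  "real ^ 'm ^ 'm \<Rightarrow> ('n::finite \<Rightarrow> real ^ 'm ^ 'm) \<Rightarrow> real ^ 'm ^ 'm \<Rightarrow>
   (real ^ 'n \<Rightarrow> real ^ 'm) \<Rightarrow> (real \<Rightarrow> real ^ 'n \<Rightarrow> real ^ 'm) \<Rightarrow> bool" where
  "Cauchy_solution A0 A L u0 u \<longleftrightarrow>
     (\<forall>t\<ge>0. L2_fun (u t) \<and>
        ((\<lambda>s. L2_norm (\<lambda>x. u s x - u t x)) \<longlongrightarrow> 0) (at t within {0..})) \<and>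
     (\<forall>\<phi> t. test_function \<phi> \<longrightarrow> t > 0 \<longrightarrow>
        ((\<lambda>s. \<integral>x. \<phi> x *\<^sub>R (A0 *v u s x) \<partial>lborel) has_vector_derivative
         (\<integral>x. (\<Sum>j\<in>UNIV. partial j \<phi> x *\<^sub>R (A j *v u t x)) - \<phi> x *\<^sub>R (L *v u t x) \<partial>lborel))
        (at t)) \<and>
     (AE x in lborel. u 0 x = u0 x)"

text \<open>The equation at a single frequency \<open>\<xi>\<close>; note \<open>sgn \<xi> = \<xi> / norm \<xi>\<close>, and that the
  term with \<open>sgn \<xi>\<close> vanishes for \<open>\<xi> = 0\<close>.\<close>

definition Fourier_ODE ::
  "real ^ 'm ^ 'm \<Rightarrow> ('n::finite \<Rightarrow> real ^ 'm ^ 'm) \<Rightarrow> real ^ 'm ^ 'm \<Rightarrow>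
   real ^ 'n \<Rightarrow> (real \<Rightarrow> complex ^ 'm) \<Rightarrow> bool" where
  "Fourier_ODE A0 A L \<xi> v \<longleftrightarrow>
     (\<forall>t\<ge>0. \<exists>v'. (v has_vector_derivative v') (at t within {0..}) \<and>
        cmat A0 *v v' + (\<i> * complex_of_real (norm \<xi>)) *s (cmat (symbol A (sgn \<xi>)) *v v t)
          + cmat L *v v t = 0)"

definition rho :: "real ^ 'n \<Rightarrow> real" where
  "rho \<xi> = (norm \<xi>)\<^sup>2 / (1 + (norm \<xi>)\<^sup>2)"

end

(* On the Fourier side the equation is an ODE for each frequency, and the form of
   A0 + beta S A0 - alpha |xi| / (1 + |xi|^2) i K(omega) A0 is a Lyapunov function: S dissipates the
   part off Ker L, S_2 makes the transport term harmless, and K dissipates the part in Ker L, so the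
   form decays at rate rho(xi).  A Cauchy solution satisfies the equation only weakly, but testing
   against band-limited functions shows that its transform is differentiable in time as an L^2 map on
   bounded sets of frequencies; integrating the Lyapunov function over small frequency sets gives the
   pointwise bound almost everywhere.  For the derivatives, Plancherel reduces the claim to the bound
   of |xi|^(2k) exp(-2 c rho t) |u0^|^2, where |u0^| is bounded by the L^1 norm for |xi| <= 1 and
   rho >= 1/2 elsewhere. *)
theory Submission
  imports Defs "HOL-Probability.Characteristic_Functions"
begin

text \<open>The transform \<open>fourier (u t)\<close> is chosen for each \<open>t\<close>
  separately and only up to a null set, so at a fixed frequency there is no function of time to
  differentiate. This is the obstacle that shapes the energy argument: energies are integrated over
  bounded sets of frequencies before they are differentiated, and since \<open>rho\<close> varies,
  these sets are confined to \<open>q\<close> <= \<open>rho\<close> with rational \<open>q\<close>,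
  so that countably many null sets suffice. The weight |xi| / (1 + |xi|^2) meets three demands. It
  is bounded, so the K term does not spoil the equivalence of the form with |z|^2; multiplied by the
  |xi| of the transport term it gives \<open>rho\<close>; and its square is at most
  \<open>rho\<close>, so the mixed term of K and L is absorbed by Young's inequality. The constants
  are fixed in the order beta, alpha: beta is small against A0 and S and at most 1, so that L pays
  for the loss from beta * L; alpha is small against beta, so that the S term pays for the K term
  off Ker L.\<close>

section \<open>Square-integrable functions: Cauchy-Schwarz, dominated convergence,
  completeness\<close>

lemma borel_measurable_cvec_nth [measurable (raw)]:
  fixes f :: "'a \<Rightarrow> 'b::euclidean_space ^ 'm"
  assumes [measurable]: "f \<in> borel_measurable M"
  shows "(\<lambda>x. f x $ i) \<in> borel_measurable M"
  by (rule borel_measurable_continuous_on[of "\<lambda>v. v $ i"])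
    (auto intro!: continuous_intros linear_continuous_on bounded_linear_vec_nth)

lemma L2_fun_measurable [measurable_dest]: "L2_fun f \<Longrightarrow> f \<in> borel_measurable borel"
  by (simp add: L2_fun_def)

lemma L2_fun_square_integrable: "L2_fun f \<Longrightarrow> integrable lborel (\<lambda>x. (norm (f x))\<^sup>2)"
  by (simp add: L2_fun_def)

lemma L2_norm_nonneg [simp]: "0 \<le> L2_norm f"
  by (simp add: L2_norm_def)

lemma L2_norm_square: "(L2_norm f)\<^sup>2 = (\<integral>x. (norm (f x))\<^sup>2 \<partial>lborel)"
  by (simp add: L2_norm_def)

lemma L2_fun_bound:
  assumes f: "L2_fun f" and [measurable]: "g \<in> borel_measurable borel"
    and le: "\<And>x. norm (g x) \<le> C * norm (f x)"
  shows "L2_fun g"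
  unfolding L2_fun_def
proof
  show "integrable lborel (\<lambda>x. (norm (g x))\<^sup>2)"
  proof (rule Bochner_Integration.integrable_bound)
    show "integrable lborel (\<lambda>x. C\<^sup>2 * (norm (f x))\<^sup>2)"
      using L2_fun_square_integrable[OF f] by simp
    show "AE x in lborel. norm ((norm (g x))\<^sup>2) \<le> norm (C\<^sup>2 * (norm (f x))\<^sup>2)"
    proof (rule AE_I2)
      fix x
      have "(norm (g x))\<^sup>2 \<le> (C * norm (f x))\<^sup>2" by (intro power_mono le) simp
      then show "norm ((norm (g x))\<^sup>2) \<le> norm (C\<^sup>2 * (norm (f x))\<^sup>2)"
        by (simp add: power_mult_distrib)
    qed
  qed simp
qed simp

lemma L2_fun_zero [simp]: "L2_fun (\<lambda>x. 0)"
  by (simp add: L2_fun_def)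

lemma L2_fun_scaleR: "L2_fun f \<Longrightarrow> L2_fun (\<lambda>x. c *\<^sub>R f x)"
  by (rule L2_fun_bound[where C="\<bar>c\<bar>" and f=f]) auto

lemma L2_fun_add:
  assumes f: "L2_fun f" and g: "L2_fun g" shows "L2_fun (\<lambda>x. f x + g x)"
proof -
  note [measurable] = L2_fun_measurable[OF f] L2_fun_measurable[OF g]
  show ?thesis
    unfolding L2_fun_def
  proof
    show "integrable lborel (\<lambda>x. (norm (f x + g x))\<^sup>2)"
    proof (rule Bochner_Integration.integrable_bound)
      show "integrable lborel (\<lambda>x. 2 * (norm (f x))\<^sup>2 + 2 * (norm (g x))\<^sup>2)"
        using L2_fun_square_integrable[OF f] L2_fun_square_integrable[OF g] by simp
      have "(norm (f x + g x))\<^sup>2 \<le> 2 * (norm (f x))\<^sup>2 + 2 * (norm (g x))\<^sup>2" for x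
      proof -
        have "(norm (f x + g x))\<^sup>2 \<le> (norm (f x) + norm (g x))\<^sup>2"
          by (intro power_mono norm_triangle_ineq) simp
        also have "\<dots> \<le> 2 * (norm (f x))\<^sup>2 + 2 * (norm (g x))\<^sup>2"
          using zero_le_power2[of "norm (f x) - norm (g x)"] by (simp add: power2_eq_square algebra_simps)
        finally show ?thesis .
      qed
      then show "AE x in lborel. norm ((norm (f x + g x))\<^sup>2) \<le> norm (2 * (norm (f x))\<^sup>2 + 2 * (norm (g x))\<^sup>2)"
        by (auto intro!: AE_I2 order_trans[OF _ abs_ge_self])
    qed simp
  qed simp
qed

lemma L2_fun_diff: "L2_fun f \<Longrightarrow> L2_fun g \<Longrightarrow> L2_fun (\<lambda>x. f x - g x)"
  using L2_fun_add[of f "\<lambda>x. (-1) *\<^sub>R g x"] L2_fun_scaleR[of g "-1"] by simp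

lemma L2_fun_sum: "(\<And>i. i \<in> I \<Longrightarrow> L2_fun (f i)) \<Longrightarrow> L2_fun (\<lambda>x. \<Sum>i\<in>I. f i x)"
  by (induction I rule: infinite_finite_induct) (auto intro: L2_fun_add)

lemma L2_fun_indicator:
  "L2_fun f \<Longrightarrow> B \<in> sets borel \<Longrightarrow> L2_fun (\<lambda>x. indicat_real B x *\<^sub>R f x)"
  by (rule L2_fun_bound[where C=1 and f=f]) (auto simp: indicator_def)

lemma L2_integrable_norm_mult:
  assumes f: "L2_fun f" and g: "L2_fun g"
  shows "integrable lborel (\<lambda>x. norm (f x) * norm (g x))"
proof (rule Bochner_Integration.integrable_bound)
  note [measurable] = L2_fun_measurable[OF f] L2_fun_measurable[OF g]
  show "integrable lborel (\<lambda>x. (norm (f x))\<^sup>2 + (norm (g x))\<^sup>2)"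
    using L2_fun_square_integrable[OF f] L2_fun_square_integrable[OF g] by simp
  have "norm (f x) * norm (g x) \<le> (norm (f x))\<^sup>2 + (norm (g x))\<^sup>2" for x
    using sum_squares_bound[of "norm (f x)" "norm (g x)"] mult_nonneg_nonneg[OF norm_ge_zero[of "f x"] norm_ge_zero[of "g x"]]
    by linarith
  then show "AE x in lborel. norm (norm (f x) * norm (g x)) \<le> norm ((norm (f x))\<^sup>2 + (norm (g x))\<^sup>2)"
    by simp
  show "(\<lambda>x. norm (f x) * norm (g x)) \<in> borel_measurable lborel" by simp
qed

lemma L2_integrable_bound:
  fixes h :: "real ^ 'n \<Rightarrow> 'c::{banach, second_countable_topology}"
  assumes f: "L2_fun f" and g: "L2_fun g" and "h \<in> borel_measurable borel"
    and le: "\<And>x. norm (h x) \<le> norm (f x) * norm (g x)"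
  shows "integrable lborel h"
  by (rule Bochner_Integration.integrable_bound[OF L2_integrable_norm_mult[OF f g]])
    (use assms in auto)

text \<open>Integrate 2ab <= t a^2 + b^2 / t and take for \<open>t\<close> the quotient of the norms
  of \<open>g\<close> and \<open>f\<close>. Both norms are first enlarged by \<open>e\<close>, so
  that the quotient makes sense when a norm vanishes, and \<open>e\<close> tends to 0 at the
  end.\<close>

lemma L2_integral_norm_mult_le:
  assumes f: "L2_fun f" and g: "L2_fun g"
  shows "(\<integral>x. norm (f x) * norm (g x) \<partial>lborel) \<le> L2_norm f * L2_norm g"
proof -
  let ?I = "\<integral>x. norm (f x) * norm (g x) \<partial>lborel"
  let ?p = "L2_norm f" and ?q = "L2_norm g"
  have weighted: "2 * ?I \<le> t * ?p\<^sup>2 + ?q\<^sup>2 / t" if t: "t > 0" for t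
  proof -
    have "2 * (norm (f x) * norm (g x)) \<le> t * (norm (f x))\<^sup>2 + (norm (g x))\<^sup>2 / t" for x
    proof -
      have "0 \<le> (t * norm (f x) - norm (g x))\<^sup>2 / t" using t by simp
      also have "\<dots> = t * (norm (f x))\<^sup>2 + (norm (g x))\<^sup>2 / t - 2 * (norm (f x) * norm (g x))"
        using t by (simp add: power2_eq_square field_simps)
      finally show ?thesis by simp
    qed
    then have "(\<integral>x. 2 * (norm (f x) * norm (g x)) \<partial>lborel) \<le>
        (\<integral>x. t * (norm (f x))\<^sup>2 + (norm (g x))\<^sup>2 / t \<partial>lborel)"
      using L2_integrable_norm_mult[OF f g] L2_fun_square_integrable[OF f] L2_fun_square_integrable[OF g]
      by (intro integral_mono) auto
    also have "\<dots> = t * ?p\<^sup>2 + ?q\<^sup>2 / t"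
      using L2_fun_square_integrable[OF f] L2_fun_square_integrable[OF g] by (simp add: L2_norm_square)
    finally show ?thesis by simp
  qed
  have bound: "?I \<le> (?p + e) * (?q + e)" if e: "e > 0" for e
  proof -
    define a b where "a = ?p + e" and "b = ?q + e"
    have ab: "a > 0" "b > 0" "?p \<le> a" "?q \<le> b" using e by (auto simp: a_def b_def intro: add_nonneg_pos)
    have "2 * ?I \<le> (b / a) * ?p\<^sup>2 + ?q\<^sup>2 / (b / a)" using ab by (intro weighted) simp
    also have "\<dots> \<le> (b / a) * a\<^sup>2 + b\<^sup>2 / (b / a)"
      using ab by (intro add_mono mult_left_mono divide_right_mono power_mono) auto
    also have "\<dots> = 2 * (a * b)" using ab by (simp add: power2_eq_square)
    finally show ?thesis by (simp add: a_def b_def)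
  qed
  have "((\<lambda>e. (?p + e) * (?q + e)) \<longlongrightarrow> (?p + 0) * (?q + 0)) (at_right 0)"
    by (intro tendsto_intros)
  then show ?thesis
    using bound by (intro tendsto_lowerbound[where F="at_right 0" and f="\<lambda>e. (?p + e) * (?q + e)"])
      (auto simp: eventually_at_right_less intro: eventually_mono[OF eventually_at_right_less])
qed

lemma L2_norm_triangle:
  assumes f: "L2_fun f" and g: "L2_fun g"
  shows "L2_norm (\<lambda>x. f x + g x) \<le> L2_norm f + L2_norm g"
proof (rule power2_le_imp_le)
  note [measurable] = L2_fun_measurable[OF f] L2_fun_measurable[OF g]
  have "(L2_norm (\<lambda>x. f x + g x))\<^sup>2 \<le>
      (\<integral>x. (norm (f x))\<^sup>2 + 2 * (norm (f x) * norm (g x)) + (norm (g x))\<^sup>2 \<partial>lborel)"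
    unfolding L2_norm_square
  proof (rule integral_mono)
    fix x
    have "(norm (f x + g x))\<^sup>2 \<le> (norm (f x) + norm (g x))\<^sup>2"
      by (intro power_mono norm_triangle_ineq) simp
    then show "(norm (f x + g x))\<^sup>2 \<le> (norm (f x))\<^sup>2 + 2 * (norm (f x) * norm (g x)) + (norm (g x))\<^sup>2"
      by (simp add: power2_sum)
  qed (use L2_fun_square_integrable[OF L2_fun_add[OF f g]] L2_integrable_norm_mult[OF f g]
      L2_fun_square_integrable[OF f] L2_fun_square_integrable[OF g] in auto)
  also have "\<dots> = (L2_norm f)\<^sup>2 + 2 * (\<integral>x. norm (f x) * norm (g x) \<partial>lborel) + (L2_norm g)\<^sup>2"
    using L2_integrable_norm_mult[OF f g] L2_fun_square_integrable[OF f] L2_fun_square_integrable[OF g]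
    by (simp add: L2_norm_square)
  also have "\<dots> \<le> (L2_norm f + L2_norm g)\<^sup>2"
    using L2_integral_norm_mult_le[OF f g] by (simp add: power2_sum)
  finally show "(L2_norm (\<lambda>x. f x + g x))\<^sup>2 \<le> (L2_norm f + L2_norm g)\<^sup>2" .
qed simp

lemma L2_norm_mono:
  assumes g: "L2_fun g" and [measurable]: "f \<in> borel_measurable borel"
    and le: "AE x in lborel. norm (f x) \<le> norm (g x)"
  shows "L2_norm f \<le> L2_norm g"
  unfolding L2_norm_def
  by (intro real_sqrt_le_mono integral_mono_AE' L2_fun_square_integrable g)
    (use le in \<open>auto elim!: eventually_mono intro: power_mono\<close>)

lemma L2_norm_scaleR: "L2_norm (\<lambda>x. c *\<^sub>R f x) = \<bar>c\<bar> * L2_norm f"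
  by (simp add: L2_norm_def power_mult_distrib real_sqrt_mult)

lemma L2_norm_minus_commute: "L2_norm (\<lambda>x. f x - g x) = L2_norm (\<lambda>x. g x - f x)"
  by (simp add: L2_norm_def norm_minus_commute)

lemma L2_norm_triangle_diff:
  assumes "L2_fun f" "L2_fun g" "L2_fun h"
  shows "L2_norm (\<lambda>x. f x - h x) \<le> L2_norm (\<lambda>x. f x - g x) + L2_norm (\<lambda>x. g x - h x)"
  using L2_norm_triangle[OF L2_fun_diff[OF assms(1,2)] L2_fun_diff[OF assms(2,3)]] by simp

lemma L2_norm_diff_abs_le:
  assumes "L2_fun f" "L2_fun g"
  shows "\<bar>L2_norm f - L2_norm g\<bar> \<le> L2_norm (\<lambda>x. f x - g x)"
  using L2_norm_triangle[OF L2_fun_diff[OF assms] assms(2)] 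
    L2_norm_triangle[OF L2_fun_diff[OF assms(2,1)] assms(1)] L2_norm_minus_commute[of f g] by simp

lemma L2_norm_zero_iff_AE:
  assumes f: "L2_fun f" shows "L2_norm f = 0 \<longleftrightarrow> (AE x in lborel. f x = 0)"
  using integral_nonneg_eq_0_iff_AE[OF L2_fun_square_integrable[OF f]] by (simp add: L2_norm_def)

lemma L2_integral_norm_le:
  fixes h :: "real ^ 'n \<Rightarrow> 'c::{banach, second_countable_topology}"
  assumes f: "L2_fun f" and g: "L2_fun g" and "\<And>x. norm (h x) \<le> norm (f x) * norm (g x)"
  shows "norm (\<integral>x. h x \<partial>lborel) \<le> L2_norm f * L2_norm g"
proof -
  have "norm (\<integral>x. h x \<partial>lborel) \<le> (\<integral>x. norm (h x) \<partial>lborel)" by (rule integral_norm_bound)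
  also have "\<dots> \<le> (\<integral>x. norm (f x) * norm (g x) \<partial>lborel)"
    using assms by (intro integral_mono' L2_integrable_norm_mult) auto
  finally show ?thesis using L2_integral_norm_mult_le[OF f g] by simp
qed

text \<open>Dominated convergence for the squares, along a real parameter. The truncation and
  cut-off arguments below come down to this.\<close>

lemma L2_norm_tendsto_zero_at_top:
  fixes f :: "real \<Rightarrow> real ^ 'n \<Rightarrow> 'b::euclidean_space"
  assumes w: "L2_fun w" and [measurable]: "\<And>R. f R \<in> borel_measurable borel"
    and le: "\<And>R x. norm (f R x) \<le> norm (w x)"
    and lim: "\<And>x. ((\<lambda>R. f R x) \<longlongrightarrow> 0) at_top"
  shows "((\<lambda>R::real. L2_norm (f R)) \<longlongrightarrow> 0) at_top"
proof -
  have "((\<lambda>R. integral\<^sup>L lborel (\<lambda>x. (norm (f R x))\<^sup>2)) \<longlongrightarrow> integral\<^sup>L (lborel :: (real ^ 'n) measure) (\<lambda>x. 0)) at_top"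
  proof (rule integral_dominated_convergence_at_top[where M=lborel and s="\<lambda>R x. (norm (f R x))\<^sup>2" and f="\<lambda>x. 0::real" and w="\<lambda>x. (norm (w x))\<^sup>2"])
    have "norm ((norm (f R x))\<^sup>2) \<le> (norm (w x))\<^sup>2" for R x
      using power_mono[OF le[of R x] norm_ge_zero, where n=2] by (simp only: power_abs real_norm_def abs_norm_cancel)
    then show "\<forall>\<^sub>F R in at_top. AE x in lborel. norm ((norm (f R x))\<^sup>2) \<le> (norm (w x))\<^sup>2"
      by (intro always_eventually allI AE_I2)
    have "((\<lambda>R. (norm (f R x))\<^sup>2) \<longlongrightarrow> 0) at_top" for x
      using tendsto_power[OF tendsto_norm[OF lim], of x 2] by simp
    then show "AE x in lborel. ((\<lambda>R. (norm (f R x))\<^sup>2) \<longlongrightarrow> 0) at_top"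
      by simp
    show "integrable lborel (\<lambda>x. (norm (w x))\<^sup>2)" by (rule L2_fun_square_integrable[OF w])
    show "(\<lambda>x. (norm (f R x))\<^sup>2) \<in> borel_measurable lborel" for R by measurable
  qed simp
  from tendsto_real_sqrt[OF this] show ?thesis
    unfolding L2_norm_def by (simp only: integral_zero real_sqrt_zero)
qed

text \<open>The positive integrable weight \<open>w\<close> makes the sequence Cauchy in \<open>L\<^sup>1\<close>, which yields a
  subsequence converging almost everywhere.\<close>

lemma L2_complete:
  fixes f :: "nat \<Rightarrow> real ^ 'n \<Rightarrow> 'b::euclidean_space"
  assumes f: "\<And>n. L2_fun (f n)"
    and Cauchy: "\<And>e. e > 0 \<Longrightarrow> \<exists>N. \<forall>i\<ge>N. \<forall>j\<ge>N. L2_norm (\<lambda>x. f i x - f j x) < e"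
  obtains g where "L2_fun g" "(\<lambda>n. L2_norm (\<lambda>x. f n x - g x)) \<longlonglongrightarrow> 0"
proof -
  note [measurable] = L2_fun_measurable[OF f]
  obtain w :: "real ^ 'n \<Rightarrow> real" where w [measurable]: "w \<in> borel_measurable lborel"
    and w0: "\<And>x. w x > 0" "\<And>x. w x \<le> 1" and wint: "integrable lborel w"
    by (rule sigma_finite_measure.obtain_positive_integrable_function[OF lborel.sigma_finite_measure_axioms]) blast
  have wL2: "L2_fun w"
    unfolding L2_fun_def
  proof
    show "integrable lborel (\<lambda>x. (norm (w x))\<^sup>2)"
      using w0 by (intro Bochner_Integration.integrable_bound[OF wint])
        (auto simp: power2_eq_square less_imp_le mult_left_le)
  qed simp
  have int: "integrable lborel (\<lambda>x. w x *\<^sub>R f n x)" for n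
    by (rule L2_integrable_bound[OF wL2 f[of n]]) auto
  have wn: "0 < L2_norm w + 1" using L2_norm_nonneg[of w] by linarith
  have "\<exists>N. \<forall>i\<ge>N. \<forall>j\<ge>N. (LINT x|lborel. norm (w x *\<^sub>R f i x - w x *\<^sub>R f j x)) < e" if e: "e > 0" for e
  proof -
    obtain N where N: "\<And>i j. i \<ge> N \<Longrightarrow> j \<ge> N \<Longrightarrow> L2_norm (\<lambda>x. f i x - f j x) < e / (L2_norm w + 1)"
      using Cauchy[OF divide_pos_pos[OF e wn]] by blast
    have "(LINT x|lborel. norm (w x *\<^sub>R f i x - w x *\<^sub>R f j x)) < e" if ij: "i \<ge> N" "j \<ge> N" for i j
    proof -
      have "(LINT x|lborel. norm (w x *\<^sub>R f i x - w x *\<^sub>R f j x)) = 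
          (LINT x|lborel. norm (w x) * norm (f i x - f j x))"
        by (simp add: scaleR_diff_right[symmetric])
      also have "\<dots> \<le> L2_norm w * L2_norm (\<lambda>x. f i x - f j x)"
        by (intro L2_integral_norm_mult_le wL2 L2_fun_diff f)
      also have "\<dots> \<le> (L2_norm w + 1) * L2_norm (\<lambda>x. f i x - f j x)"
        by (intro mult_right_mono) auto
      also have "\<dots> < e"
        using N[OF ij] wn by (simp add: pos_less_divide_eq mult.commute)
      finally show ?thesis .
    qed
    then show ?thesis by blast
  qed
  from cauchy_L1_AE_cauchy_subseq[of lborel "\<lambda>n x. w x *\<^sub>R f n x", OF int this]
  obtain r where r: "strict_mono r" and AEC: "AE x in lborel. Cauchy (\<lambda>i. w x *\<^sub>R f (r i) x)"
    by blast
  \<comment> \<open>Outside the convergence set the value 0 is assigned, which makes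
    \<open>g\<close> Borel measurable and not merely measurable up to a null set.\<close>
  define g where "g x = (if convergent (\<lambda>i. f (r i) x) then lim (\<lambda>i. f (r i) x) else 0)" for x
  have [measurable]: "g \<in> borel_measurable borel"
  proof -
    have "{x \<in> space borel. convergent (\<lambda>i. f (r i) x)} \<in> sets borel"
      unfolding Cauchy_convergent_iff[symmetric] by measurable
    then show ?thesis unfolding g_def by measurable
  qed
  have conv: "AE x in lborel. (\<lambda>i. f (r i) x) \<longlonglongrightarrow> g x"
  proof -
    have "(\<lambda>i. f (r i) x) \<longlonglongrightarrow> g x" if "Cauchy (\<lambda>i. w x *\<^sub>R f (r i) x)" for x
    proof -
      have "convergent (\<lambda>i. w x *\<^sub>R f (r i) x)" using that by (rule Cauchy_convergent)
      then obtain l where "(\<lambda>i. w x *\<^sub>R f (r i) x) \<longlonglongrightarrow> l"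
        unfolding convergent_def by blast
      from tendsto_scaleR[OF tendsto_const this, of "1 / w x"]
      have "(\<lambda>i. f (r i) x) \<longlonglongrightarrow> (1 / w x) *\<^sub>R l" using w0(1)[of x] by simp
      then have "convergent (\<lambda>i. f (r i) x)" by (auto simp: convergent_def)
      then show ?thesis by (simp add: g_def convergent_LIMSEQ_iff)
    qed
    then show ?thesis using AEC by (auto elim: eventually_mono)
  qed
  \<comment> \<open>Fatou's lemma along the subsequence carries the Cauchy bound over to the
    pointwise limit. It also shows that the difference lies in L^2, and this is how \<open>g\<close>
    itself is seen to be in L^2.\<close>
  have key: "L2_fun (\<lambda>x. f n x - g x) \<and> L2_norm (\<lambda>x. f n x - g x) \<le> e"
    if e: "e > 0" and N: "\<And>j. j \<ge> N \<Longrightarrow> L2_norm (\<lambda>x. f n x - f j x) \<le> e" for e n N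
  proof -
    have "(\<integral>\<^sup>+x. ennreal ((norm (f n x - g x))\<^sup>2) \<partial>lborel) =
        (\<integral>\<^sup>+x. liminf (\<lambda>i. ennreal ((norm (f n x - f (r i) x))\<^sup>2)) \<partial>lborel)"
    proof (rule nn_integral_cong_AE, use conv in eventually_elim)
      fix x assume "(\<lambda>i. f (r i) x) \<longlonglongrightarrow> g x"
      then have "(\<lambda>i. ennreal ((norm (f n x - f (r i) x))\<^sup>2)) \<longlonglongrightarrow> ennreal ((norm (f n x - g x))\<^sup>2)"
        by (intro tendsto_intros)
      then show "ennreal ((norm (f n x - g x))\<^sup>2) = liminf (\<lambda>i. ennreal ((norm (f n x - f (r i) x))\<^sup>2))"
        by (intro lim_imp_Liminf[symmetric] trivial_limit_sequentially)
    qed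
    also have "\<dots> \<le> liminf (\<lambda>i. \<integral>\<^sup>+x. ennreal ((norm (f n x - f (r i) x))\<^sup>2) \<partial>lborel)"
      by (rule nn_integral_liminf) simp
    also have "\<dots> \<le> ennreal (e\<^sup>2)"
    proof (rule Liminf_le)
      have "(\<integral>\<^sup>+x. ennreal ((norm (f n x - f (r i) x))\<^sup>2) \<partial>lborel) \<le> ennreal (e\<^sup>2)" if "i \<ge> N" for i
      proof -
        have "r i \<ge> N" using seq_suble[OF r, of i] that by simp
        from power_mono[OF N[OF this] L2_norm_nonneg, of 2]
        have "(\<integral>x. (norm (f n x - f (r i) x))\<^sup>2 \<partial>lborel) \<le> e\<^sup>2" by (simp only: L2_norm_square)
        then show ?thesis
          using L2_fun_square_integrable[OF L2_fun_diff[OF f[of n] f[of "r i"]]]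
          by (simp add: nn_integral_eq_integral ennreal_leI)
      qed
      then show "\<forall>\<^sub>F i in sequentially. (\<integral>\<^sup>+x. ennreal ((norm (f n x - f (r i) x))\<^sup>2) \<partial>lborel) \<le> ennreal (e\<^sup>2)"
        by (auto simp: eventually_sequentially)
    qed simp
    finally have le: "(\<integral>\<^sup>+x. ennreal ((norm (f n x - g x))\<^sup>2) \<partial>lborel) \<le> ennreal (e\<^sup>2)" .
    then have int: "integrable lborel (\<lambda>x. (norm (f n x - g x))\<^sup>2)"
      by (intro integrableI_bounded) (auto intro: le_less_trans)
    then have "(L2_norm (\<lambda>x. f n x - g x))\<^sup>2 \<le> e\<^sup>2"
      using le by (subst (asm) nn_integral_eq_integral) (auto simp: L2_norm_square)
    then show ?thesis using int e by (auto simp: L2_fun_def abs_le_square_iff[symmetric])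
  qed
  obtain N1 where N1: "\<And>i j. i \<ge> N1 \<Longrightarrow> j \<ge> N1 \<Longrightarrow> L2_norm (\<lambda>x. f i x - f j x) < 1" using Cauchy[of 1] by auto
  have "L2_fun (\<lambda>x. f N1 x - g x)" using key[of 1 N1 N1] N1[of N1] by (force simp: less_imp_le)
  from L2_fun_diff[OF f[of N1] this] have "L2_fun g" by simp
  moreover have "(\<lambda>n. L2_norm (\<lambda>x. f n x - g x)) \<longlonglongrightarrow> 0"
  proof (rule LIMSEQ_I)
    fix e :: real assume e: "e > 0"
    obtain N where N: "\<And>i j. i \<ge> N \<Longrightarrow> j \<ge> N \<Longrightarrow> L2_norm (\<lambda>x. f i x - f j x) < e / 2"
      using Cauchy[of "e/2"] e by auto
    have "L2_norm (\<lambda>x. f n x - g x) < e" if "n \<ge> N" for n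
      using key[of "e/2" N n] N[OF that] e by (force simp: less_imp_le)
    then show "\<exists>N. \<forall>n\<ge>N. norm (L2_norm (\<lambda>x. f n x - g x) - 0) < e" by auto
  qed
  ultimately show ?thesis by (rule that)
qed

section \<open>The Fourier transform and Plancherel's theorem\<close>

lemma borel_measurable_cnj [measurable (raw)]:
  "f \<in> borel_measurable M \<Longrightarrow> (\<lambda>x. cnj (f x)) \<in> borel_measurable M"
  by (rule borel_measurable_continuous_on[of cnj]) (auto intro!: continuous_intros)

section \<open>Affine substitutions and continuity of translations in L^1\<close>

lemma lborel_integral_affine:
  fixes f :: "'a::euclidean_space \<Rightarrow> 'b::{banach, second_countable_topology}"
  assumes [measurable]: "f \<in> borel_measurable borel" and c: "c \<noteq> 0"
  shows "(\<integral>x. f x \<partial>lborel) = \<bar>c\<bar> ^ DIM('a) *\<^sub>R (\<integral>x. f (t + c *\<^sub>R x) \<partial>lborel)"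
  by (subst lborel_affine[OF c, of t]) (simp add: integral_density integral_distr)

lemma lborel_integrable_affine:
  fixes f :: "'a::euclidean_space \<Rightarrow> 'b::{banach, second_countable_topology}"
  assumes f: "integrable lborel f" and c: "c \<noteq> 0"
  shows "integrable lborel (\<lambda>x. f (t + c *\<^sub>R x))"
proof -
  have [measurable]: "f \<in> borel_measurable borel" using f by auto
  have "integrable (density (distr lborel borel (\<lambda>x. t + c *\<^sub>R x)) (\<lambda>_. ennreal (\<bar>c\<bar> ^ DIM('a)))) f"
    using f lborel_affine[OF c, of t] by (simp add: ennreal_power)
  then have "integrable lborel (\<lambda>x. \<bar>c\<bar> ^ DIM('a) *\<^sub>R f (t + c *\<^sub>R x))"
    by (simp add: integrable_density integrable_distr_eq)
  from integrable_scaleR_right[OF this, of "1 / \<bar>c\<bar> ^ DIM('a)"] show ?thesis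
    using c by simp
qed

lemma lborel_integral_translate:
  fixes f :: "'a::euclidean_space \<Rightarrow> 'b::{banach, second_countable_topology}"
  shows "f \<in> borel_measurable borel \<Longrightarrow> (\<integral>x. f (x + t) \<partial>lborel) = (\<integral>x. f x \<partial>lborel)"
  using lborel_integral_affine[of f 1 t] by (simp add: add.commute)

lemma lborel_integrable_translate:
  fixes f :: "'a::euclidean_space \<Rightarrow> 'b::{banach, second_countable_topology}"
  shows "integrable lborel f \<Longrightarrow> integrable lborel (\<lambda>x. f (x + t))"
  using lborel_integrable_affine[of f 1 t] by (simp add: add.commute)

text \<open>Lebesgue measure is translation invariant, so replacing \<open>f\<close> by
  \<open>g\<close> costs at most twice their L^1 distance. The closure property is used twice: from
  open sets to Borel sets, and from simple functions to integrable ones.\<close>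

lemma L1_translation_approx:
  fixes f :: "'a::euclidean_space \<Rightarrow> 'b::{banach, second_countable_topology}"
  assumes f: "integrable lborel f"
    and approx: "\<And>e. e > 0 \<Longrightarrow> \<exists>g. integrable lborel g \<and> (\<integral>x. norm (f x - g x) \<partial>lborel) < e \<and>
      (\<lambda>k. \<integral>x. norm (g (x + h k) - g x) \<partial>lborel) \<longlonglongrightarrow> 0"
  shows "(\<lambda>k. \<integral>x. norm (f (x + h k) - f x) \<partial>lborel) \<longlonglongrightarrow> 0"
proof (rule LIMSEQ_I)
  fix e :: real assume e: "e > 0"
  obtain g where g: "integrable lborel g" and d: "(\<integral>x. norm (f x - g x) \<partial>lborel) < e / 3"
    and lim: "(\<lambda>k. \<integral>x. norm (g (x + h k) - g x) \<partial>lborel) \<longlonglongrightarrow> 0"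
    using approx[of "e/3"] e by auto
  note [measurable] = borel_measurable_integrable[OF f] borel_measurable_integrable[OF g]
  obtain K where K: "\<And>k. k \<ge> K \<Longrightarrow> norm ((\<integral>x. norm (g (x + h k) - g x) \<partial>lborel) - 0) < e / 3"
    using LIMSEQ_D[OF lim, of "e/3"] e by auto
  have "norm ((\<integral>x. norm (f (x + h k) - f x) \<partial>lborel) - 0) < e" if "k \<ge> K" for k
  proof -
    note ft = lborel_integrable_translate[OF f, of "h k"] and gt = lborel_integrable_translate[OF g, of "h k"]
    have "(\<integral>x. norm (f (x + h k) - f x) \<partial>lborel) \<le>
        (\<integral>x. norm (f (x + h k) - g (x + h k)) + norm (g (x + h k) - g x) + norm (f x - g x) \<partial>lborel)"
    proof (rule integral_mono)
      fix x
      have "f (x + h k) - f x = (f (x + h k) - g (x + h k)) + (g (x + h k) - g x) + - (f x - g x)" by simp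
      then show "norm (f (x + h k) - f x) \<le>
          norm (f (x + h k) - g (x + h k)) + norm (g (x + h k) - g x) + norm (f x - g x)"
        by (metis norm_triangle_mono norm_minus_cancel order_refl)
    qed (use f g ft gt in \<open>auto\<close>)
    also have "\<dots> = (\<integral>x. norm (f (x + h k) - g (x + h k)) \<partial>lborel)
        + (\<integral>x. norm (g (x + h k) - g x) \<partial>lborel) + (\<integral>x. norm (f x - g x) \<partial>lborel)"
      using f g ft gt by simp
    also have "(\<integral>x. norm (f (x + h k) - g (x + h k)) \<partial>lborel) = (\<integral>x. norm (f x - g x) \<partial>lborel)"
      by (rule lborel_integral_translate[of "\<lambda>x. norm (f x - g x)"]) simp
    finally have "(\<integral>x. norm (f (x + h k) - f x) \<partial>lborel) < e"
      using d K[OF that] by simp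
    moreover have "0 \<le> (\<integral>x. norm (f (x + h k) - f x) \<partial>lborel)" by simp
    ultimately show ?thesis by simp
  qed
  then show "\<exists>K. \<forall>k\<ge>K. norm ((\<integral>x. norm (f (x + h k) - f x) \<partial>lborel) - 0) < e" by blast
qed

text \<open>By invariance the L^1 difference is twice the measure of \<open>U\<close> minus twice
  the integral of the product of the two indicators. At points of \<open>U\<close> the product tends
  to 1 because \<open>U\<close> is open, elsewhere it is 0, so the boundary of \<open>U\<close>
  needs no attention.\<close>

lemma L1_translation_open:
  fixes U :: "'a::euclidean_space set"
  assumes U: "open U" and fin: "emeasure lborel U < \<infinity>" and h: "h \<longlonglongrightarrow> 0"
  shows "(\<lambda>k. \<integral>x. \<bar>indicat_real U (x + h k) - indicat_real U x\<bar> \<partial>lborel) \<longlonglongrightarrow> 0"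
proof -
  have [measurable]: "U \<in> sets borel" using U by simp
  have int: "integrable lborel (indicat_real U)" using fin by simp
  note intt = lborel_integrable_translate[OF int]
  have intp: "integrable lborel (\<lambda>x. indicat_real U x * indicat_real U (x + t))" for t
    by (rule Bochner_Integration.integrable_bound[OF int]) (auto simp: indicator_def)
  have eq: "(\<integral>x. \<bar>indicat_real U (x + t) - indicat_real U x\<bar> \<partial>lborel) =
      2 * (\<integral>x. indicat_real U x \<partial>lborel) - 2 * (\<integral>x. indicat_real U x * indicat_real U (x + t) \<partial>lborel)" for t
  proof -
    have "(\<integral>x. \<bar>indicat_real U (x + t) - indicat_real U x\<bar> \<partial>lborel) =
        (\<integral>x. indicat_real U (x + t) + indicat_real U x - 2 * (indicat_real U x * indicat_real U (x + t)) \<partial>lborel)"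
      by (rule Bochner_Integration.integral_cong) (auto simp: indicator_def)
    also have "\<dots> = (\<integral>x. indicat_real U (x + t) \<partial>lborel) + (\<integral>x. indicat_real U x \<partial>lborel)
        - 2 * (\<integral>x. indicat_real U x * indicat_real U (x + t) \<partial>lborel)"
      using int intt intp by simp
    finally show ?thesis using lborel_integral_translate[of "indicat_real U" t] by simp
  qed
  have "(\<lambda>k. \<integral>x. indicat_real U x * indicat_real U (x + h k) \<partial>lborel) \<longlonglongrightarrow> (\<integral>x. indicat_real U x \<partial>lborel)"
  proof (rule integral_dominated_convergence[where w="indicat_real U"])
    have "(\<lambda>k. indicat_real U x * indicat_real U (x + h k)) \<longlonglongrightarrow> indicat_real U x" for x
    proof (cases "x \<in> U")
      case True
      have "(\<lambda>k. x + h k) \<longlonglongrightarrow> x" using tendsto_add[OF tendsto_const h, of x] by simp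
      then have "\<forall>\<^sub>F k in sequentially. x + h k \<in> U" using topological_tendstoD U True by blast
      then have "\<forall>\<^sub>F k in sequentially. indicat_real U x * indicat_real U (x + h k) = indicat_real U x"
        using True by (auto elim!: eventually_mono)
      then show ?thesis by (rule tendsto_eventually)
    qed simp
    then show "AE x in lborel. (\<lambda>k. indicat_real U x * indicat_real U (x + h k)) \<longlonglongrightarrow> indicat_real U x"
      by simp
  qed (use int in \<open>auto simp: indicator_def\<close>)
  from tendsto_diff[OF tendsto_const tendsto_mult[OF tendsto_const this], of "2 * (\<integral>x. indicat_real U x \<partial>lborel)" 2]
  show ?thesis unfolding eq by simp
qed

text \<open>Induction over integrable functions: a Borel set is approximated from outside by open
  sets through regularity, and limits of simple functions are handled by dominated
  convergence.\<close>

lemma L1_translation: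
  fixes f :: "'a::euclidean_space \<Rightarrow> 'b::{banach, second_countable_topology}"
  assumes f: "integrable lborel f" and h: "h \<longlonglongrightarrow> 0"
  shows "(\<lambda>k. \<integral>x. norm (f (x + h k) - f x) \<partial>lborel) \<longlonglongrightarrow> 0"
  using f
proof (induction rule: integrable_induct)
  case (base A c)
  then have A [measurable]: "A \<in> sets borel" and fin: "emeasure lborel A < \<infinity>" by auto
  have intA: "integrable lborel (indicat_real A)" using fin by simp
  show ?case
  proof (rule L1_translation_approx)
    show "integrable lborel (\<lambda>x. indicat_real A x *\<^sub>R c)" using intA by simp
    fix e :: real assume e: "e > 0"
    \<comment> \<open>The added 1 covers the case that \<open>c\<close> is 0.\<close>
    define d where "d = e / (norm c + 1)"
    have nc: "norm c + 1 > 0" by (simp add: add_nonneg_pos)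
    have d: "d > 0" using e nc by (simp add: d_def)
    obtain U where U: "open U" "A \<subseteq> U" "emeasure lborel (U - A) < d"
      using outer_regular_lborel[OF A d] by blast
    have [measurable]: "U \<in> sets borel" using U by simp
    have "emeasure lborel U \<le> emeasure lborel (U - A) + emeasure lborel A"
      using U(2) by (subst plus_emeasure) (auto simp: Un_absorb2)
    also have "\<dots> < \<infinity>" using U(3) fin by (auto simp: less_top[symmetric] top_unique)
    finally have finU: "emeasure lborel U < \<infinity>" .
    have "(\<integral>x. norm (indicat_real A x *\<^sub>R c - indicat_real U x *\<^sub>R c) \<partial>lborel)
        = (\<integral>x. indicat_real (U - A) x * norm c \<partial>lborel)"
      using U(2) by (intro Bochner_Integration.integral_cong) (auto simp: indicator_def)
    also have "\<dots> = measure lborel (U - A) * norm c" by simp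
    also have "\<dots> < e"
    proof -
      have "measure lborel (U - A) \<le> d"
        using U(3) d unfolding measure_def by (auto intro!: enn2real_leI)
      then have "measure lborel (U - A) * norm c \<le> d * norm c" by (intro mult_right_mono) auto
      also have "\<dots> < d * (norm c + 1)" using d by simp
      also have "\<dots> = e" using nc by (simp add: d_def)
      finally show ?thesis .
    qed
    finally have 1: "(\<integral>x. norm (indicat_real A x *\<^sub>R c - indicat_real U x *\<^sub>R c) \<partial>lborel) < e" .
    have "(\<lambda>k. (\<integral>x. \<bar>indicat_real U (x + h k) - indicat_real U x\<bar> \<partial>lborel) * norm c) \<longlonglongrightarrow> 0 * norm c"
      by (intro tendsto_mult tendsto_const L1_translation_open U finU h)
    then have 2: "(\<lambda>k. \<integral>x. norm (indicat_real U (x + h k) *\<^sub>R c - indicat_real U x *\<^sub>R c) \<partial>lborel) \<longlonglongrightarrow> 0"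
      by (simp add: scaleR_diff_left[symmetric])
    show "\<exists>g. integrable lborel g \<and> (\<integral>x. norm (indicat_real A x *\<^sub>R c - g x) \<partial>lborel) < e \<and>
        (\<lambda>k. \<integral>x. norm (g (x + h k) - g x) \<partial>lborel) \<longlonglongrightarrow> 0"
      using finU 1 2 by (intro exI[of _ "\<lambda>x. indicat_real U x *\<^sub>R c"]) auto
  qed
next
  case (add f g)
  note [measurable] = borel_measurable_integrable[OF add.hyps(1)] borel_measurable_integrable[OF add.hyps(2)]
  show ?case
  proof (rule tendsto_sandwich[OF _ _ tendsto_const])
    show "(\<lambda>k. (\<integral>x. norm (f (x + h k) - f x) \<partial>lborel) + (\<integral>x. norm (g (x + h k) - g x) \<partial>lborel)) \<longlonglongrightarrow> 0"
      using tendsto_add[OF add.IH] by simp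
    have "(\<integral>x. norm (f (x + h k) + g (x + h k) - (f x + g x)) \<partial>lborel) \<le>
        (\<integral>x. norm (f (x + h k) - f x) \<partial>lborel) + (\<integral>x. norm (g (x + h k) - g x) \<partial>lborel)" for k
    proof -
      note int = add.hyps lborel_integrable_translate[OF add.hyps(1), of "h k"]
        lborel_integrable_translate[OF add.hyps(2), of "h k"]
      have "(\<integral>x. norm (f (x + h k) + g (x + h k) - (f x + g x)) \<partial>lborel) \<le>
          (\<integral>x. norm (f (x + h k) - f x) + norm (g (x + h k) - g x) \<partial>lborel)"
        by (rule integral_mono) (use int in \<open>auto intro: norm_diff_triangle_ineq\<close>)
      then show ?thesis using int by simp
    qed
    then show "\<forall>\<^sub>F k in sequentially. (\<integral>x. norm (f (x + h k) + g (x + h k) - (f x + g x)) \<partial>lborel) \<le>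
        (\<integral>x. norm (f (x + h k) - f x) \<partial>lborel) + (\<integral>x. norm (g (x + h k) - g x) \<partial>lborel)"
      by simp
  qed simp
next
  case (lim f s)
  show ?case
  proof (rule L1_translation_approx[OF \<open>integrable lborel f\<close>])
    fix e :: real assume e: "e > 0"
    note [measurable] = borel_measurable_integrable[OF lim.hyps(1)] borel_measurable_integrable[OF lim.hyps(4)]
    have "(\<lambda>i. \<integral>x. norm (f x - s i x) \<partial>lborel) \<longlonglongrightarrow> integral\<^sup>L (lborel :: 'a measure) (\<lambda>x. 0)"
    \<comment> \<open>The induction rule supplies approximations bounded by twice
      \<open>norm (f x)\<close>, so the differences are bounded by three times it.\<close>
    proof (rule integral_dominated_convergence[where w="\<lambda>x. 3 * norm (f x)"])
      have "(\<lambda>i. norm (f x - s i x)) \<longlonglongrightarrow> 0" for x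
        using tendsto_norm[OF tendsto_diff[OF tendsto_const lim.hyps(2)[of x]], of "f x"] by simp
      then show "AE x in lborel. (\<lambda>i. norm (f x - s i x)) \<longlonglongrightarrow> 0" by simp
      have "norm (norm (f x - s i x)) \<le> 3 * norm (f x)" for i x
        using norm_triangle_ineq4[of "f x" "s i x"] lim.hyps(3)[of x i] by simp
      then show "AE x in lborel. norm (norm (f x - s i x)) \<le> 3 * norm (f x)" for i by simp
    qed (use lim.hyps(4) in auto)
    from LIMSEQ_D[OF this e] obtain i where
      "norm ((\<integral>x. norm (f x - s i x) \<partial>lborel) - integral\<^sup>L (lborel :: 'a measure) (\<lambda>x. 0)) < e"
      by blast
    then have "(\<integral>x. norm (f x - s i x) \<partial>lborel) < e" by simp
    then show "\<exists>g. integrable lborel g \<and> (\<integral>x. norm (f x - g x) \<partial>lborel) < e \<and>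
        (\<lambda>k. \<integral>x. norm (g (x + h k) - g x) \<partial>lborel) \<longlonglongrightarrow> 0"
      using lim.hyps(1) lim.IH by blast
  qed
qed

section \<open>The Gaussian and its transform\<close>

definition gauss :: "'a::euclidean_space \<Rightarrow> real" where
  "gauss x = exp (- (norm x)\<^sup>2 / 2)"

lemma gauss_bounds [simp]: "0 < gauss x" "gauss x \<le> 1"
  by (simp_all add: gauss_def)

lemma gauss_measurable [measurable]: "gauss \<in> borel_measurable borel"
  unfolding gauss_def by measurable

text \<open>The integrand is a product over the coordinates, and each one-dimensional factor is, up
  to normalisation, the integrand of the characteristic function of the standard normal
  distribution, whose value is known.\<close>

lemma gauss_integrable_and_fourier:
  fixes \<xi> :: "'a::euclidean_space"
  shows "integrable lborel (\<lambda>x. exp (- \<i> * of_real (x \<bullet> \<xi>)) * of_real (gauss x))" (is ?int)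
    and "(\<integral>x. exp (- \<i> * of_real (x \<bullet> \<xi>)) * of_real (gauss x) \<partial>lborel) =
      of_real ((2 * pi) powr (real DIM('a) / 2) * gauss \<xi>)" (is ?eq)
proof -
  define e where "e t x = exp (- \<i> * of_real (t * x)) * of_real (exp (- x\<^sup>2 / 2))" for t x :: real
  have [measurable]: "e t \<in> borel_measurable borel" for t unfolding e_def by measurable
  have e_eq: "e t x = of_real (sqrt (2 * pi)) * (of_real (std_normal_density x) * iexp ((- t) * x))" for t x
    by (simp add: e_def std_normal_density_def field_simps)
  have iexp_int: "integrable lborel (\<lambda>x. of_real (std_normal_density x) * iexp (t * x))" for t
    by (rule Bochner_Integration.integrable_bound[OF integrable_normal_moment[of 1 0 0]])
      (auto simp: norm_mult)
  have e_int: "integrable lborel (e t)" for t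
    unfolding e_eq by (intro integrable_mult_right iexp_int)
  have e_val: "(\<integral>x. e t x \<partial>lborel) = of_real (sqrt (2 * pi) * exp (- t\<^sup>2 / 2))" for t
  proof -
    have "(\<integral>x. of_real (std_normal_density x) * iexp ((- t) * x) \<partial>lborel) = char std_normal_distribution (- t)"
      unfolding char_def by (subst integral_density) (auto simp: normal_density_nonneg scaleR_conv_of_real)
    also have "\<dots> = of_real (exp (- t\<^sup>2 / 2))" by (simp add: char_std_normal_distribution)
    finally show ?thesis unfolding e_eq by (simp del: of_real_minus of_real_mult add: of_real_mult[symmetric])
  qed
  interpret product_sigma_finite "\<lambda>_::'a. lborel :: real measure" ..
  let ?f = "\<lambda>x. exp (- \<i> * of_real (x \<bullet> \<xi>)) * complex_of_real (gauss x)"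
  have f_prod: "?f (\<Sum>b\<in>Basis. z b *\<^sub>R b) = (\<Prod>b\<in>Basis. e (\<xi> \<bullet> b) (z b))" for z :: "'a \<Rightarrow> real"
  proof -
    let ?x = "\<Sum>b\<in>Basis. z b *\<^sub>R b"
    have xb: "?x \<bullet> b = z b" if "b \<in> Basis" for b using that by simp
    have "?x \<bullet> \<xi> = (\<Sum>b\<in>Basis. (\<xi> \<bullet> b) * z b)"
      by (subst euclidean_inner) (intro sum.cong refl, simp add: xb mult.commute)
    moreover have "(norm ?x)\<^sup>2 = (\<Sum>b\<in>Basis. (z b)\<^sup>2)"
      unfolding power2_norm_eq_inner
      by (subst euclidean_inner) (intro sum.cong refl, simp add: xb power2_eq_square)
    ultimately show ?thesis
      by (simp add: e_def gauss_def prod.distrib exp_sum[symmetric] sum_distrib_left sum_negf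
          sum_divide_distrib of_real_exp[symmetric] of_real_prod[symmetric] del: of_real_exp of_real_prod)
  qed
  have m: "(\<lambda>z::'a \<Rightarrow> real. \<Sum>b\<in>Basis. z b *\<^sub>R b) \<in> measurable (Pi\<^sub>M Basis (\<lambda>_. lborel)) borel"
    by measurable
  show ?int
    by (subst lborel_eq, subst integrable_distr_eq[OF m])
      (auto simp only: f_prod intro!: product_integrable_prod e_int finite_Basis, measurable)
  have "(\<integral>x. ?f x \<partial>lborel) = (\<integral>z. (\<Prod>b\<in>Basis. e (\<xi> \<bullet> b) (z b)) \<partial>Pi\<^sub>M Basis (\<lambda>_. lborel))"
    by (subst lborel_eq, subst integral_distr[OF m]) (measurable, simp only: f_prod)
  also have "\<dots> = (\<Prod>b\<in>Basis. of_real (sqrt (2 * pi) * exp (- (\<xi> \<bullet> b)\<^sup>2 / 2)))"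
    by (subst product_integral_prod) (auto simp: e_int e_val)
  also have "\<dots> = of_real ((2 * pi) powr (real DIM('a) / 2) * gauss \<xi>)"
  proof -
    have "sqrt (2 * pi) ^ DIM('a) = (2 * pi) powr (real DIM('a) / 2)"
      by (simp add: powr_half_sqrt[symmetric] powr_power)
    moreover have "(\<Prod>b\<in>Basis. exp (- (\<xi> \<bullet> b)\<^sup>2 / 2)) = gauss \<xi>"
      unfolding gauss_def power2_norm_eq_inner
      by (subst (2) euclidean_inner) (simp add: exp_sum[symmetric] sum_negf sum_divide_distrib power2_eq_square)
    ultimately show ?thesis
      by (simp add: of_real_prod[symmetric] prod.distrib del: of_real_prod of_real_mult)
  qed
  finally show ?eq .
qed

lemma gauss_integrable: "integrable lborel (gauss :: 'a::euclidean_space \<Rightarrow> real)"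
  using integrable_norm[OF gauss_integrable_and_fourier(1)[of "0::'a"]]
  by (simp add: norm_mult abs_of_pos[OF gauss_bounds(1)])

lemma gauss_integral: "integral\<^sup>L lborel (gauss :: 'a::euclidean_space \<Rightarrow> real) = (2 * pi) powr (real DIM('a) / 2)"
proof -
  have "gauss (0::'a) = 1" by (simp add: gauss_def)
  then show ?thesis
    using gauss_integrable_and_fourier(2)[of "0::'a"] by (simp add: of_real_eq_iff del: of_real_mult)
qed


text \<open>As \<open>s\<close> tends to 0 the Gaussian in the frequency widens to the constant 1,
  while its transform concentrates at \<open>z\<close> = 0 with constant mass. This is the
  approximate identity behind Plancherel's theorem.\<close>

lemma gauss_scaled_fourier:
  fixes z :: "'a::euclidean_space"
  assumes s: "s > 0"
  shows "(\<integral>\<xi>. exp (- \<i> * of_real (z \<bullet> \<xi>)) * of_real (gauss (s *\<^sub>R \<xi>)) \<partial>lborel) =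
      of_real ((2 * pi) powr (real DIM('a) / 2) / s ^ DIM('a) * gauss (z /\<^sub>R s))"
proof -
  let ?g = "\<lambda>\<eta>. exp (- \<i> * of_real (\<eta> \<bullet> (z /\<^sub>R s))) * complex_of_real (gauss \<eta>)"
  have "(\<integral>\<eta>. ?g \<eta> \<partial>lborel) = \<bar>s\<bar> ^ DIM('a) *\<^sub>R (\<integral>\<xi>. ?g (0 + s *\<^sub>R \<xi>) \<partial>lborel)"
    using s by (intro lborel_integral_affine) auto
  moreover have "?g (0 + s *\<^sub>R \<xi>) = exp (- \<i> * of_real (z \<bullet> \<xi>)) * of_real (gauss (s *\<^sub>R \<xi>))" for \<xi>
  proof -
    have "(s *\<^sub>R \<xi>) \<bullet> (z /\<^sub>R s) = (s * inverse s) * (z \<bullet> \<xi>)" by (simp add: inner_commute)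
    then have "(s *\<^sub>R \<xi>) \<bullet> (z /\<^sub>R s) = z \<bullet> \<xi>" using s by simp
    then show ?thesis by (simp only: add_0_left)
  qed
  ultimately have "of_real ((2 * pi) powr (real DIM('a) / 2) * gauss (z /\<^sub>R s)) = s ^ DIM('a) *\<^sub>R
      (\<integral>\<xi>. exp (- \<i> * of_real (z \<bullet> \<xi>)) * complex_of_real (gauss (s *\<^sub>R \<xi>)) \<partial>lborel)"
    using s by (simp only: gauss_integrable_and_fourier(2) abs_of_pos)
  from arg_cong[OF this, of "scaleR (1 / s ^ DIM('a))"] show ?thesis
    using s by (simp add: scaleR_conv_of_real field_simps)
qed

section \<open>The scalar transform on L^1 and Plancherel's identity\<close>

lemma Fubini_kernel:
  fixes f :: "'a::euclidean_space \<Rightarrow> complex" and g :: "'b::euclidean_space \<Rightarrow> complex"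
  assumes f: "integrable lborel f" and g: "integrable lborel g"
    and k [measurable]: "(\<lambda>(x, y). k x y) \<in> borel_measurable (borel \<Otimes>\<^sub>M borel)"
    and bound: "\<And>x y. norm (k x y) \<le> 1"
  shows "(\<integral>x. f x * (\<integral>y. k x y * g y \<partial>lborel) \<partial>lborel) = (\<integral>y. (\<integral>x. k x y * f x \<partial>lborel) * g y \<partial>lborel)"
proof -
  note [measurable] = borel_measurable_integrable[OF f] borel_measurable_integrable[OF g]
  have [measurable]: "k x \<in> borel_measurable borel" for x
    using measurable_compose[OF measurable_Pair1'[of x borel borel] k] by simp
  have k2 [measurable]: "(\<lambda>x. k x y) \<in> borel_measurable borel" for y
    using measurable_compose[OF measurable_Pair2'[of y borel borel] k] by simp
  have kg: "integrable lborel (\<lambda>y. k x y * g y)" for x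
    using mult_right_mono[OF bound norm_ge_zero]
    by (intro Bochner_Integration.integrable_bound[OF g]) (auto simp: norm_mult)
  have bnd: "norm (f x * (k x y * g y)) \<le> norm (f x) * norm (g y)" for x y
    using mult_left_mono[OF mult_right_mono[OF bound[of x y] norm_ge_zero[of "g y"]] norm_ge_zero[of "f x"]]
    by (simp add: norm_mult)
  have "integrable (lborel \<Otimes>\<^sub>M lborel) (\<lambda>(x, y). f x * (k x y * g y))"
  proof (rule Bochner_Integration.integrable_bound)
    show "integrable (lborel \<Otimes>\<^sub>M lborel) (\<lambda>(x, y). norm (f x) * norm (g y))"
      using f g by (intro lborel_pair.Fubini_integrable) auto
    show "AE x in lborel \<Otimes>\<^sub>M lborel. norm (case x of (x, y) \<Rightarrow> f x * (k x y * g y)) \<le>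
        norm (case x of (x, y) \<Rightarrow> norm (f x) * norm (g y))"
      using bnd by (auto simp: split_beta)
  qed measurable
  from lborel_pair.Fubini_integral[OF this]
  have "(\<integral>x. \<integral>y. f x * (k x y * g y) \<partial>lborel \<partial>lborel) = (\<integral>y. \<integral>x. f x * (k x y * g y) \<partial>lborel \<partial>lborel)"
    by simp
  moreover have "(\<integral>x. f x * (k x y * g y) \<partial>lborel) = (\<integral>x. k x y * f x \<partial>lborel) * g y" for y
  proof -
    have "(\<integral>x. f x * (k x y * g y) \<partial>lborel) = (\<integral>x. (k x y * f x) * g y \<partial>lborel)"
      by (simp add: ac_simps)
    then show ?thesis by simp
  qed
  ultimately show ?thesis by simp
qed

text \<open>Same unitary normalisation as \<open>fourier_L1\<close>, but for complex scalar
  functions: it is applied to the components of a function and also, in the other direction, to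
  complex functions of the frequency.\<close>

definition FT :: "(real ^ 'n \<Rightarrow> complex) \<Rightarrow> real ^ 'n \<Rightarrow> complex" where
  "FT f \<xi> = (2 * pi) powr (- real CARD('n) / 2) *\<^sub>R
     (\<integral>x. exp (- \<i> * complex_of_real (x \<bullet> \<xi>)) * f x \<partial>lborel)"

lemma norm_exp_ii [simp]: "norm (exp (- (\<i> * complex_of_real t))) = 1" "norm (exp (\<i> * complex_of_real t)) = 1"
  by (simp_all add: norm_exp_eq_Re)

lemma FT_measurable [measurable (raw)]:
  assumes f [measurable]: "f \<in> borel_measurable borel"
  shows "FT f \<in> borel_measurable borel"
proof -
  have "(\<lambda>\<xi>. \<integral>x. exp (- \<i> * complex_of_real (x \<bullet> \<xi>)) * f x \<partial>lborel) \<in> borel_measurable borel"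
    by (rule lborel.borel_measurable_lebesgue_integral) measurable
  then show ?thesis unfolding FT_def by measurable
qed

lemma FT_integrand_integrable:
  assumes f: "integrable lborel f"
  shows "integrable lborel (\<lambda>x. exp (- \<i> * complex_of_real (x \<bullet> \<xi>)) * f x)"
proof (rule Bochner_Integration.integrable_bound[OF f])
  note [measurable] = borel_measurable_integrable[OF f]
  show "(\<lambda>x. exp (- \<i> * complex_of_real (x \<bullet> \<xi>)) * f x) \<in> borel_measurable lborel" by measurable
qed (simp add: norm_mult)

lemma FT_bound:
  fixes f :: "real ^ 'n \<Rightarrow> complex"
  assumes f: "integrable lborel f"
  shows "norm (FT f \<xi>) \<le> (2 * pi) powr (- real CARD('n) / 2) * (\<integral>x. norm (f x) \<partial>lborel)"
proof -
  have "norm (\<integral>x. exp (- \<i> * complex_of_real (x \<bullet> \<xi>)) * f x \<partial>lborel) \<le>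
      (\<integral>x. norm (exp (- \<i> * complex_of_real (x \<bullet> \<xi>)) * f x) \<partial>lborel)"
    by (rule integral_norm_bound)
  then show ?thesis unfolding FT_def by (auto simp: norm_mult intro!: mult_left_mono)
qed

text \<open>Fubini, with a kernel that is symmetric in position and frequency.\<close>

lemma FT_multiplication:
  fixes f g :: "real ^ 'n \<Rightarrow> complex"
  assumes f: "integrable lborel f" and g: "integrable lborel g"
  shows "(\<integral>x. FT g x * f x \<partial>lborel) = (\<integral>\<xi>. g \<xi> * FT f \<xi> \<partial>lborel)"
proof -
  have "(\<integral>x. f x * (\<integral>y. exp (- \<i> * complex_of_real (y \<bullet> x)) * g y \<partial>lborel) \<partial>lborel) =
      (\<integral>y. (\<integral>x. exp (- \<i> * complex_of_real (y \<bullet> x)) * f x \<partial>lborel) * g y \<partial>lborel)"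
    by (rule Fubini_kernel[OF f g]) (simp_all add: split_beta')
  then show ?thesis
    unfolding FT_def by (simp add: inner_commute ac_simps)
qed

text \<open>Split \<open>f\<close> by height. Where |f| <= M, continuity of translations in L^1
  controls the difference; the remaining part \<open>tail M\<close> is small in L^2 and is paired by
  Cauchy-Schwarz with a difference of norm at most twice that of \<open>f\<close>.\<close>

lemma autocorrelation_tendsto:
  fixes f :: "real ^ 'n \<Rightarrow> complex"
  assumes f: "integrable lborel f" and f2: "L2_fun f" and h: "h \<longlonglongrightarrow> 0"
  shows "(\<lambda>k. \<integral>x. f x * cnj (f (x + h k)) \<partial>lborel) \<longlonglongrightarrow> of_real ((L2_norm f)\<^sup>2)"
proof -
  note [measurable] = borel_measurable_integrable[OF f]
  have ft2: "L2_fun (\<lambda>x. f (x + t))" for t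
    using lborel_integrable_translate[OF L2_fun_square_integrable[OF f2], of t] by (simp add: L2_fun_def)
  have ftn: "L2_norm (\<lambda>x. f (x + t)) = L2_norm f" for t
    unfolding L2_norm_def by (subst lborel_integral_translate[of "\<lambda>x. (norm (f x))\<^sup>2"]) auto
  have d2: "L2_fun (\<lambda>x. f (x + t) - f x)" for t by (intro L2_fun_diff ft2 f2)
  have dn: "L2_norm (\<lambda>x. f (x + t) - f x) \<le> 2 * L2_norm f" for t
    using L2_norm_triangle[OF ft2[of t] L2_fun_scaleR[OF f2, of "-1"]] L2_norm_scaleR[of "-1" f]
    by (simp add: ftn)
  define tail where "tail M x = (if norm (f x) \<le> M then 0 else f x)" for M :: real and x
  have [measurable]: "tail M \<in> borel_measurable borel" for M unfolding tail_def by measurable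
  have tail2: "L2_fun (tail M)" for M
    by (rule L2_fun_bound[OF f2, where C=1]) (auto simp: tail_def)
  have tail0: "((\<lambda>M. L2_norm (tail M)) \<longlongrightarrow> 0) at_top"
  proof (rule L2_norm_tendsto_zero_at_top[OF f2])
    fix x
    have "\<forall>\<^sub>F M in at_top. tail M x = 0"
      using eventually_ge_at_top[of "norm (f x)"] by eventually_elim (simp add: tail_def)
    then show "((\<lambda>M. tail M x) \<longlongrightarrow> 0) at_top" by (rule tendsto_eventually)
  qed (auto simp: tail_def)
  have key: "norm ((\<integral>x. f x * cnj (f (x + t)) \<partial>lborel) - of_real ((L2_norm f)\<^sup>2)) \<le>
      M * (\<integral>x. norm (f (x + t) - f x) \<partial>lborel) + L2_norm (tail M) * (2 * L2_norm f)" if M: "M > 0" for t M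
  proof -
    have i1: "integrable lborel (\<lambda>x. f x * cnj (f (x + t)))"
      by (rule L2_integrable_bound[OF f2 ft2[of t]]) (auto simp: norm_mult)
    have i2: "integrable lborel (\<lambda>x. f x * cnj (f x))"
      by (rule L2_integrable_bound[OF f2 f2]) (auto simp: norm_mult)
    have i3: "integrable lborel (\<lambda>x. norm (f (x + t) - f x))"
      using f lborel_integrable_translate[OF f, of t] by simp
    have i4: "integrable lborel (\<lambda>x. norm (tail M x) * norm (f (x + t) - f x))"
      by (rule L2_integrable_norm_mult[OF tail2 d2])
    have "of_real ((L2_norm f)\<^sup>2) = (\<integral>x. f x * cnj (f x) \<partial>lborel)"
      unfolding L2_norm_square complex_norm_square[symmetric] of_real_power[symmetric] integral_complex_of_real ..
    then have "(\<integral>x. f x * cnj (f (x + t)) \<partial>lborel) - of_real ((L2_norm f)\<^sup>2) =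
        (\<integral>x. f x * cnj (f (x + t)) - f x * cnj (f x) \<partial>lborel)"
      using i1 i2 by simp
    also have "norm \<dots> \<le> (\<integral>x. norm (f x * cnj (f (x + t)) - f x * cnj (f x)) \<partial>lborel)"
      by (rule integral_norm_bound)
    also have "\<dots> \<le> (\<integral>x. M * norm (f (x + t) - f x) + norm (tail M x) * norm (f (x + t) - f x) \<partial>lborel)"
    proof (rule integral_mono)
      fix x
      have "norm (f x * cnj (f (x + t)) - f x * cnj (f x)) = norm (f x) * norm (f (x + t) - f x)"
        by (simp add: norm_mult right_diff_distrib[symmetric] flip: complex_cnj_diff)
      also have "\<dots> \<le> (M + norm (tail M x)) * norm (f (x + t) - f x)"
        using M by (intro mult_right_mono) (auto simp: tail_def)
      finally show "norm (f x * cnj (f (x + t)) - f x * cnj (f x)) \<le>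
          M * norm (f (x + t) - f x) + norm (tail M x) * norm (f (x + t) - f x)"
        by (simp add: algebra_simps)
    qed (use i1 i2 i3 i4 in auto)
    also have "\<dots> = M * (\<integral>x. norm (f (x + t) - f x) \<partial>lborel) + (\<integral>x. norm (tail M x) * norm (f (x + t) - f x) \<partial>lborel)"
      using i3 i4 by simp
    also have "(\<integral>x. norm (tail M x) * norm (f (x + t) - f x) \<partial>lborel) \<le>
        L2_norm (tail M) * L2_norm (\<lambda>x. f (x + t) - f x)"
      by (rule L2_integral_norm_mult_le[OF tail2 d2])
    also have "\<dots> \<le> L2_norm (tail M) * (2 * L2_norm f)"
      by (intro mult_left_mono dn) simp
    finally show ?thesis by simp
  qed
  show ?thesis
  proof (rule LIMSEQ_I)
    fix e :: real assume e: "e > 0"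
    have "((\<lambda>M. L2_norm (tail M) * (2 * L2_norm f)) \<longlongrightarrow> 0 * (2 * L2_norm f)) at_top"
      by (intro tendsto_intros tail0)
    then have "\<forall>\<^sub>F M in at_top. L2_norm (tail M) * (2 * L2_norm f) < e / 2"
      using e by (intro order_tendstoD(2)) auto
    then obtain M where M: "M > 0" "L2_norm (tail M) * (2 * L2_norm f) < e / 2"
      using eventually_happens'[OF _ eventually_conj[OF _ eventually_gt_at_top[of 0]]]
        trivial_limit_at_top_linorder by (metis (no_types, lifting))
    have "(\<lambda>k. M * (\<integral>x. norm (f (x + h k) - f x) \<partial>lborel)) \<longlonglongrightarrow> M * 0"
      by (intro tendsto_intros L1_translation[OF f h])
    from LIMSEQ_D[OF this, of "e / 2"] obtain K where
      K: "\<And>k. k \<ge> K \<Longrightarrow> M * (\<integral>x. norm (f (x + h k) - f x) \<partial>lborel) < e / 2"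
      using e by fastforce
    have "norm ((\<integral>x. f x * cnj (f (x + h k)) \<partial>lborel) - of_real ((L2_norm f)\<^sup>2)) < e" if "k \<ge> K" for k
      using key[OF M(1), of "h k"] K[OF that] M(2) by linarith
    then show "\<exists>K. \<forall>k\<ge>K. norm ((\<integral>x. f x * cnj (f (x + h k)) \<partial>lborel) - of_real ((L2_norm f)\<^sup>2)) < e"
      by blast
  qed
qed


text \<open>The squared transform is integrated against ever wider Gaussians; the multiplication formula turns
  these integrals into Gaussian means of the autocorrelation of \<open>f\<close> concentrating at \<open>0\<close>.\<close>

lemma Plancherel_L1_L2:
  fixes f :: "real ^ 'n \<Rightarrow> complex"
  assumes f: "integrable lborel f" and f2: "L2_fun f"
  shows "L2_fun (FT f)" and "L2_norm (FT f) = L2_norm f"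
proof -
  note [measurable] = borel_measurable_integrable[OF f]
  define c0 where "c0 = (2 * pi) powr (- real CARD('n) / 2)"
  have c0: "c0 > 0" by (simp add: c0_def)
  have c0_gauss: "c0 * (2 * pi) powr (real DIM(real ^ 'n) / 2) = 1"
    by (simp add: c0_def powr_add[symmetric])
  define s where "s k = 1 / real (Suc k)" for k
  have s: "s k > 0" for k by (simp add: s_def)
  have s0: "s \<longlonglongrightarrow> 0" unfolding s_def using LIMSEQ_Suc[OF lim_const_over_n[of 1]] by simp
  define B where "B = c0 * (\<integral>x. norm (f x) \<partial>lborel)"
  have FTB: "norm (FT f \<xi>) \<le> B" for \<xi> unfolding B_def c0_def by (rule FT_bound[OF f])
  have gs_int: "integrable lborel (\<lambda>\<xi>::real ^ 'n. gauss (s k *\<^sub>R \<xi>))" for k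
    using lborel_integrable_affine[OF gauss_integrable, of "s k" 0] s[of k] by simp
  have B0: "B \<ge> 0" using order_trans[OF norm_ge_zero FTB] .
  have gs2: "integrable lborel (\<lambda>\<xi>. of_real (gauss (s k *\<^sub>R \<xi>)) * cnj (FT f \<xi>))" for k
  proof (rule Bochner_Integration.integrable_bound)
    show "integrable lborel (\<lambda>\<xi>::real^'n. B * gauss (s k *\<^sub>R \<xi>))" using gs_int[of k] by simp
    show "AE \<xi> in lborel. norm (of_real (gauss (s k *\<^sub>R \<xi>)) * cnj (FT f \<xi>)) \<le> norm (B * gauss (s k *\<^sub>R \<xi>))"
    proof (rule AE_I2)
      fix \<xi>
      have "norm (of_real (gauss (s k *\<^sub>R \<xi>)) * cnj (FT f \<xi>)) = norm (FT f \<xi>) * gauss (s k *\<^sub>R \<xi>)"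
        by (simp add: norm_mult abs_of_pos[OF gauss_bounds(1)] mult.commute)
      also have "\<dots> \<le> B * gauss (s k *\<^sub>R \<xi>)"
        by (intro mult_right_mono FTB less_imp_le gauss_bounds)
      finally show "norm (of_real (gauss (s k *\<^sub>R \<xi>)) * cnj (FT f \<xi>)) \<le> norm (B * gauss (s k *\<^sub>R \<xi>))"
        by simp
    qed
  qed measurable
  let ?E = "\<lambda>\<xi> k. gauss (s k *\<^sub>R \<xi>) * (norm (FT f \<xi>))\<^sup>2"
  \<comment> \<open>The autocorrelation of \<open>f\<close>; it has no relation to the decay rate
    \<open>rho\<close>.\<close>
  define \<rho> where "\<rho> v = (\<integral>x. f x * cnj (f (x + v)) \<partial>lborel)" for v
  have ft2: "L2_fun (\<lambda>x. f (x + t))" for t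
    using lborel_integrable_translate[OF L2_fun_square_integrable[OF f2], of t] by (simp add: L2_fun_def)
  have ftn: "L2_norm (\<lambda>x. f (x + t)) = L2_norm f" for t
    unfolding L2_norm_def by (subst lborel_integral_translate[of "\<lambda>x. (norm (f x))\<^sup>2"]) auto
  have \<rho>_bound: "norm (\<rho> v) \<le> (L2_norm f)\<^sup>2" for v
    unfolding \<rho>_def power2_eq_square
    using L2_integral_norm_le[OF f2 ft2[of v], of "\<lambda>x. f x * cnj (f (x + v))"] by (simp add: norm_mult ftn)
  have [measurable]: "\<rho> \<in> borel_measurable borel"
    unfolding \<rho>_def by (rule lborel.borel_measurable_lebesgue_integral) measurable
  have FTcnj: "cnj (FT f \<xi>) = c0 *\<^sub>R (\<integral>y. exp (\<i> * complex_of_real (y \<bullet> \<xi>)) * cnj (f y) \<partial>lborel)" for \<xi>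
    unfolding FT_def c0_def complex_cnj_scaleR Bochner_Integration.integral_cnj[symmetric] complex_cnj_mult exp_cnj by simp
  define P where "P = (2 * pi) powr (real DIM(real ^ 'n) / 2)"
  have c0P: "c0 * P = 1" using c0_gauss by (simp add: P_def)
  \<comment> \<open>Fubini makes the left side a convolution with the concentrating kernel of
    \<open>gauss_scaled_fourier\<close>. The substitution y = x - s w then moves the dependence on
    \<open>k\<close> from the kernel into the argument of \<open>f\<close>.\<close>
  have step1: "FT (\<lambda>\<xi>. of_real (gauss (s k *\<^sub>R \<xi>)) * cnj (FT f \<xi>)) x =
      c0 *\<^sub>R (\<integral>w. of_real (gauss w) * cnj (f (x - s k *\<^sub>R w)) \<partial>lborel)" for x k
  proof -
    let ?a = "\<lambda>\<xi>. exp (- \<i> * complex_of_real (\<xi> \<bullet> x)) * of_real (gauss (s k *\<^sub>R \<xi>))"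
    have ka: "exp (\<i> * complex_of_real (y \<bullet> \<xi>)) * ?a \<xi> =
        exp (- \<i> * of_real ((x - y) \<bullet> \<xi>)) * of_real (gauss (s k *\<^sub>R \<xi>))" for y \<xi>
      by (simp add: inner_diff_left inner_commute[of \<xi> x] exp_add[symmetric] right_diff_distrib mult.assoc[symmetric])
    have "(\<integral>\<xi>. exp (- \<i> * complex_of_real (\<xi> \<bullet> x)) * (of_real (gauss (s k *\<^sub>R \<xi>)) * cnj (FT f \<xi>)) \<partial>lborel) =
        c0 *\<^sub>R (\<integral>\<xi>. ?a \<xi> * (\<integral>y. exp (\<i> * complex_of_real (y \<bullet> \<xi>)) * cnj (f y) \<partial>lborel) \<partial>lborel)"
      unfolding FTcnj by (simp add: mult.assoc)
    also have "(\<integral>\<xi>. ?a \<xi> * (\<integral>y. exp (\<i> * complex_of_real (y \<bullet> \<xi>)) * cnj (f y) \<partial>lborel) \<partial>lborel) =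
        (\<integral>y. (\<integral>\<xi>. exp (\<i> * complex_of_real (y \<bullet> \<xi>)) * ?a \<xi> \<partial>lborel) * cnj (f y) \<partial>lborel)"
    proof (rule Fubini_kernel)
      show "integrable lborel ?a"
        by (rule FT_integrand_integrable) (use gs_int in simp)
      show "integrable lborel (\<lambda>y. cnj (f y))" using f by simp
      show "(\<lambda>(\<xi> :: real ^ 'n, y :: real ^ 'n). exp (\<i> * complex_of_real (y \<bullet> \<xi>))) \<in> borel_measurable (borel \<Otimes>\<^sub>M borel)"
        unfolding split_beta' by measurable
    qed simp
    also have "\<dots> = (\<integral>y. of_real (P / s k ^ CARD('n) * gauss ((x - y) /\<^sub>R s k)) * cnj (f y) \<partial>lborel)"
      unfolding ka gauss_scaled_fourier[OF s] P_def by simp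
    also have "\<dots> = \<bar>- s k\<bar> ^ DIM(real ^ 'n) *\<^sub>R
        (\<integral>w. of_real (P / s k ^ CARD('n) * gauss ((x - (x + (- s k) *\<^sub>R w)) /\<^sub>R s k)) * cnj (f (x + (- s k) *\<^sub>R w)) \<partial>lborel)"
      using s[of k] by (intro lborel_integral_affine) auto
    also have "\<dots> = s k ^ CARD('n) *\<^sub>R (\<integral>w. of_real (P / s k ^ CARD('n)) * (of_real (gauss w) * cnj (f (x - s k *\<^sub>R w))) \<partial>lborel)"
      using s[of k] by (simp add: mult.assoc)
    also have "\<dots> = P *\<^sub>R (\<integral>w. of_real (gauss w) * cnj (f (x - s k *\<^sub>R w)) \<partial>lborel)"
      using s[of k] unfolding integral_mult_right_zero by (simp add: scaleR_conv_of_real)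
    finally show ?thesis
      unfolding FT_def c0_def[symmetric] using c0P by simp
  qed
  \<comment> \<open>Absolute integrability of the double integrand comes from Cauchy-Schwarz in
    \<open>x\<close>, which leaves an integrable Gaussian in \<open>w\<close>.\<close>
  have step3: "(\<integral>x. (\<integral>w. of_real (gauss w) * cnj (f (x - s k *\<^sub>R w)) \<partial>lborel) * f x \<partial>lborel) =
      (\<integral>w. of_real (gauss w) * \<rho> ((- s k) *\<^sub>R w) \<partial>lborel)" for k
  proof -
    let ?h = "\<lambda>(w, x). of_real (gauss w) * cnj (f (x - s k *\<^sub>R w)) * f x"
    have m: "?h \<in> borel_measurable (lborel \<Otimes>\<^sub>M lborel)"
      unfolding split_beta' by measurable
    have inner: "integrable lborel (\<lambda>x. ?h (w, x))" for w
    proof -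
      have "integrable lborel (\<lambda>x. cnj (f (x + (- s k) *\<^sub>R w)) * f x)"
        by (rule L2_integrable_bound[OF ft2[of "(- s k) *\<^sub>R w"] f2]) (auto simp: norm_mult)
      then show ?thesis by (simp add: mult.assoc)
    qed
    have "integrable (lborel \<Otimes>\<^sub>M lborel) ?h"
    proof (rule lborel_pair.Fubini_integrable[OF m])
      show "integrable lborel (\<lambda>w. \<integral>x. norm (?h (w, x)) \<partial>lborel)"
      proof (rule Bochner_Integration.integrable_bound)
        show "integrable lborel (\<lambda>w::real^'n. (L2_norm f)\<^sup>2 * gauss w)" using gauss_integrable[where 'a="real ^ 'n"] by simp
        show "(\<lambda>w. \<integral>x. norm (?h (w, x)) \<partial>lborel) \<in> borel_measurable lborel"
          using m by (intro lborel.borel_measurable_lebesgue_integral) (simp add: split_beta')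
        have "(\<integral>x. norm (?h (w, x)) \<partial>lborel) \<le> (L2_norm f)\<^sup>2 * gauss w" for w
        proof -
          have "(\<integral>x. norm (?h (w, x)) \<partial>lborel) = gauss w * (\<integral>x. norm (f (x + (- s k) *\<^sub>R w)) * norm (f x) \<partial>lborel)"
            by (simp add: norm_mult mult.assoc abs_of_pos[OF gauss_bounds(1)])
          also have "\<dots> \<le> gauss w * (L2_norm f * L2_norm f)"
            using L2_integral_norm_mult_le[OF ft2[of "(- s k) *\<^sub>R w"] f2] ftn[of "(- s k) *\<^sub>R w"]
            by (intro mult_left_mono) (auto intro: less_imp_le)
          finally show ?thesis by (simp add: power2_eq_square mult.commute)
        qed
        then show "AE w in lborel. norm (\<integral>x. norm (?h (w, x)) \<partial>lborel) \<le> norm ((L2_norm f)\<^sup>2 * gauss w)"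
          by (intro AE_I2) (simp add: abs_of_pos[OF gauss_bounds(1)] abs_mult)
      qed
      show "AE w in lborel. integrable lborel (\<lambda>x. ?h (w, x))" using inner by simp
    qed
    then have "integrable (lborel \<Otimes>\<^sub>M lborel) (\<lambda>(w, x). of_real (gauss w) * cnj (f (x - s k *\<^sub>R w)) * f x)" .
    from lborel_pair.Fubini_integral[OF this]
    have "(\<integral>x. \<integral>w. of_real (gauss w) * cnj (f (x - s k *\<^sub>R w)) * f x \<partial>lborel \<partial>lborel) =
        (\<integral>w. \<integral>x. of_real (gauss w) * cnj (f (x - s k *\<^sub>R w)) * f x \<partial>lborel \<partial>lborel)" .
    moreover have "(\<integral>x. of_real (gauss w) * cnj (f (x - s k *\<^sub>R w)) * f x \<partial>lborel) =
        of_real (gauss w) * \<rho> ((- s k) *\<^sub>R w)" for w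
    proof -
      have "(\<integral>x. of_real (gauss w) * cnj (f (x - s k *\<^sub>R w)) * f x \<partial>lborel) =
          (\<integral>x. of_real (gauss w) * (f x * cnj (f (x + (- s k) *\<^sub>R w))) \<partial>lborel)"
        by (simp add: ac_simps)
      then show ?thesis unfolding \<rho>_def by simp
    qed
    ultimately show ?thesis by simp
  qed
  have E_int: "integrable lborel (\<lambda>\<xi>. ?E \<xi> k)" for k
  proof (rule Bochner_Integration.integrable_bound)
    show "integrable lborel (\<lambda>\<xi>::real^'n. B\<^sup>2 * gauss (s k *\<^sub>R \<xi>))" using gs_int[of k] by simp
    have "?E \<xi> k \<le> B\<^sup>2 * gauss (s k *\<^sub>R \<xi>)" for \<xi>
      using mult_left_mono[OF power_mono[OF FTB[of \<xi>] norm_ge_zero, of 2] less_imp_le[OF gauss_bounds(1)[of "s k *\<^sub>R \<xi>"]]]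
      by (simp add: mult.commute)
    then show "AE \<xi> in lborel. norm (?E \<xi> k) \<le> norm (B\<^sup>2 * gauss (s k *\<^sub>R \<xi>))"
      by (intro AE_I2) (simp add: abs_mult abs_of_pos[OF gauss_bounds(1)])
  qed measurable
  have E_val: "complex_of_real (\<integral>\<xi>. ?E \<xi> k \<partial>lborel) =
      c0 *\<^sub>R (\<integral>w. of_real (gauss w) * \<rho> ((- s k) *\<^sub>R w) \<partial>lborel)" for k
  proof -
    have "complex_of_real (\<integral>\<xi>. ?E \<xi> k \<partial>lborel) = (\<integral>\<xi>. (of_real (gauss (s k *\<^sub>R \<xi>)) * cnj (FT f \<xi>)) * FT f \<xi> \<partial>lborel)"
      unfolding integral_complex_of_real[symmetric]
      by (intro Bochner_Integration.integral_cong refl)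
        (simp only: of_real_mult complex_norm_square mult.assoc mult.commute[of "FT f _"])
    also have "\<dots> = (\<integral>x. FT (\<lambda>\<xi>. of_real (gauss (s k *\<^sub>R \<xi>)) * cnj (FT f \<xi>)) x * f x \<partial>lborel)"
      by (rule FT_multiplication[OF f gs2, symmetric])
    also have "\<dots> = c0 *\<^sub>R (\<integral>x. (\<integral>w. of_real (gauss w) * cnj (f (x - s k *\<^sub>R w)) \<partial>lborel) * f x \<partial>lborel)"
      unfolding step1 by simp
    finally show ?thesis unfolding step3 .
  qed
  have "(\<lambda>k. \<integral>w. of_real (gauss w) * \<rho> ((- s k) *\<^sub>R w) \<partial>lborel) \<longlonglongrightarrow>
      (\<integral>w. of_real (gauss (w::real^'n)) * of_real ((L2_norm f)\<^sup>2) \<partial>lborel)"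
  proof (rule integral_dominated_convergence[where w="\<lambda>w. (L2_norm f)\<^sup>2 * gauss w"])
    show "integrable lborel (\<lambda>w::real^'n. (L2_norm f)\<^sup>2 * gauss w)" using gauss_integrable[where 'a="real ^ 'n"] by simp
    have "(\<lambda>k. of_real (gauss w) * \<rho> ((- s k) *\<^sub>R w)) \<longlonglongrightarrow> of_real (gauss w) * of_real ((L2_norm f)\<^sup>2)" for w
    proof -
      have "(\<lambda>k. (- s k) *\<^sub>R w) \<longlonglongrightarrow> 0"
        using tendsto_scaleR[OF tendsto_minus[OF s0] tendsto_const, of w] by simp
      from autocorrelation_tendsto[OF f f2 this] show ?thesis
        unfolding \<rho>_def by (intro tendsto_mult tendsto_const)
    qed
    then show "AE w in lborel. (\<lambda>k. of_real (gauss w) * \<rho> ((- s k) *\<^sub>R w)) \<longlonglongrightarrow> of_real (gauss w) * of_real ((L2_norm f)\<^sup>2)"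
      by simp
    fix k
    show "AE w in lborel. norm (of_real (gauss w) * \<rho> ((- s k) *\<^sub>R w)) \<le> (L2_norm f)\<^sup>2 * gauss w"
    proof (rule AE_I2)
      fix w
      show "norm (of_real (gauss w) * \<rho> ((- s k) *\<^sub>R w)) \<le> (L2_norm f)\<^sup>2 * gauss w"
        using mult_right_mono[OF \<rho>_bound[of "(- s k) *\<^sub>R w"] less_imp_le[OF gauss_bounds(1)[of w]]]
        by (simp add: norm_mult abs_of_pos[OF gauss_bounds(1)] mult.commute)
    qed
  qed measurable
  then have "(\<lambda>k. complex_of_real (\<integral>\<xi>. ?E \<xi> k \<partial>lborel)) \<longlonglongrightarrow>
      c0 *\<^sub>R (\<integral>w. of_real (gauss (w::real^'n)) * of_real ((L2_norm f)\<^sup>2) \<partial>lborel)"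
    unfolding E_val by (intro tendsto_scaleR tendsto_const)
  also have "c0 *\<^sub>R (\<integral>w. of_real (gauss (w::real^'n)) * of_real ((L2_norm f)\<^sup>2) \<partial>lborel) =
      complex_of_real (c0 * P * (L2_norm f)\<^sup>2)"
    unfolding of_real_mult[symmetric] integral_complex_of_real P_def gauss_integral[symmetric] by (simp add: scaleR_conv_of_real mult.assoc)
  finally have E_lim: "(\<lambda>k. \<integral>\<xi>. ?E \<xi> k \<partial>lborel) \<longlonglongrightarrow> (L2_norm f)\<^sup>2"
    unfolding c0P mult_1_left by (simp only: tendsto_of_real_iff)
  \<comment> \<open>Integrability of |FT f|^2 is part of the claim, so no dominating function is at
    hand. The Gaussian factors increase with \<open>k\<close>, and monotone convergence gives
    integrability and value together.\<close>
  have "has_bochner_integral lborel (\<lambda>\<xi>. (norm (FT f \<xi>))\<^sup>2) ((L2_norm f)\<^sup>2)"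
  proof (rule has_bochner_integral_monotone_convergence[OF E_int _ _ E_lim])
    have "mono (\<lambda>k. ?E \<xi> k)" for \<xi>
    proof (rule monoI)
      fix i j :: nat assume ij: "i \<le> j"
      then have "s j \<le> s i" by (simp add: s_def field_simps)
      then have "(norm (s j *\<^sub>R \<xi>))\<^sup>2 \<le> (norm (s i *\<^sub>R \<xi>))\<^sup>2"
        using s[of i] s[of j] by (intro power_mono) (auto intro: mult_right_mono)
      then have "gauss (s i *\<^sub>R \<xi>) \<le> gauss (s j *\<^sub>R \<xi>)" by (simp only: gauss_def exp_le_cancel_iff)
      then show "?E \<xi> i \<le> ?E \<xi> j" by (intro mult_right_mono) auto
    qed
    then show "AE \<xi> in lborel. mono (\<lambda>k. ?E \<xi> k)" by simp
    have "(\<lambda>k. ?E \<xi> k) \<longlonglongrightarrow> (norm (FT f \<xi>))\<^sup>2" for \<xi>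
    proof -
      have "(\<lambda>k. exp (- (norm (s k *\<^sub>R \<xi>))\<^sup>2 / 2) * (norm (FT f \<xi>))\<^sup>2) \<longlonglongrightarrow> exp (- (norm (0 *\<^sub>R \<xi>))\<^sup>2 / 2) * (norm (FT f \<xi>))\<^sup>2"
        by (intro tendsto_intros s0) auto
      then show ?thesis by (simp add: gauss_def)
    qed
    then show "AE \<xi> in lborel. (\<lambda>k. ?E \<xi> k) \<longlonglongrightarrow> (norm (FT f \<xi>))\<^sup>2" by simp
  qed measurable
  then have int: "integrable lborel (\<lambda>\<xi>. (norm (FT f \<xi>))\<^sup>2)"
    and val: "(\<integral>\<xi>. (norm (FT f \<xi>))\<^sup>2 \<partial>lborel) = (L2_norm f)\<^sup>2"
    by (auto simp: has_bochner_integral_iff)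
  then show "L2_fun (FT f)" by (simp add: L2_fun_def)
  from val show "L2_norm (FT f) = L2_norm f"
    by (simp add: L2_norm_square[symmetric])
qed

section \<open>Vector-valued functions and the transform on L^2\<close>

lemma borel_measurable_vec:
  fixes f :: "'a \<Rightarrow> 'b::euclidean_space ^ 'm"
  assumes "\<And>i. (\<lambda>x. f x $ i) \<in> borel_measurable M"
  shows "f \<in> borel_measurable M"
  unfolding borel_measurable_euclidean_space[of f]
proof
  fix b :: "'b ^ 'm" assume "b \<in> Basis"
  then obtain i u where b: "b = axis i u" by (auto simp: Basis_vec_def)
  show "(\<lambda>x. f x \<bullet> b) \<in> borel_measurable M"
    unfolding b inner_axis using assms[of i] by simp
qed

lemma norm_vec_square: "(norm (v :: 'b::real_normed_vector ^ 'm))\<^sup>2 = (\<Sum>i\<in>UNIV. (norm (v $ i))\<^sup>2)"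
  by (simp add: norm_vec_def L2_set_def sum_nonneg)

lemma L2_fun_nth: "L2_fun f \<Longrightarrow> L2_fun (\<lambda>x. f x $ i)"
  by (rule L2_fun_bound[where C=1]) (auto simp: Finite_Cartesian_Product.norm_nth_le)

lemma L2_fun_vec:
  fixes f :: "real ^ 'n \<Rightarrow> 'b::euclidean_space ^ 'm"
  assumes "\<And>i. L2_fun (\<lambda>x. f x $ i)" shows "L2_fun f"
  using assms unfolding L2_fun_def norm_vec_square
  by (auto intro!: borel_measurable_vec)

lemma L2_norm_nth_le: "L2_fun f \<Longrightarrow> L2_norm (\<lambda>x. f x $ i) \<le> L2_norm f"
  by (rule L2_norm_mono) (auto simp: Finite_Cartesian_Product.norm_nth_le)

lemma L2_norm_vec:
  fixes f :: "real ^ 'n \<Rightarrow> 'b::euclidean_space ^ 'm"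
  assumes "L2_fun f"
  shows "(L2_norm f)\<^sup>2 = (\<Sum>i\<in>UNIV. (L2_norm (\<lambda>x. f x $ i))\<^sup>2)"
  using L2_fun_square_integrable[OF L2_fun_nth[OF assms]] unfolding L2_norm_square norm_vec_square by simp

lemma L2_fun_of_real: "L2_fun f \<Longrightarrow> L2_fun (\<lambda>x. complex_of_real (f x))"
  by (rule L2_fun_bound[where C=1]) auto

lemma L2_norm_of_real: "L2_norm (\<lambda>x. complex_of_real (f x)) = L2_norm f"
  by (simp add: L2_norm_def)

lemma cball_measurable [measurable]: "cball (x :: 'a::metric_space) r \<in> sets borel"
  by simp

lemma L2_fun_cnj: "L2_fun f \<Longrightarrow> L2_fun (\<lambda>x. cnj (f x))"
  by (rule L2_fun_bound[where C=1 and f=f]) (auto intro: borel_measurable_cnj)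

lemma L2_norm_tendsto:
  assumes "\<And>R. L2_fun (F R)" "L2_fun G" "((\<lambda>R. L2_norm (\<lambda>x. F R x - G x)) \<longlongrightarrow> 0) A"
  shows "((\<lambda>R. L2_norm (F R)) \<longlongrightarrow> L2_norm G) A"
  by (rule LIM_zero_cancel, rule Lim_null_comparison[OF _ assms(3)])
    (simp add: L2_norm_diff_abs_le assms)

lemma L2_fun_indicator_cball: "L2_fun (\<lambda>x::real^'n. indicat_real (cball 0 R) x)"
proof -
  have "(\<lambda>x::real^'n. (norm (indicat_real (cball 0 R) x))\<^sup>2) = indicat_real (cball 0 R)"
    by (auto simp: indicator_def)
  then show ?thesis
    unfolding L2_fun_def using emeasure_bounded_finite[of "cball (0::real^'n) R"]
    by (simp only:) (auto intro!: integrable_real_indicator borel_measurable_indicator)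
qed

lemma L2_bounded_support_integrable:
  fixes f :: "real ^ 'n \<Rightarrow> 'b::euclidean_space"
  assumes f: "L2_fun f" and supp: "\<And>x. norm x > R \<Longrightarrow> f x = 0"
  shows "integrable lborel f"
proof (rule L2_integrable_bound[OF L2_fun_indicator_cball[of R] f])
  show "norm (f x) \<le> norm (indicat_real (cball 0 R) x) * norm (f x)" for x
    using supp[of x] by (cases "norm x > R") (auto simp: indicator_def)
qed (use f in auto)

abbreviation trunc :: "real \<Rightarrow> (real ^ 'n \<Rightarrow> 'b::euclidean_space) \<Rightarrow> real ^ 'n \<Rightarrow> 'b" where
  "trunc R f \<equiv> \<lambda>x. indicat_real (cball 0 R) x *\<^sub>R f x"

lemma L2_fun_trunc: "L2_fun f \<Longrightarrow> L2_fun (trunc R f)"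
  by (rule L2_fun_indicator) auto

lemma integrable_trunc: "L2_fun f \<Longrightarrow> integrable lborel (trunc R f)"
  by (rule L2_bounded_support_integrable[OF L2_fun_trunc, of f R R]) auto

lemma trunc_tendsto:
  assumes f: "L2_fun f"
  shows "((\<lambda>R. L2_norm (\<lambda>x. trunc R f x - f x)) \<longlongrightarrow> 0) at_top"
proof (rule L2_norm_tendsto_zero_at_top[OF f])
  note [measurable] = L2_fun_measurable[OF f]
  show "(\<lambda>x. trunc R f x - f x) \<in> borel_measurable borel" for R by measurable
  show "norm (trunc R f x - f x) \<le> norm (f x)" for R x by (auto simp: indicator_def)
  fix x
  have "\<forall>\<^sub>F R in at_top. trunc R f x - f x = 0"
    using eventually_ge_at_top[of "norm x"] by eventually_elim (simp add: indicator_def)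
  then show "((\<lambda>R. trunc R f x - f x) \<longlongrightarrow> 0) at_top" by (rule tendsto_eventually)
qed

lemma L2_integral_mult_tendsto:
  fixes h :: "real ^ 'n \<Rightarrow> 'b::{euclidean_space, real_normed_field}"
  assumes h: "L2_fun h" and F: "\<And>R. L2_fun (F R)" and G: "L2_fun G"
    and lim: "((\<lambda>R. L2_norm (\<lambda>x. F R x - G x)) \<longlongrightarrow> 0) A"
  shows "((\<lambda>R. \<integral>x. h x * F R x \<partial>lborel) \<longlongrightarrow> (\<integral>x. h x * G x \<partial>lborel)) A"
proof -
  have int: "integrable lborel (\<lambda>x. h x * f x)" if "L2_fun f" for f
  proof -
    note [measurable] = L2_fun_measurable[OF h] L2_fun_measurable[OF that]
    show ?thesis by (rule L2_integrable_bound[OF h that]) (auto simp: norm_mult)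
  qed
  have "norm ((\<integral>x. h x * F R x \<partial>lborel) - (\<integral>x. h x * G x \<partial>lborel)) \<le> L2_norm h * L2_norm (\<lambda>x. F R x - G x)" for R
  proof -
    have "(\<integral>x. h x * F R x \<partial>lborel) - (\<integral>x. h x * G x \<partial>lborel) = (\<integral>x. h x * (F R x - G x) \<partial>lborel)"
      using int[OF F[of R]] int[OF G] by (simp add: right_diff_distrib)
    then show ?thesis
      using L2_integral_norm_le[OF h L2_fun_diff[OF F[of R] G], of "\<lambda>x. h x * (F R x - G x)"]
      by (simp add: norm_mult)
  qed
  then have ev: "\<forall>\<^sub>F R in A. norm ((\<integral>x. h x * F R x \<partial>lborel) - (\<integral>x. h x * G x \<partial>lborel)) \<le>
      L2_norm h * L2_norm (\<lambda>x. F R x - G x)" by (intro always_eventually allI)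
  have "((\<lambda>R. L2_norm h * L2_norm (\<lambda>x. F R x - G x)) \<longlongrightarrow> 0) A"
    using tendsto_mult[OF tendsto_const lim, of "L2_norm h"] by simp
  with ev have "((\<lambda>R. (\<integral>x. h x * F R x \<partial>lborel) - (\<integral>x. h x * G x \<partial>lborel)) \<longlongrightarrow> 0) A"
    by (rule Lim_null_comparison)
  then show ?thesis by (rule LIM_zero_cancel)
qed

lemma fourier_L1_nth:
  assumes f: "integrable lborel f"
  shows "fourier_L1 f \<xi> $ i = FT (\<lambda>x. complex_of_real (f x $ i)) \<xi>"
proof -
  note [measurable] = borel_measurable_integrable[OF f]
  have "integrable lborel (\<lambda>x. exp (- \<i> * complex_of_real (x \<bullet> \<xi>)) *s cvec (f x))"
  proof (rule Bochner_Integration.integrable_bound[OF f])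
    show "(\<lambda>x. exp (- \<i> * complex_of_real (x \<bullet> \<xi>)) *s cvec (f x)) \<in> borel_measurable lborel"
      by (rule borel_measurable_vec) simp
    have "norm (exp (- \<i> * complex_of_real (x \<bullet> \<xi>)) *s cvec (f x)) = norm (f x)" for x
      by (simp add: norm_vec_def L2_set_def norm_mult)
    then show "AE x in lborel. norm (exp (- \<i> * complex_of_real (x \<bullet> \<xi>)) *s cvec (f x)) \<le> norm (f x)" by simp
  qed
  from integral_bounded_linear[OF bounded_linear_vec_nth this, of i]
  show ?thesis by (simp add: fourier_L1_def FT_def)
qed

lemma fourier_L1_diff:
  assumes f: "integrable lborel f" and g: "integrable lborel g"
  shows "fourier_L1 f \<xi> - fourier_L1 g \<xi> = fourier_L1 (\<lambda>x. f x - g x) \<xi>"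
proof (rule vec_eq_iff[THEN iffD2], rule allI)
  fix i
  have c: "integrable lborel (\<lambda>x. complex_of_real (h x $ i))" if "integrable lborel h" for h :: "real ^ 'a \<Rightarrow> real ^ 'b"
    using integrable_bounded_linear[OF bounded_linear_vec_nth that, of i] by simp
  have "FT (\<lambda>x. complex_of_real (f x $ i)) \<xi> - FT (\<lambda>x. complex_of_real (g x $ i)) \<xi> =
      FT (\<lambda>x. complex_of_real (f x $ i) - complex_of_real (g x $ i)) \<xi>"
    unfolding FT_def right_diff_distrib
      Bochner_Integration.integral_diff[OF FT_integrand_integrable[OF c[OF f]] FT_integrand_integrable[OF c[OF g]]]
      scaleR_diff_right ..
  then show "(fourier_L1 f \<xi> - fourier_L1 g \<xi>) $ i = fourier_L1 (\<lambda>x. f x - g x) \<xi> $ i"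
    using f g by (simp add: fourier_L1_nth)
qed

lemma Plancherel_fourier_L1_nth:
  assumes f: "integrable lborel f" and f2: "L2_fun f"
  shows "L2_fun (\<lambda>\<xi>. fourier_L1 f \<xi> $ i)"
    and "L2_norm (\<lambda>\<xi>. fourier_L1 f \<xi> $ i) = L2_norm (\<lambda>x. f x $ i)"
proof -
  have c: "integrable lborel (\<lambda>x. complex_of_real (f x $ i))"
    using integrable_bounded_linear[OF bounded_linear_vec_nth f, of i] by simp
  note P = Plancherel_L1_L2[OF c L2_fun_of_real[OF L2_fun_nth[OF f2]]]
  show "L2_fun (\<lambda>\<xi>. fourier_L1 f \<xi> $ i)"
    and "L2_norm (\<lambda>\<xi>. fourier_L1 f \<xi> $ i) = L2_norm (\<lambda>x. f x $ i)"
    using P by (simp_all add: fourier_L1_nth[OF f] L2_norm_of_real)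
qed

lemma Plancherel_fourier_L1:
  assumes f: "integrable lborel f" and f2: "L2_fun f"
  shows "L2_fun (fourier_L1 f)" and "L2_norm (fourier_L1 f) = L2_norm f"
proof -
  show L2: "L2_fun (fourier_L1 f)" by (rule L2_fun_vec) (rule Plancherel_fourier_L1_nth[OF f f2])
  have "(L2_norm (fourier_L1 f))\<^sup>2 = (L2_norm f)\<^sup>2"
    unfolding L2_norm_vec[OF L2] L2_norm_vec[OF f2] Plancherel_fourier_L1_nth[OF f f2] ..
  then show "L2_norm (fourier_L1 f) = L2_norm f" by simp
qed

lemma L2_norm_fourier_L1_trunc_diff:
  assumes f: "L2_fun f"
  shows "L2_norm (\<lambda>\<xi>. fourier_L1 (trunc R f) \<xi> - fourier_L1 (trunc S f) \<xi>) \<le>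
    L2_norm (\<lambda>x. trunc R f x - f x) + L2_norm (\<lambda>x. trunc S f x - f x)"
proof -
  note t = L2_fun_trunc[OF f] and i = integrable_trunc[OF f]
  have "L2_norm (\<lambda>\<xi>. fourier_L1 (trunc R f) \<xi> - fourier_L1 (trunc S f) \<xi>) = L2_norm (\<lambda>x. trunc R f x - trunc S f x)"
    unfolding fourier_L1_diff[OF i[of R] i[of S]]
    by (rule Plancherel_fourier_L1(2)) (auto intro: L2_fun_diff t i)
  also have "\<dots> \<le> L2_norm (\<lambda>x. trunc R f x - f x) + L2_norm (\<lambda>x. f x - trunc S f x)"
    by (rule L2_norm_triangle_diff[OF t f t])
  finally show ?thesis by (simp add: L2_norm_minus_commute[of f])
qed

text \<open>By Plancherel the transforms of the truncations are as close to each other as the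
  truncations are. Without this lemma the choice made in \<open>fourier\<close> would be
  arbitrary.\<close>

lemma fourier_exists:
  assumes f: "L2_fun f"
  shows "\<exists>g. L2_fun g \<and> ((\<lambda>R. L2_norm (\<lambda>\<xi>. fourier_L1 (trunc R f) \<xi> - g \<xi>)) \<longlongrightarrow> 0) at_top"
proof -
  note F = Plancherel_fourier_L1(1)[OF integrable_trunc[OF f] L2_fun_trunc[OF f]]
  let ?d = "\<lambda>R. L2_norm (\<lambda>x. trunc R f x - f x)"
  note d = trunc_tendsto[OF f]
  have dn: "(\<lambda>k. ?d (real k)) \<longlonglongrightarrow> 0" by (rule filterlim_compose[OF d filterlim_real_sequentially])
  have "\<exists>N. \<forall>i\<ge>N. \<forall>j\<ge>N. L2_norm (\<lambda>\<xi>. fourier_L1 (trunc (real i) f) \<xi> - fourier_L1 (trunc (real j) f) \<xi>) < e"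
    if e: "e > 0" for e
  proof -
    obtain N where N: "\<And>k. k \<ge> N \<Longrightarrow> norm (?d (real k) - 0) < e / 2" using LIMSEQ_D[OF dn, of "e/2"] e by auto
    have "L2_norm (\<lambda>\<xi>. fourier_L1 (trunc (real i) f) \<xi> - fourier_L1 (trunc (real j) f) \<xi>) < e"
      if "i \<ge> N" "j \<ge> N" for i j
      using L2_norm_fourier_L1_trunc_diff[OF f, of "real i" "real j"] N[OF that(1)] N[OF that(2)] by simp
    then show ?thesis by blast
  qed
  from L2_complete[OF F this] obtain g where g: "L2_fun g"
    and lim: "(\<lambda>k. L2_norm (\<lambda>\<xi>. fourier_L1 (trunc (real k) f) \<xi> - g \<xi>)) \<longlonglongrightarrow> 0" by blast
  \<comment> \<open>Completeness yields a limit along integer radii only. This bound, obtained by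
    letting the integer radius tend to infinity, extends the convergence to all real radii.\<close>
  have "L2_norm (\<lambda>\<xi>. fourier_L1 (trunc R f) \<xi> - g \<xi>) \<le> ?d R" for R
  proof (rule tendsto_lowerbound)
    show "(\<lambda>k. ?d R + ?d (real k) + L2_norm (\<lambda>\<xi>. fourier_L1 (trunc (real k) f) \<xi> - g \<xi>)) \<longlonglongrightarrow> ?d R"
      using tendsto_add[OF tendsto_add[OF tendsto_const dn] lim, of "?d R"] by simp
    have "L2_norm (\<lambda>\<xi>. fourier_L1 (trunc R f) \<xi> - g \<xi>) \<le>
        ?d R + ?d (real k) + L2_norm (\<lambda>\<xi>. fourier_L1 (trunc (real k) f) \<xi> - g \<xi>)" for k
      using L2_norm_triangle_diff[OF F[of R] F[of "real k"] g] L2_norm_fourier_L1_trunc_diff[OF f, of R "real k"]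
      by linarith
    then show "\<forall>\<^sub>F k in sequentially. L2_norm (\<lambda>\<xi>. fourier_L1 (trunc R f) \<xi> - g \<xi>) \<le>
        ?d R + ?d (real k) + L2_norm (\<lambda>\<xi>. fourier_L1 (trunc (real k) f) \<xi> - g \<xi>)"
      by simp
  qed simp
  then have "((\<lambda>R. L2_norm (\<lambda>\<xi>. fourier_L1 (trunc R f) \<xi> - g \<xi>)) \<longlongrightarrow> 0) at_top"
    by (intro tendsto_sandwich[OF _ _ tendsto_const d]) auto
  with g show ?thesis by blast
qed

lemma
  assumes f: "L2_fun f"
  shows L2_fun_fourier: "L2_fun (fourier f)"
    and fourier_L1_trunc_tendsto: "((\<lambda>R. L2_norm (\<lambda>\<xi>. fourier_L1 (trunc R f) \<xi> - fourier f \<xi>)) \<longlongrightarrow> 0) at_top"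
  using someI_ex[OF fourier_exists[OF f]] unfolding fourier_def by blast+

lemma fourier_L1_trunc_nth_tendsto:
  assumes f: "L2_fun f"
  shows "((\<lambda>R. L2_norm (\<lambda>\<xi>. fourier_L1 (trunc R f) \<xi> $ i - fourier f \<xi> $ i)) \<longlongrightarrow> 0) at_top"
proof (rule tendsto_sandwich[OF _ _ tendsto_const fourier_L1_trunc_tendsto[OF f]])
  note F = Plancherel_fourier_L1(1)[OF integrable_trunc[OF f] L2_fun_trunc[OF f]]
  show "\<forall>\<^sub>F R in at_top. L2_norm (\<lambda>\<xi>. fourier_L1 (trunc R f) \<xi> $ i - fourier f \<xi> $ i) \<le>
      L2_norm (\<lambda>\<xi>. fourier_L1 (trunc R f) \<xi> - fourier f \<xi>)"
    using L2_norm_nth_le[OF L2_fun_diff[OF F L2_fun_fourier[OF f]], where i=i] by simp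
qed simp

lemma Plancherel_nth:
  assumes f: "L2_fun f"
  shows "L2_norm (\<lambda>\<xi>. fourier f \<xi> $ i) = L2_norm (\<lambda>x. f x $ i)"
proof -
  note F = Plancherel_fourier_L1_nth[OF integrable_trunc[OF f] L2_fun_trunc[OF f], where i=i]
  let ?a = "\<lambda>R. L2_norm (\<lambda>\<xi>. fourier_L1 (trunc R f) \<xi> $ i)"
  have "(?a \<longlongrightarrow> L2_norm (\<lambda>\<xi>. fourier f \<xi> $ i)) at_top"
    by (rule L2_norm_tendsto[OF F(1) L2_fun_nth[OF L2_fun_fourier[OF f]] fourier_L1_trunc_nth_tendsto[OF f]])
  moreover have "((\<lambda>R. L2_norm (\<lambda>x. trunc R f x $ i)) \<longlongrightarrow> L2_norm (\<lambda>x. f x $ i)) at_top"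
    using trunc_tendsto[OF L2_fun_nth[OF f], of i]
    by (intro L2_norm_tendsto L2_fun_nth[OF L2_fun_trunc[OF f]] L2_fun_nth[OF f]) simp
  ultimately show ?thesis unfolding F(2) by (rule tendsto_unique[OF trivial_limit_at_top_linorder])
qed

lemma Plancherel:
  assumes f: "L2_fun f" shows "L2_norm (fourier f) = L2_norm f"
proof -
  have "(L2_norm (fourier f))\<^sup>2 = (L2_norm f)\<^sup>2"
    unfolding L2_norm_vec[OF f] L2_norm_vec[OF L2_fun_fourier[OF f]] Plancherel_nth[OF f] ..
  then show ?thesis by simp
qed

text \<open>The defining L^2 limit of \<open>fourier f\<close> is passed to the limit in the
  multiplication formula for the truncations. Together with \<open>L2_local_dual_zero\<close> this
  formula determines \<open>fourier f\<close> almost everywhere, and later identities for it are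
  proved in this way.\<close>

lemma fourier_multiplication:
  assumes f: "L2_fun f" and g: "integrable lborel g" and g2: "L2_fun g"
  shows "(\<integral>x. FT g x * complex_of_real (f x $ i) \<partial>lborel) = (\<integral>\<xi>. g \<xi> * fourier f \<xi> $ i \<partial>lborel)"
proof (rule tendsto_unique[OF trivial_limit_at_top_linorder])
  let ?c = "\<lambda>R x. complex_of_real (trunc R f x $ i)"
  note t = L2_fun_trunc[OF f] and ti = integrable_trunc[OF f]
  have c: "integrable lborel (?c R)" for R
    by (rule integrable_of_real) (rule integrable_bounded_linear[OF bounded_linear_vec_nth ti])
  show "((\<lambda>R. \<integral>\<xi>. g \<xi> * fourier_L1 (trunc R f) \<xi> $ i \<partial>lborel) \<longlongrightarrow> (\<integral>\<xi>. g \<xi> * fourier f \<xi> $ i \<partial>lborel)) at_top"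
    by (rule L2_integral_mult_tendsto[OF g2 Plancherel_fourier_L1_nth(1)[OF ti t]
          L2_fun_nth[OF L2_fun_fourier[OF f]] fourier_L1_trunc_nth_tendsto[OF f]])
  have "((\<lambda>R. L2_norm (\<lambda>x. ?c R x - complex_of_real (f x $ i))) \<longlongrightarrow> 0) at_top"
    unfolding of_real_diff[symmetric] L2_norm_of_real using trunc_tendsto[OF L2_fun_nth[OF f], of i] by simp
  then have "((\<lambda>R. \<integral>x. FT g x * ?c R x \<partial>lborel) \<longlongrightarrow> (\<integral>x. FT g x * complex_of_real (f x $ i) \<partial>lborel)) at_top"
    by (intro L2_integral_mult_tendsto Plancherel_L1_L2 g g2 L2_fun_of_real L2_fun_nth f t)
  then show "((\<lambda>R. \<integral>\<xi>. g \<xi> * fourier_L1 (trunc R f) \<xi> $ i \<partial>lborel) \<longlongrightarrow> (\<integral>x. FT g x * complex_of_real (f x $ i) \<partial>lborel)) at_top"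
    unfolding FT_multiplication[OF c g] fourier_L1_nth[OF ti] .
qed

text \<open>Take for \<open>g\<close> the conjugate of \<open>d\<close> cut to a ball: the integral
  becomes the squared norm of \<open>d\<close> on that ball. Square integrability is demanded on
  balls only, because \<open>d\<close> will contain polynomial factors in the frequency.\<close>

lemma L2_local_dual_zero:
  fixes d :: "real ^ 'n \<Rightarrow> complex"
  assumes d: "\<And>R. L2_fun (trunc R d)"
    and dual: "\<And>R g. L2_fun g \<Longrightarrow> (\<And>\<xi>. norm \<xi> > R \<Longrightarrow> g \<xi> = 0) \<Longrightarrow> (\<integral>\<xi>. g \<xi> * d \<xi> \<partial>lborel) = 0"
  shows "AE \<xi> in lborel. d \<xi> = 0"
proof -
  have "AE \<xi> in lborel. trunc (real k) d \<xi> = 0" for k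
  proof -
    let ?g = "\<lambda>\<xi>. cnj (trunc (real k) d \<xi>)"
    have "L2_fun ?g" by (rule L2_fun_cnj[OF d])
    then have "(\<integral>\<xi>. ?g \<xi> * d \<xi> \<partial>lborel) = 0" by (rule dual[where R="real k"]) auto
    moreover have "?g \<xi> * d \<xi> = complex_of_real ((norm (trunc (real k) d \<xi>))\<^sup>2)" for \<xi>
      using complex_norm_square[of "d \<xi>"] by (simp add: indicator_def mult.commute[of "cnj (d \<xi>)"])
    ultimately have "complex_of_real (\<integral>\<xi>. (norm (trunc (real k) d \<xi>))\<^sup>2 \<partial>lborel) = 0"
      by (simp only: integral_complex_of_real)
    then have "L2_norm (trunc (real k) d) = 0" by (simp only: L2_norm_def of_real_eq_0_iff real_sqrt_zero)
    then show ?thesis unfolding L2_norm_zero_iff_AE[OF d] .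
  qed
  then have "AE \<xi> in lborel. \<forall>k. trunc (real k) d \<xi> = 0"
    by (intro AE_all_countable[THEN iffD2] allI)
  then show ?thesis
  proof eventually_elim
    case (elim \<xi>)
    obtain k where "norm \<xi> \<le> real k" using real_arch_simple by blast
    then show ?case using elim[rule_format, of k] by (simp add: indicator_def)
  qed
qed

text \<open>Both transforms satisfy the multiplication formula with the same left side. This is what
  makes the bound of |u0^| by the L^1 norm available at low frequencies.\<close>

lemma fourier_eq_fourier_L1:
  assumes f: "L2_fun f" and f1: "integrable lborel f"
  shows "AE \<xi> in lborel. fourier f \<xi> = fourier_L1 f \<xi>"
proof -
  note L2 = L2_fun_fourier[OF f] and L1 = Plancherel_fourier_L1(1)[OF f1 f]
  have "AE \<xi> in lborel. fourier f \<xi> $ i - fourier_L1 f \<xi> $ i = 0" for i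
  proof (rule L2_local_dual_zero)
    show "L2_fun (trunc R (\<lambda>\<xi>. fourier f \<xi> $ i - fourier_L1 f \<xi> $ i))" for R
      by (intro L2_fun_trunc L2_fun_diff L2_fun_nth L1 L2)
    fix R and g :: "real ^ 'a \<Rightarrow> complex" assume g: "L2_fun g" "\<And>\<xi>. norm \<xi> > R \<Longrightarrow> g \<xi> = 0"
    have gi: "integrable lborel g" by (rule L2_bounded_support_integrable[OF g])
    have c: "integrable lborel (\<lambda>x. complex_of_real (f x $ i))"
      using integrable_bounded_linear[OF bounded_linear_vec_nth f1, of i] by simp
    have int: "integrable lborel (\<lambda>\<xi>. g \<xi> * v \<xi> $ i)" if v: "L2_fun v" for v :: "real ^ 'a \<Rightarrow> complex ^ 'b"
      using g(1) v by (intro L2_integrable_bound[OF g(1) L2_fun_nth[OF v, of i]]) (auto simp: norm_mult)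
    have "(\<integral>\<xi>. g \<xi> * (fourier f \<xi> $ i - fourier_L1 f \<xi> $ i) \<partial>lborel) =
        (\<integral>\<xi>. g \<xi> * fourier f \<xi> $ i \<partial>lborel) - (\<integral>\<xi>. g \<xi> * fourier_L1 f \<xi> $ i \<partial>lborel)"
      using int[OF L1] int[OF L2] by (simp add: right_diff_distrib)
    also have "\<dots> = 0"
      unfolding fourier_multiplication[OF f gi g(1), symmetric] fourier_L1_nth[OF f1] FT_multiplication[OF c gi, symmetric]
      by simp
    finally show "(\<integral>\<xi>. g \<xi> * (fourier f \<xi> $ i - fourier_L1 f \<xi> $ i) \<partial>lborel) = 0" .
  qed
  then have "AE \<xi> in lborel. \<forall>i\<in>UNIV. fourier f \<xi> $ i - fourier_L1 f \<xi> $ i = 0"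
    by (intro AE_finite_all[THEN iffD2] ballI) auto
  then show ?thesis by eventually_elim (simp add: vec_eq_iff)
qed

section \<open>Inversion\<close>

lemma FT_uminus: "FT g (- x) = cnj (FT (\<lambda>\<xi>. cnj (g \<xi>)) x)"
  unfolding FT_def complex_cnj_scaleR Bochner_Integration.integral_cnj[symmetric] complex_cnj_mult exp_cnj by simp

lemma L2_reflect:
  fixes f :: "real ^ 'n \<Rightarrow> 'b::euclidean_space"
  assumes f: "L2_fun f"
  shows "L2_fun (\<lambda>x. f (- x))" and "L2_norm (\<lambda>x. f (- x)) = L2_norm f"
proof -
  note [measurable] = L2_fun_measurable[OF f]
  show "L2_fun (\<lambda>x. f (- x))"
    using lborel_integrable_affine[OF L2_fun_square_integrable[OF f], of "-1" 0] by (simp add: L2_fun_def)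
  show "L2_norm (\<lambda>x. f (- x)) = L2_norm f"
    using lborel_integral_affine[of "\<lambda>x. (norm (f x))\<^sup>2" "-1" 0] by (simp add: L2_norm_def)
qed

text \<open>Expand the squared distance. By the multiplication formula the cross term is the squared
  norm of the truncated transform, and by Plancherel so is the first square; hence the squared
  distance is the part of the norm of \<open>fourier f\<close> outside the ball. The lemma supplies
  band-limited approximations of \<open>f\<close>.\<close>

lemma fourier_inversion:
  fixes f :: "real ^ 'n \<Rightarrow> real ^ 'm"
  assumes f: "L2_fun f"
  shows "((\<lambda>R. L2_norm (\<lambda>x. FT (trunc R (\<lambda>\<xi>. fourier f \<xi> $ i)) (- x) - complex_of_real (f x $ i))) \<longlongrightarrow> 0) at_top"
proof -
  let ?h = "\<lambda>\<xi>. fourier f \<xi> $ i" and ?b = "\<lambda>x. complex_of_real (f x $ i)"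
  have h: "L2_fun ?h" by (intro L2_fun_nth L2_fun_fourier f)
  have b: "L2_fun ?b" by (intro L2_fun_of_real L2_fun_nth f)
  let ?G = "\<lambda>R. trunc R ?h"
  note G = L2_fun_trunc[OF h] and Gi = integrable_trunc[OF h]
  let ?a = "\<lambda>R x. FT (?G R) (- x)"
  have a: "L2_fun (?a R)" and an: "L2_norm (?a R) = L2_norm (?G R)" for R
    using L2_reflect[OF Plancherel_L1_L2(1)[OF Gi G], of R] Plancherel_L1_L2(2)[OF Gi G, of R] by auto
  note [measurable] = L2_fun_measurable[OF a] L2_fun_measurable[OF b] L2_fun_measurable[OF G] L2_fun_measurable[OF h]
  have eq: "(L2_norm (\<lambda>x. ?a R x - ?b x))\<^sup>2 = (L2_norm ?h)\<^sup>2 - (L2_norm (?G R))\<^sup>2" for R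
  proof -
    have cG: "L2_fun (\<lambda>\<xi>. cnj (?G R \<xi>))" by (rule L2_fun_cnj[OF G])
    have cGi: "integrable lborel (\<lambda>\<xi>. cnj (?G R \<xi>))" by (rule Bochner_Integration.integrable_cnj[OF Gi])
    have iab: "integrable lborel (\<lambda>x. ?a R x * ?b x)"
      by (rule L2_integrable_bound[OF a b]) (auto simp: norm_mult)
    have "(\<integral>x. ?a R x * ?b x \<partial>lborel) = cnj (\<integral>x. FT (\<lambda>\<xi>. cnj (?G R \<xi>)) x * ?b x \<partial>lborel)"
      unfolding FT_uminus Bochner_Integration.integral_cnj[symmetric] by simp
    also have "\<dots> = cnj (\<integral>\<xi>. cnj (?G R \<xi>) * ?h \<xi> \<partial>lborel)"
      by (subst fourier_multiplication[OF f cGi cG]) simp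
    also have "(\<integral>\<xi>. cnj (?G R \<xi>) * ?h \<xi> \<partial>lborel) = (\<integral>\<xi>. complex_of_real ((norm (?G R \<xi>))\<^sup>2) \<partial>lborel)"
      using complex_norm_square[of "?h _"]
      by (intro Bochner_Integration.integral_cong refl) (simp add: indicator_def mult.commute[of "cnj (?h _)"])
    finally have ab: "(\<integral>x. ?a R x * ?b x \<partial>lborel) = complex_of_real ((L2_norm (?G R))\<^sup>2)"
      unfolding integral_complex_of_real L2_norm_square complex_cnj_complex_of_real .
    have comb: "(\<integral>x. p x - 2 * q x + r x \<partial>lborel) = (\<integral>x. p x \<partial>lborel) - 2 * (\<integral>x. q x \<partial>lborel) + (\<integral>x. r x \<partial>lborel)"
      if "integrable lborel p" "integrable lborel q" "integrable lborel r" for p q r :: "real ^ 'n \<Rightarrow> real"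
      using that by simp
    have sq: "(norm (z - complex_of_real r))\<^sup>2 = (norm z)\<^sup>2 - 2 * Re (z * complex_of_real r) + (norm (complex_of_real r))\<^sup>2" for z r
      unfolding cmod_power2 by (simp add: power2_eq_square algebra_simps)
    have "(L2_norm (\<lambda>x. ?a R x - ?b x))\<^sup>2 =
        (\<integral>x. (norm (?a R x))\<^sup>2 - 2 * Re (?a R x * ?b x) + (norm (?b x))\<^sup>2 \<partial>lborel)"
      unfolding L2_norm_square
      by (intro Bochner_Integration.integral_cong refl sq)
    also have "\<dots> = (L2_norm (?a R))\<^sup>2 - 2 * Re (\<integral>x. ?a R x * ?b x \<partial>lborel) + (L2_norm ?b)\<^sup>2"
      unfolding L2_norm_square integral_Re[OF iab, symmetric]
      by (rule comb[OF L2_fun_square_integrable[OF a] integrable_Re[OF iab] L2_fun_square_integrable[OF b]])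
    also have "\<dots> = (L2_norm ?h)\<^sup>2 - (L2_norm (?G R))\<^sup>2"
      unfolding ab an L2_norm_of_real Plancherel_nth[OF f, symmetric] by simp
    finally show ?thesis .
  qed
  have "((\<lambda>R. L2_norm (?G R)) \<longlongrightarrow> L2_norm ?h) at_top"
    by (rule L2_norm_tendsto[OF G h trunc_tendsto[OF h]])
  from tendsto_diff[OF tendsto_const tendsto_power[OF this, of 2], of "(L2_norm ?h)\<^sup>2"]
  have "((\<lambda>R. (L2_norm (\<lambda>x. ?a R x - ?b x))\<^sup>2) \<longlongrightarrow> 0) at_top" unfolding eq by simp
  from tendsto_real_sqrt[OF this] show ?thesis by (simp only: real_sqrt_abs abs_of_nonneg[OF L2_norm_nonneg] real_sqrt_zero)
qed

section \<open>Test functions and weak derivatives\<close>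

lemma Ck_SucI:
  assumes "\<And>x. (f has_derivative f' x) (at x)" and "\<And>v. Ck_on k UNIV (\<lambda>x. f' x v)"
  shows "Ck_on (Suc k) UNIV f"
proof -
  have "frechet_derivative f (at x) = f' x" for x
    using frechet_derivative_at[OF assms(1)] by simp
  then show ?thesis
    using assms by (auto simp: differentiable_on_def differentiable_def)
qed

lemma Ck_Suc_has_derivative:
  "Ck_on (Suc k) UNIV f \<Longrightarrow> (f has_derivative frechet_derivative f (at x)) (at x)"
  by (auto simp: differentiable_on_def frechet_derivative_works[symmetric])

lemma Ck_Suc_imp_Ck: "Ck_on (Suc k) UNIV f \<Longrightarrow> Ck_on k UNIV f"
proof (induction k arbitrary: f)
  case 0
  then show ?case by (simp add: differentiable_imp_continuous_on)
next
  case (Suc k)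
  from Suc.prems have "f differentiable_on UNIV"
    and "\<And>v. Ck_on (Suc k) UNIV (\<lambda>x. frechet_derivative f (at x) v)" by auto
  then show ?case using Suc.IH by auto
qed

lemma Ck_const [intro]: "Ck_on k UNIV (\<lambda>x. c)"
proof (induction k arbitrary: c)
  case (Suc k)
  show ?case by (rule Ck_SucI[where f'="\<lambda>_ _. 0"]) (auto intro: Suc.IH)
qed simp

lemma Ck_add [intro]: "Ck_on k UNIV f \<Longrightarrow> Ck_on k UNIV g \<Longrightarrow> Ck_on k UNIV (\<lambda>x. f x + g x)"
proof (induction k arbitrary: f g)
  case 0
  then show ?case by (auto intro: continuous_on_add)
next
  case (Suc k)
  show ?case
    by (rule Ck_SucI[OF has_derivative_add[OF Ck_Suc_has_derivative[OF Suc.prems(1)] Ck_Suc_has_derivative[OF Suc.prems(2)]]])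
      (use Suc.prems Suc.IH in auto)
qed

lemma Ck_mult [intro]:
  fixes f g :: "'a::real_normed_vector \<Rightarrow> real"
  shows "Ck_on k UNIV f \<Longrightarrow> Ck_on k UNIV g \<Longrightarrow> Ck_on k UNIV (\<lambda>x. f x * g x)"
proof (induction k arbitrary: f g)
  case 0
  then show ?case by (auto intro: continuous_on_mult)
next
  case (Suc k)
  show ?case
    by (rule Ck_SucI[OF has_derivative_mult[OF Ck_Suc_has_derivative[OF Suc.prems(1)] Ck_Suc_has_derivative[OF Suc.prems(2)]]])
      (use Suc.prems Suc.prems[THEN Ck_Suc_imp_Ck] in \<open>auto intro!: Suc.IH Ck_add\<close>)
qed

lemma Ck_inner [intro]: "Ck_on k UNIV (\<lambda>x. x \<bullet> v)"
proof (cases k)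
  case (Suc l)
  show ?thesis
    unfolding Suc by (rule Ck_SucI[where f'="\<lambda>_ u. u \<bullet> v"]) (auto intro!: derivative_eq_intros)
qed (auto intro: continuous_intros)

lemma Ck_scale: 
  fixes f :: "'a::real_normed_vector \<Rightarrow> real"
  shows "Ck_on k UNIV f \<Longrightarrow> Ck_on k UNIV (\<lambda>x. f (c *\<^sub>R x))"
proof (induction k arbitrary: f)
  case 0
  then show ?case
    by (auto intro!: continuous_on_compose2[of UNIV f] continuous_intros)
next
  case (Suc k)
  show ?case
  proof (rule Ck_SucI)
    fix x
    show "((\<lambda>x. f (c *\<^sub>R x)) has_derivative (\<lambda>v. c * frechet_derivative f (at (c *\<^sub>R x)) v)) (at x)"
    proof -
      have D: "(f has_derivative frechet_derivative f (at (c *\<^sub>R x))) (at (c *\<^sub>R x))"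
        by (rule Ck_Suc_has_derivative[OF Suc.prems])
      have "((\<lambda>x. c *\<^sub>R x) has_derivative (\<lambda>v. c *\<^sub>R v)) (at x)" by (auto intro!: derivative_eq_intros)
      from has_derivative_compose[OF this D]
      show ?thesis
        using linear_scale[OF has_derivative_linear[OF D], of c] by simp
    qed
    show "Ck_on k UNIV (\<lambda>x. c * frechet_derivative f (at (c *\<^sub>R x)) v)" for v
      using Suc.prems by (intro Ck_mult Ck_const Suc.IH) auto
  qed
qed

lemma smooth_on_has_derivative:
  "smooth_on UNIV f \<Longrightarrow> (f has_derivative frechet_derivative f (at x)) (at x)"
  using Ck_Suc_has_derivative[of 0 f] by (auto simp: smooth_on_def)

lemma smooth_on_continuous: "smooth_on UNIV f \<Longrightarrow> continuous_on UNIV f"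
  by (auto simp: smooth_on_def dest: spec[of _ 0])

lemma smooth_on_measurable: "smooth_on UNIV f \<Longrightarrow> f \<in> borel_measurable borel"
  by (intro borel_measurable_continuous_onI smooth_on_continuous)

lemma smooth_on_mult:
  fixes f g :: "'a::real_normed_vector \<Rightarrow> real"
  shows "smooth_on UNIV f \<Longrightarrow> smooth_on UNIV g \<Longrightarrow> smooth_on UNIV (\<lambda>x. f x * g x)"
  by (auto simp: smooth_on_def)

lemma smooth_on_const: "smooth_on UNIV (\<lambda>x. c)"
  by (auto simp: smooth_on_def)

lemma smooth_on_scale:
  fixes f :: "'a::real_normed_vector \<Rightarrow> real"
  shows "smooth_on UNIV f \<Longrightarrow> smooth_on UNIV (\<lambda>x. f (c *\<^sub>R x))"
  by (auto simp: smooth_on_def intro: Ck_scale)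

lemma partial_eq: "(f has_derivative f') (at x) \<Longrightarrow> partial j f x = f' (axis j 1)"
  using frechet_derivative_at[of f f' x] by (simp add: partial_def)

lemma smooth_on_partial: "smooth_on UNIV f \<Longrightarrow> smooth_on UNIV (partial j f)"
  unfolding smooth_on_def partial_def[abs_def] using Ck_on.simps(2) by blast

lemma smooth_on_partials: "smooth_on UNIV f \<Longrightarrow> smooth_on UNIV (partials js f)"
  by (induction js) (auto intro: smooth_on_partial)

lemma partial_add:
  assumes "smooth_on UNIV f" "smooth_on UNIV g"
  shows "partial j (\<lambda>x. f x + g x) = (\<lambda>x. partial j f x + partial j g x)"
  using partial_eq[OF has_derivative_add[OF assms[THEN smooth_on_has_derivative]]] by (simp add: fun_eq_iff partial_def)

lemma partial_mult:
  assumes "smooth_on UNIV f" "smooth_on UNIV g"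
  shows "partial j (\<lambda>x. f x * g x) = (\<lambda>x. f x * partial j g x + partial j f x * g x)"
  using partial_eq[OF has_derivative_mult[OF assms[THEN smooth_on_has_derivative]]] by (simp add: fun_eq_iff partial_def)

lemma partial_cmult:
  assumes "smooth_on UNIV f"
  shows "partial j (\<lambda>x. c * f x) = (\<lambda>x. c * partial j f x)"
  using partial_eq[OF has_derivative_mult_right[OF smooth_on_has_derivative[OF assms]]] by (simp add: fun_eq_iff partial_def)

lemma partial_scale:
  assumes "smooth_on UNIV f"
  shows "partial j (\<lambda>x. f (c *\<^sub>R x)) x = c * partial j f (c *\<^sub>R x)"
proof -
  note D = smooth_on_has_derivative[OF assms, of "c *\<^sub>R x"]
  have "((\<lambda>x. c *\<^sub>R x) has_derivative (\<lambda>v. c *\<^sub>R v)) (at x)" by (auto intro!: derivative_eq_intros)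
  from partial_eq[OF has_derivative_compose[OF this D]] show ?thesis
    using linear_scale[OF has_derivative_linear[OF D], of c] by (simp add: partial_def)
qed

lemma partials_append: "partials (is @ js) f = partials is (partials js f)"
  by (induction "is") auto

lemma partials_add:
  "smooth_on UNIV f \<Longrightarrow> smooth_on UNIV g \<Longrightarrow>
    partials js (\<lambda>x. f x + g x) = (\<lambda>x. partials js f x + partials js g x)"
  by (induction js) (auto simp: partial_add smooth_on_partials)

lemma partials_cmult:
  "smooth_on UNIV f \<Longrightarrow> partials js (\<lambda>x. c * f x) = (\<lambda>x. c * partials js f x)"
  by (induction js) (auto simp: partial_cmult smooth_on_partials)

text \<open>A family closed under differentiation, so that smoothness of the bump function is an induction.\<close>

definition flat_exp :: "nat \<Rightarrow> real \<Rightarrow> real" where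
  "flat_exp j s = (if s > 0 then exp (- 1 / s) / s ^ j else 0)"

lemma flat_tendsto_zero: "(flat_exp j \<longlongrightarrow> 0) (at 0)"
proof (rule filterlim_split_at)
  have "\<forall>\<^sub>F s in at_left 0. flat_exp j s = 0"
    by (auto simp: flat_exp_def eventually_at_filter)
  then show "(flat_exp j \<longlongrightarrow> 0) (at_left 0)" by (rule tendsto_eventually)
  have "((\<lambda>s::real. inverse s ^ j / exp (inverse s)) \<longlongrightarrow> 0) (at_right 0)"
    by (rule filterlim_compose[OF tendsto_power_div_exp_0 filterlim_inverse_at_top_right])
  moreover have "\<forall>\<^sub>F s in at_right 0. inverse s ^ j / exp (inverse s) = flat_exp j s"
    using eventually_at_right_less[of "0::real"]
    by eventually_elim (simp add: flat_exp_def exp_minus field_simps)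
  ultimately show "(flat_exp j \<longlongrightarrow> 0) (at_right 0)" by (rule Lim_transform_eventually)
qed

text \<open>The exponential contributes a factor 1/s^2 and the power a factor -j/s, which stays in
  the family. At 0 the difference quotient is itself \<open>flat_exp (Suc j)\<close>, whose limit is
  already known.\<close>

lemma flat_DERIV: "(flat_exp j has_real_derivative flat_exp (j + 2) s - real j * flat_exp (j + 1) s) (at s)"
proof (cases s "0 :: real" rule: linorder_cases)
  case less
  have "\<forall>\<^sub>F t in nhds s. flat_exp j t = 0"
    using eventually_nhds_in_open[of "{..<0}" s] less by (auto simp: flat_exp_def elim!: eventually_mono)
  from DERIV_cong_ev[OF refl this refl, THEN iffD2, OF DERIV_const]
  have "(flat_exp j has_real_derivative 0) (at s)" .
  then show ?thesis using less by (simp add: flat_exp_def)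
next
  case equal
  have "((\<lambda>t. (flat_exp j t - flat_exp j 0) / (t - 0)) \<longlongrightarrow> 0) (at 0)"
  proof (rule Lim_transform_eventually[OF flat_tendsto_zero[of "Suc j"]])
    show "\<forall>\<^sub>F t in at 0. flat_exp (Suc j) t = (flat_exp j t - flat_exp j 0) / (t - 0)"
      by (auto simp: flat_exp_def eventually_at_filter)
  qed
  then show ?thesis using equal by (simp add: has_field_derivative_iff flat_exp_def)
next
  case greater
  have "((\<lambda>s. exp (- 1 / s) * (1 / s) ^ j) has_real_derivative
      exp (- 1 / s) * (1 / s\<^sup>2) * (1 / s) ^ j + real j * (1 / s) ^ (j - 1) * (- 1 / s\<^sup>2) * exp (- 1 / s)) (at s)"
    using greater by (auto intro!: derivative_eq_intros simp: power2_eq_square)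
  moreover have "exp (- 1 / s) * (1 / s\<^sup>2) * (1 / s) ^ j + real j * (1 / s) ^ (j - 1) * (- 1 / s\<^sup>2) * exp (- 1 / s)
      = flat_exp (j + 2) s - real j * flat_exp (j + 1) s"
    using greater by (cases j) (auto simp: flat_exp_def power_one_over power2_eq_square field_simps)
  ultimately have D: "((\<lambda>s. exp (- 1 / s) / s ^ j) has_real_derivative flat_exp (j + 2) s - real j * flat_exp (j + 1) s) (at s)"
    by (simp add: power_one_over)
  have "\<forall>\<^sub>F t in nhds s. flat_exp j t = exp (- 1 / t) / t ^ j"
    using eventually_nhds_in_open[of "{0<..}" s] greater by (auto simp: flat_exp_def elim!: eventually_mono)
  from DERIV_cong_ev[OF refl this refl, THEN iffD2, OF D] show ?thesis .
qed

lemma Ck_flat_ball: "Ck_on k UNIV (\<lambda>x::'a::real_inner. flat_exp j (1 - x \<bullet> x))"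
proof (induction k arbitrary: j)
  case 0
  have "continuous_on UNIV (flat_exp j)"
    using flat_DERIV by (intro DERIV_continuous_on) blast
  then show ?case
    by (auto intro!: continuous_on_compose2[of UNIV "flat_exp j"] continuous_intros)
next
  case (Suc k)
  show ?case
  proof (rule Ck_SucI)
    fix x :: 'a
    have "((\<lambda>x::'a. 1 - x \<bullet> x) has_derivative (\<lambda>v. (-2) * (x \<bullet> v))) (at x)"
      by (auto intro!: derivative_eq_intros simp: inner_commute)
    from has_derivative_compose[OF this flat_DERIV[of j, unfolded has_field_derivative_def]]
    show "((\<lambda>x. flat_exp j (1 - x \<bullet> x)) has_derivative
        (\<lambda>v. (flat_exp (j + 2) (1 - x \<bullet> x) + (- real j) * flat_exp (j + 1) (1 - x \<bullet> x)) * ((-2) * (x \<bullet> v)))) (at x)"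
      by simp
    show "Ck_on k UNIV (\<lambda>x::'a. (flat_exp (j + 2) (1 - x \<bullet> x) + (- real j) * flat_exp (j + 1) (1 - x \<bullet> x)) * ((-2) * (x \<bullet> v)))" for v
      by (intro Ck_mult Ck_add Ck_const Ck_inner Suc.IH)
  qed
qed

lemma test_function_exists: "\<exists>\<theta> :: real ^ 'n \<Rightarrow> real. test_function \<theta> \<and> \<theta> 0 = 1"
proof (intro exI conjI)
  \<comment> \<open>The factor \<open>exp 1\<close> normalises the value at 0, since
    \<open>flat_exp 0 1\<close> is exp(-1).\<close>
  let ?\<theta> = "\<lambda>x::real^'n. exp 1 * flat_exp 0 (1 - x \<bullet> x)"
  show "?\<theta> 0 = 1" by (simp add: flat_exp_def exp_add[symmetric])
  have "{x. ?\<theta> x \<noteq> 0} \<subseteq> cball 0 1"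
    by (auto simp: flat_exp_def norm_eq_sqrt_inner split: if_splits)
  then have "bounded (closure {x. ?\<theta> x \<noteq> 0})"
    using bounded_subset bounded_cball by blast
  then show "test_function ?\<theta>"
    unfolding test_function_def smooth_on_def compact_eq_bounded_closed
    by (auto intro!: Ck_flat_ball)
qed

section \<open>Test functions and integration by parts\<close>

lemma test_function_smooth: "test_function \<phi> \<Longrightarrow> smooth_on UNIV \<phi>"
  by (simp add: test_function_def)

lemma test_functionI:
  assumes "smooth_on UNIV \<phi>" and "\<And>x. norm x > R \<Longrightarrow> \<phi> x = 0"
  shows "test_function \<phi>"
proof -
  have "{x. \<phi> x \<noteq> 0} \<subseteq> cball 0 R" using assms(2) by (force simp: not_less[symmetric])
  then have "bounded (closure {x. \<phi> x \<noteq> 0})"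
    using bounded_subset bounded_cball by blast
  then show ?thesis using assms(1) by (auto simp: test_function_def compact_eq_bounded_closed)
qed

lemma test_function_support:
  assumes "test_function \<phi>"
  obtains R where "R > 0" "\<And>x. norm x > R \<Longrightarrow> \<phi> x = 0"
proof -
  have "bounded (closure {x. \<phi> x \<noteq> 0})"
    using assms unfolding test_function_def by (blast intro: compact_imp_bounded)
  then obtain R where R: "R > 0" "\<And>x. x \<in> closure {x. \<phi> x \<noteq> 0} \<Longrightarrow> norm x \<le> R"
    unfolding bounded_pos by blast
  then have "\<phi> x = 0" if "norm x > R" for x
    using that closure_subset[of "{x. \<phi> x \<noteq> 0}"] by force
  with R(1) show ?thesis by (rule that)
qed

lemma test_function_bounded:
  assumes "test_function \<phi>"
  obtains B where "B > 0" "\<And>x. \<bar>\<phi> x\<bar> \<le> B"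
proof -
  obtain R where R: "R > 0" "\<And>x. norm x > R \<Longrightarrow> \<phi> x = 0" using test_function_support[OF assms] by blast
  have "bounded (\<phi> ` cball 0 R)"
    by (intro compact_imp_bounded compact_continuous_image compact_cball
        continuous_on_subset[OF smooth_on_continuous[OF test_function_smooth[OF assms]]]) auto
  then obtain B where B: "B > 0" "\<And>x. norm x \<le> R \<Longrightarrow> \<bar>\<phi> x\<bar> \<le> B"
    unfolding bounded_pos by auto
  have "\<bar>\<phi> x\<bar> \<le> B" for x using B R(2)[of x] by (cases "norm x \<le> R") auto
  with B(1) show ?thesis by (rule that)
qed

lemma test_function_measurable [measurable_dest]: "test_function \<phi> \<Longrightarrow> \<phi> \<in> borel_measurable borel"
  by (rule smooth_on_measurable[OF test_function_smooth])

lemma test_function_L2: "test_function \<phi> \<Longrightarrow> L2_fun \<phi>"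
proof -
  assume t: "test_function \<phi>"
  obtain R where R: "R > 0" "\<And>x. norm x > R \<Longrightarrow> \<phi> x = 0" using test_function_support[OF t] by blast
  obtain B where B: "B > 0" "\<And>x. \<bar>\<phi> x\<bar> \<le> B" using test_function_bounded[OF t] by blast
  show "L2_fun \<phi>"
  proof (rule L2_fun_bound[OF L2_fun_indicator_cball[of R], where C=B])
    show "norm (\<phi> x) \<le> B * norm (indicat_real (cball 0 R) x)" for x
      using R(2)[of x] B(2)[of x] by (auto simp: indicator_def)
  qed (use t in measurable)
qed

lemma test_function_mult:
  assumes "test_function \<phi>" "smooth_on UNIV \<psi>" shows "test_function (\<lambda>x. \<phi> x * \<psi> x)"
proof -
  obtain R where "R > 0" "\<And>x. norm x > R \<Longrightarrow> \<phi> x = 0" using test_function_support[OF assms(1)] by blast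
  then show ?thesis
    using smooth_on_mult[OF test_function_smooth[OF assms(1)] assms(2)] by (auto intro: test_functionI[of _ R])
qed

lemma test_function_scale:
  assumes "test_function \<phi>" "c > 0" shows "test_function (\<lambda>x. \<phi> (c *\<^sub>R x))"
proof -
  obtain R where R: "R > 0" "\<And>x. norm x > R \<Longrightarrow> \<phi> x = 0" using test_function_support[OF assms(1)] by blast
  show ?thesis
  proof (rule test_functionI[of _ "R / c"])
    show "smooth_on UNIV (\<lambda>x. \<phi> (c *\<^sub>R x))" by (rule smooth_on_scale[OF test_function_smooth[OF assms(1)]])
    show "\<phi> (c *\<^sub>R x) = 0" if "norm x > R / c" for x
      using that assms(2) by (intro R(2)) (simp add: field_simps)
  qed
qed

lemma test_function_partial:
  assumes "test_function \<phi>" shows "test_function (partial j \<phi>)"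
proof -
  obtain R where R: "R > 0" "\<And>x. norm x > R \<Longrightarrow> \<phi> x = 0" using test_function_support[OF assms] by blast
  show ?thesis
  proof (rule test_functionI[of _ R])
    show "smooth_on UNIV (partial j \<phi>)" by (rule smooth_on_partial[OF test_function_smooth[OF assms]])
    fix x :: "real ^ 'a" assume x: "norm x > R"
    have "\<forall>\<^sub>F y in nhds x. y \<in> - cball 0 R" using x by (intro eventually_nhds_in_open) auto
    then have "\<forall>\<^sub>F y in at x. 0 = \<phi> y"
      by (auto simp: eventually_at_filter R(2) elim!: eventually_mono)
    then have "(\<phi> has_derivative (\<lambda>v. 0)) (at x)"
      using R(2)[OF x] by (intro has_derivative_transform_eventually[OF has_derivative_const]) auto
    then show "partial j \<phi> x = 0" by (simp add: partial_eq)
  qed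
qed

lemma test_function_partials: "test_function \<phi> \<Longrightarrow> test_function (partials js \<phi>)"
  by (induction js) (auto intro: test_function_partial)

text \<open>Difference quotients have integral 0 because translations preserve the integral of
  \<open>\<eta>\<close>, and they converge to the derivative under a common bound.\<close>

lemma integral_partial_test_function:
  assumes t: "test_function \<eta>"
  shows "(\<integral>x. partial j \<eta> x \<partial>lborel) = 0"
proof -
  let ?e = "axis j 1 :: real ^ 'a"
  note [measurable] = test_function_measurable[OF t]
  obtain R where R: "R > 0" "\<And>x. norm x > R \<Longrightarrow> \<eta> x = 0" using test_function_support[OF t] by blast
  obtain B where B: "B > 0" "\<And>x. \<bar>partial j \<eta> x\<bar> \<le> B" using test_function_bounded[OF test_function_partial[OF t]] by blast
  have D: "((\<lambda>t. \<eta> (x + t *\<^sub>R ?e)) has_real_derivative partial j \<eta> (x + s *\<^sub>R ?e)) (at s)" for x s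
  proof -
    note D = smooth_on_has_derivative[OF test_function_smooth[OF t], of "x + s *\<^sub>R ?e"]
    have "((\<lambda>t. x + t *\<^sub>R ?e) has_derivative (\<lambda>h. h *\<^sub>R ?e)) (at s)" by (auto intro!: derivative_eq_intros)
    from has_derivative_compose[OF this D] show ?thesis
      unfolding has_field_derivative_def partial_def
      by (rule has_derivative_eq_rhs) (simp add: fun_eq_iff linear_scale[OF has_derivative_linear[OF D]] mult.commute)
  qed
  define a where "a k = 1 / real (Suc k)" for k
  have a: "a k > 0" "a k \<le> 1" for k by (auto simp: a_def)
  have a0: "a \<longlonglongrightarrow> 0" unfolding a_def using LIMSEQ_Suc[OF lim_const_over_n[of 1]] by simp
  define q where "q k x = (\<eta> (x + a k *\<^sub>R ?e) - \<eta> x) / a k" for k x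
  have \<eta>_int: "integrable lborel \<eta>"
    by (rule L2_bounded_support_integrable[OF test_function_L2[OF t] R(2)])
  have q_int: "(\<integral>x. q k x \<partial>lborel) = 0" for k
    unfolding q_def using lborel_integral_translate[of \<eta> "a k *\<^sub>R ?e"] lborel_integrable_translate[OF \<eta>_int, of "a k *\<^sub>R ?e"] \<eta>_int
    by simp
  have "(\<lambda>k. \<integral>x. q k x \<partial>lborel) \<longlonglongrightarrow> (\<integral>x. partial j \<eta> x \<partial>lborel)"
  \<comment> \<open>The steps \<open>a k\<close> are at most 1, so all difference quotients vanish
    outside the ball of radius \<open>R + 1\<close>; inside, the mean value theorem bounds them by
    the maximum of the derivative.\<close>
  proof (rule integral_dominated_convergence[where w="\<lambda>x. B * indicat_real (cball 0 (R + 1)) x"])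
    show "partial j \<eta> \<in> borel_measurable lborel" using test_function_measurable[OF test_function_partial[OF t]] by simp
    show "q k \<in> borel_measurable lborel" for k unfolding q_def by measurable
    show "integrable lborel (\<lambda>x::real^'a. B * indicat_real (cball 0 (R + 1)) x)"
      using emeasure_bounded_finite[of "cball (0::real^'a) (R + 1)"] by (intro integrable_mult_right integrable_real_indicator) auto
    have "(\<lambda>k. q k x) \<longlonglongrightarrow> partial j \<eta> x" for x
    proof -
      have "((\<lambda>h. (\<eta> (x + h *\<^sub>R ?e) - \<eta> x) / h) \<longlongrightarrow> partial j \<eta> x) (at 0)"
        using D[of x 0] by (simp add: has_field_derivative_iff)
      moreover have "filterlim a (at 0) sequentially"
        using a0 a(1) by (intro filterlim_atI) (auto simp: less_imp_neq[THEN not_sym] intro!: always_eventually)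
      ultimately show ?thesis unfolding q_def by (rule filterlim_compose)
    qed
    then show "AE x in lborel. (\<lambda>k. q k x) \<longlonglongrightarrow> partial j \<eta> x" by simp
    have "norm (q k x) \<le> B * indicat_real (cball 0 (R + 1)) x" for k x
    proof (cases "norm x \<le> R + 1")
      case True
      obtain s where "0 < s" "s < a k" "\<eta> (x + a k *\<^sub>R ?e) - \<eta> (x + 0 *\<^sub>R ?e) = (a k - 0) * partial j \<eta> (x + s *\<^sub>R ?e)"
        using MVT2[OF a(1)[of k], of "\<lambda>t. \<eta> (x + t *\<^sub>R ?e)" "\<lambda>s. partial j \<eta> (x + s *\<^sub>R ?e)"] D by blast
      then have "q k x = partial j \<eta> (x + s *\<^sub>R ?e)" using a(1)[of k] by (simp add: q_def)
      then show ?thesis using True B(2) by simp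
    next
      case False
      have "norm x \<le> norm (x + a k *\<^sub>R ?e) + norm (a k *\<^sub>R ?e)"
        by (metis add_diff_cancel_right' norm_triangle_ineq4)
      moreover have "norm (a k *\<^sub>R ?e) \<le> 1" using a[of k] by (simp add: norm_axis_1)
      ultimately show ?thesis using False R by (simp add: q_def)
    qed
    then show "AE x in lborel. norm (q k x) \<le> B * indicat_real (cball 0 (R + 1)) x" for k by simp
  qed
  then show ?thesis unfolding q_int using LIMSEQ_unique tendsto_const by blast
qed

lemma integration_by_parts:
  assumes t: "test_function \<phi>" and \<psi>: "smooth_on UNIV \<psi>"
  shows "(\<integral>x. partial j \<phi> x * \<psi> x \<partial>lborel) = - (\<integral>x. \<phi> x * partial j \<psi> x \<partial>lborel)"
proof -
  have int: "integrable lborel \<eta>" if "test_function \<eta>" for \<eta> :: "real ^ 'a \<Rightarrow> real"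
    using test_function_support[OF that] L2_bounded_support_integrable[OF test_function_L2[OF that]] by blast
  have "0 = (\<integral>x. partial j (\<lambda>x. \<phi> x * \<psi> x) x \<partial>lborel)"
    using integral_partial_test_function[OF test_function_mult[OF t \<psi>]] by simp
  also have "\<dots> = (\<integral>x. \<phi> x * partial j \<psi> x \<partial>lborel) + (\<integral>x. partial j \<phi> x * \<psi> x \<partial>lborel)"
    unfolding partial_mult[OF test_function_smooth[OF t] \<psi>]
    by (intro Bochner_Integration.integral_add int test_function_mult smooth_on_partial test_function_partial t \<psi>)
  finally show ?thesis by simp
qed

text \<open>The outermost derivative of \<open>\<phi>\<close> is moved first and becomes the
  innermost one on \<open>\<psi>\<close>, hence \<open>rev js\<close>.\<close>

lemma integration_by_parts_list:
  "test_function \<phi> \<Longrightarrow> smooth_on UNIV \<psi> \<Longrightarrow>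
    (\<integral>x. partials js \<phi> x * \<psi> x \<partial>lborel) = (- 1) ^ length js * (\<integral>x. \<phi> x * partials (rev js) \<psi> x \<partial>lborel)"
proof (induction js arbitrary: \<psi>)
  case (Cons j js)
  have "(\<integral>x. partials (j # js) \<phi> x * \<psi> x \<partial>lborel) = - (\<integral>x. partials js \<phi> x * partial j \<psi> x \<partial>lborel)"
    using integration_by_parts[OF test_function_partials[OF Cons.prems(1)] Cons.prems(2)] by simp
  also have "\<dots> = (- 1) ^ length (j # js) * (\<integral>x. \<phi> x * partials (rev js) (partial j \<psi>) x \<partial>lborel)"
    by (simp add: Cons.IH[OF Cons.prems(1) smooth_on_partial[OF Cons.prems(2)]])
  also have "partials (rev js) (partial j \<psi>) = partials (rev (j # js)) \<psi>" by (simp add: partials_append)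
  finally show ?case .
qed simp

text \<open>\<open>H\<^sup>\<infinity>\<close> functions are limits of test functions by cut-off; they include the transforms of
  band-limited functions, against which Fourier transforms can be tested.\<close>

definition Hinf :: "(real ^ 'n \<Rightarrow> real) \<Rightarrow> bool" where
  "Hinf \<psi> \<longleftrightarrow> smooth_on UNIV \<psi> \<and> (\<forall>js. L2_fun (partials js \<psi>))"

lemma Hinf_smooth: "Hinf \<psi> \<Longrightarrow> smooth_on UNIV \<psi>"
  and Hinf_L2: "Hinf \<psi> \<Longrightarrow> L2_fun (partials js \<psi>)"
  by (auto simp: Hinf_def)

lemma Hinf_partial: "Hinf \<psi> \<Longrightarrow> Hinf (partial j \<psi>)"
  unfolding Hinf_def
proof (intro conjI allI)
  assume a: "smooth_on UNIV \<psi> \<and> (\<forall>js. L2_fun (partials js \<psi>))"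
  then show "smooth_on UNIV (partial j \<psi>)" by (auto intro: smooth_on_partial)
  fix js
  show "L2_fun (partials js (partial j \<psi>))"
    using a[THEN conjunct2, rule_format, of "js @ [j]"] by (simp add: partials_append)
qed

text \<open>A derivative that falls on the cut-off brings a factor 1/r, which removes its
  contribution in the limit. The induction is from the innermost derivative, since that one meets
  the product first, and ranges over all test functions: the derivative of the cut-off is used as a
  new cut-off, whose value at 0 is not prescribed. Therefore \<open>\<theta> 0\<close> is kept
  general.\<close>

lemma cutoff_tendsto:
  fixes \<psi> \<theta> :: "real ^ 'n \<Rightarrow> real"
  shows "test_function \<theta> \<Longrightarrow> Hinf \<psi> \<Longrightarrow>
    ((\<lambda>r. L2_norm (\<lambda>x. partials js (\<lambda>x. \<theta> (inverse r *\<^sub>R x) * \<psi> x) x - \<theta> 0 * partials js \<psi> x)) \<longlongrightarrow> 0) at_top"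
proof (induction js arbitrary: \<theta> \<psi> rule: rev_induct)
  case Nil
  obtain B where B: "B > 0" "\<And>x. \<bar>\<theta> x\<bar> \<le> B" using test_function_bounded[OF Nil(1)] by blast
  have L2: "L2_fun \<psi>" using Hinf_L2[OF Nil(2), of "[]"] by simp
  note [measurable] = test_function_measurable[OF Nil(1)] L2_fun_measurable[OF L2]
  have "((\<lambda>r. L2_norm (\<lambda>x. \<theta> (inverse r *\<^sub>R x) * \<psi> x - \<theta> 0 * \<psi> x)) \<longlongrightarrow> 0) at_top"
  proof (rule L2_norm_tendsto_zero_at_top[OF L2_fun_scaleR[OF L2, of "2 * B"]])
    show "(\<lambda>x. \<theta> (inverse r *\<^sub>R x) * \<psi> x - \<theta> 0 * \<psi> x) \<in> borel_measurable borel" for r by measurable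
    fix r :: real and x
    have "\<bar>\<theta> (inverse r *\<^sub>R x) - \<theta> 0\<bar> \<le> 2 * B"
      using B(2)[of "inverse r *\<^sub>R x"] B(2)[of 0] by linarith
    from mult_right_mono[OF this abs_ge_zero[of "\<psi> x"]]
    show "norm (\<theta> (inverse r *\<^sub>R x) * \<psi> x - \<theta> 0 * \<psi> x) \<le> norm ((2 * B) *\<^sub>R \<psi> x)"
      using B(1) by (simp add: abs_mult left_diff_distrib[symmetric])
  next
    fix x :: "real ^ 'n"
    have "((\<lambda>r. inverse r *\<^sub>R x) \<longlongrightarrow> 0 *\<^sub>R x) at_top"
      by (rule tendsto_scaleR[OF tendsto_inverse_0_at_top[OF filterlim_ident] tendsto_const])
    then have "((\<lambda>r. \<theta> (inverse r *\<^sub>R x)) \<longlongrightarrow> \<theta> (0 *\<^sub>R x)) at_top"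
      using smooth_on_continuous[OF test_function_smooth[OF Nil(1)]]
      by (intro continuous_on_tendsto_compose[where s=UNIV and f=\<theta>]) auto
    from tendsto_diff[OF tendsto_mult[OF this tendsto_const] tendsto_const, of "\<psi> x" "\<theta> 0 * \<psi> x"]
    show "((\<lambda>r. \<theta> (inverse r *\<^sub>R x) * \<psi> x - \<theta> 0 * \<psi> x) \<longlongrightarrow> 0) at_top" by simp
  qed
  then show ?case by simp
next
  case (snoc j js)
  note \<theta> = snoc.prems(1) and \<psi> = snoc.prems(2)
  let ?\<theta>' = "partial j \<theta>" and ?\<psi>' = "partial j \<psi>"
  note \<theta>' = test_function_partial[OF \<theta>, of j] and \<psi>' = Hinf_partial[OF \<psi>, of j]
  let ?A = "\<lambda>r. partials js (\<lambda>x. \<theta> (inverse r *\<^sub>R x) * ?\<psi>' x)"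
  let ?B = "\<lambda>r. partials js (\<lambda>x. ?\<theta>' (inverse r *\<^sub>R x) * \<psi> x)"
  let ?a = "\<lambda>r. L2_norm (\<lambda>x. ?A r x - \<theta> 0 * partials js ?\<psi>' x)"
  let ?b = "\<lambda>r. L2_norm (\<lambda>x. ?B r x - ?\<theta>' 0 * partials js \<psi> x)"
  let ?c = "L2_norm (\<lambda>x. ?\<theta>' 0 * partials js \<psi> x)"
  have bound: "L2_norm (\<lambda>x. partials (js @ [j]) (\<lambda>x. \<theta> (inverse r *\<^sub>R x) * \<psi> x) x - \<theta> 0 * partials (js @ [j]) \<psi> x)
      \<le> ?a r + inverse r * (?b r + ?c)" if r: "r > 0" for r
  proof -
    have ir: "inverse r > 0" using r by simp
    have sA: "test_function (\<lambda>x. \<theta> (inverse r *\<^sub>R x) * ?\<psi>' x)"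
      by (rule test_function_mult[OF test_function_scale[OF \<theta> ir] Hinf_smooth[OF \<psi>']])
    have sB: "test_function (\<lambda>x. ?\<theta>' (inverse r *\<^sub>R x) * \<psi> x)"
      by (rule test_function_mult[OF test_function_scale[OF \<theta>' ir] Hinf_smooth[OF \<psi>]])
    have L2A: "L2_fun (\<lambda>x. ?A r x - \<theta> 0 * partials js ?\<psi>' x)"
      using L2_fun_scaleR[OF Hinf_L2[OF \<psi>'], of "\<theta> 0" js]
      by (intro L2_fun_diff test_function_L2[OF test_function_partials[OF sA]]) simp
    have L2c: "L2_fun (\<lambda>x. ?\<theta>' 0 * partials js \<psi> x)"
      using L2_fun_scaleR[OF Hinf_L2[OF \<psi>], of "?\<theta>' 0" js] by simp
    have L2B: "L2_fun (?B r)" by (rule test_function_L2[OF test_function_partials[OF sB]])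
    have "partial j (\<lambda>x. \<theta> (inverse r *\<^sub>R x) * \<psi> x) =
        (\<lambda>x. \<theta> (inverse r *\<^sub>R x) * ?\<psi>' x + inverse r * (?\<theta>' (inverse r *\<^sub>R x) * \<psi> x))"
      unfolding partial_mult[OF smooth_on_scale[OF test_function_smooth[OF \<theta>]] Hinf_smooth[OF \<psi>]]
        partial_scale[OF test_function_smooth[OF \<theta>]] by (simp add: mult.assoc)
    then have "partials (js @ [j]) (\<lambda>x. \<theta> (inverse r *\<^sub>R x) * \<psi> x) = (\<lambda>x. ?A r x + inverse r * ?B r x)"
      using partials_add[OF test_function_smooth[OF sA] smooth_on_mult[OF smooth_on_const[of "inverse r"] test_function_smooth[OF sB]], where js=js]
        partials_cmult[OF test_function_smooth[OF sB], where c="inverse r" and js=js]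
      by (simp add: partials_append)
    then have "L2_norm (\<lambda>x. partials (js @ [j]) (\<lambda>x. \<theta> (inverse r *\<^sub>R x) * \<psi> x) x - \<theta> 0 * partials (js @ [j]) \<psi> x) =
        L2_norm (\<lambda>x. (?A r x - \<theta> 0 * partials js ?\<psi>' x) + inverse r *\<^sub>R ?B r x)"
      by (simp add: partials_append algebra_simps)
    also have "\<dots> \<le> ?a r + L2_norm (\<lambda>x. inverse r *\<^sub>R ?B r x)"
      by (rule L2_norm_triangle[OF L2A L2_fun_scaleR[OF L2B]])
    also have "L2_norm (\<lambda>x. inverse r *\<^sub>R ?B r x) = inverse r * L2_norm (?B r)"
      using ir by (subst L2_norm_scaleR) simp
    also have "L2_norm (?B r) \<le> ?b r + ?c"
      using L2_norm_triangle[OF L2_fun_diff[OF L2B L2c] L2c] by simp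
    finally show ?thesis using ir by simp
  qed
  have "((\<lambda>r. ?a r + inverse r * (?b r + ?c)) \<longlongrightarrow> 0 + 0 * (0 + ?c)) at_top"
    by (intro tendsto_add tendsto_mult tendsto_const snoc.IH \<theta> \<theta>' \<psi> \<psi>' tendsto_inverse_0_at_top filterlim_ident)
  then have lim: "((\<lambda>r. ?a r + inverse r * (?b r + ?c)) \<longlongrightarrow> 0) at_top" by simp
  show ?case
    by (rule tendsto_sandwich[OF _ _ tendsto_const lim])
      (auto intro: bound eventually_mono[OF eventually_gt_at_top[of 0]])
qed

section \<open>Band-limited functions and their smooth transforms\<close>

abbreviation band :: "real \<Rightarrow> (real ^ 'n \<Rightarrow> complex) \<Rightarrow> bool" where
  "band R g \<equiv> L2_fun g \<and> (\<forall>\<xi>. norm \<xi> > R \<longrightarrow> g \<xi> = 0)"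

lemma band_integrable: "band R g \<Longrightarrow> integrable lborel g"
  by (rule L2_bounded_support_integrable) auto

lemma band_mult:
  assumes g: "band R g" and [measurable]: "m \<in> borel_measurable borel"
    and bound: "\<And>\<xi>. norm \<xi> \<le> R \<Longrightarrow> norm (m \<xi>) \<le> B"
  shows "band R (\<lambda>\<xi>. m \<xi> * g \<xi>)"
proof
  have [measurable]: "g \<in> borel_measurable borel" using g by auto
  have "norm (m \<xi> * g \<xi>) \<le> B * norm (g \<xi>)" for \<xi>
  proof (cases "norm \<xi> \<le> R")
    case True
    then show ?thesis using mult_right_mono[OF bound norm_ge_zero] by (simp add: norm_mult)
  next
    case False
    then show ?thesis using g by simp
  qed
  then show "L2_fun (\<lambda>\<xi>. m \<xi> * g \<xi>)" using g by (intro L2_fun_bound[of g "\<lambda>\<xi>. m \<xi> * g \<xi>" B]) simp_all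
qed (use g in auto)

text \<open>The factor by which differentiation in direction \<open>v\<close> multiplies the
  exponential kernel of \<open>FT\<close>.\<close>

abbreviation freq :: "real ^ 'n \<Rightarrow> real ^ 'n \<Rightarrow> complex" where
  "freq v \<xi> \<equiv> - \<i> * complex_of_real (\<xi> \<bullet> v)"

lemma band_freq:
  assumes g: "band R g" shows "band R (\<lambda>\<xi>. freq v \<xi> * g \<xi>)"
proof (rule band_mult[OF g])
  show "norm (freq v \<xi>) \<le> R * norm v" if "norm \<xi> \<le> R" for \<xi>
    using Cauchy_Schwarz_ineq2[of \<xi> v] mult_right_mono[OF that norm_ge_zero[of v]]
    by (simp add: norm_mult)
qed measurable

lemma FT_add:
  assumes "integrable lborel f" "integrable lborel g"
  shows "FT (\<lambda>\<xi>. f \<xi> + g \<xi>) x = FT f x + FT g x"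
  unfolding FT_def distrib_left
    Bochner_Integration.integral_add[OF FT_integrand_integrable[OF assms(1)] FT_integrand_integrable[OF assms(2)]]
  by (rule scaleR_add_right)

lemma FT_cmult: "FT (\<lambda>\<xi>. c * f \<xi>) x = c * FT f x"
proof -
  have "(\<integral>\<xi>. exp (- \<i> * complex_of_real (\<xi> \<bullet> x)) * (c * f \<xi>) \<partial>lborel) =
      (\<integral>\<xi>. c * (exp (- \<i> * complex_of_real (\<xi> \<bullet> x)) * f \<xi>) \<partial>lborel)"
    by (simp add: ac_simps)
  then show ?thesis unfolding FT_def by simp
qed

text \<open>On the band the second-order remainder of the exponential is at most (R |v|)^2 / 2,
  independently of \<open>x\<close>. Integrated against the integrable \<open>g\<close> it gives an
  error quadratic in \<open>v\<close>.\<close>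

lemma FT_has_derivative:
  fixes g :: "real ^ 'n \<Rightarrow> complex"
  assumes g: "band R g"
  shows "(FT g has_derivative (\<lambda>v. FT (\<lambda>\<xi>. freq v \<xi> * g \<xi>) x)) (at x)"
proof -
  let ?D = "\<lambda>v. FT (\<lambda>\<xi>. freq v \<xi> * g \<xi>) x"
  note gi = band_integrable[OF g] and fi = band_integrable[OF band_freq[OF g]]
  have "linear ?D"
  proof (rule linearI)
    fix v w :: "real ^ 'n" and c :: real
    have "(\<lambda>\<xi>. freq (v + w) \<xi> * g \<xi>) = (\<lambda>\<xi>. freq v \<xi> * g \<xi> + freq w \<xi> * g \<xi>)"
      by (simp add: inner_add_right algebra_simps)
    then show "?D (v + w) = ?D v + ?D w" using FT_add[OF fi fi] by simp
    have eq: "(\<lambda>\<xi>. freq (c *\<^sub>R v) \<xi> * g \<xi>) = (\<lambda>\<xi>. complex_of_real c * (freq v \<xi> * g \<xi>))"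
      by (simp add: ac_simps)
    show "?D (c *\<^sub>R v) = c *\<^sub>R ?D v" unfolding eq FT_cmult by (rule scaleR_conv_of_real[symmetric])
  qed
  then have bl: "bounded_linear ?D" by (simp add: linear_conv_bounded_linear)
  define c0 where "c0 = (2 * pi) powr (- real CARD('n) / 2)"
  have c0: "c0 \<ge> 0" by (simp add: c0_def)
  define G where "G = (\<integral>\<xi>. norm (g \<xi>) \<partial>lborel)"
  define C where "C = c0 * (R\<^sup>2 / 2 * G)"
  have est: "norm (FT g (x + v) - FT g x - ?D v) \<le> C * (norm v)\<^sup>2" for v
  proof -
    let ?e = "\<lambda>\<xi>. exp (- \<i> * complex_of_real (\<xi> \<bullet> x))"
    let ?r = "\<lambda>\<xi>. (exp (freq v \<xi>) - 1 - freq v \<xi>) * g \<xi>"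
    have split: "exp (- \<i> * complex_of_real (\<xi> \<bullet> (x + v))) = ?e \<xi> * exp (freq v \<xi>)" for \<xi>
      by (simp add: exp_add[symmetric] inner_add_right algebra_simps)
    have "FT g (x + v) - FT g x - ?D v = c0 *\<^sub>R (\<integral>\<xi>. ?e \<xi> * ?r \<xi> \<partial>lborel)"
    proof -
      have "(\<integral>\<xi>. ?e \<xi> * ?r \<xi> \<partial>lborel) =
          (\<integral>\<xi>. exp (- \<i> * complex_of_real (\<xi> \<bullet> (x + v))) * g \<xi> - ?e \<xi> * g \<xi> - ?e \<xi> * (freq v \<xi> * g \<xi>) \<partial>lborel)"
        unfolding split by (intro Bochner_Integration.integral_cong refl) (simp add: algebra_simps)
      also have "\<dots> = (\<integral>\<xi>. exp (- \<i> * complex_of_real (\<xi> \<bullet> (x + v))) * g \<xi> \<partial>lborel)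
          - (\<integral>\<xi>. ?e \<xi> * g \<xi> \<partial>lborel) - (\<integral>\<xi>. ?e \<xi> * (freq v \<xi> * g \<xi>) \<partial>lborel)"
        unfolding Bochner_Integration.integral_diff[OF Bochner_Integration.integrable_diff[OF FT_integrand_integrable[OF gi] FT_integrand_integrable[OF gi]] FT_integrand_integrable[OF fi]]
          Bochner_Integration.integral_diff[OF FT_integrand_integrable[OF gi] FT_integrand_integrable[OF gi]] ..
      finally show ?thesis by (simp only: FT_def c0_def[symmetric] scaleR_diff_right)
    qed
    also have "norm \<dots> \<le> c0 * (\<integral>\<xi>. R\<^sup>2 / 2 * (norm v)\<^sup>2 * norm (g \<xi>) \<partial>lborel)"
    proof -
      have pt: "norm (?e \<xi> * ?r \<xi>) \<le> R\<^sup>2 / 2 * (norm v)\<^sup>2 * norm (g \<xi>)" for \<xi>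
      proof (cases "norm \<xi> \<le> R")
        case True
        have "norm (exp (freq v \<xi>) - 1 - freq v \<xi>) \<le> (\<xi> \<bullet> v)\<^sup>2 / 2"
          using iexp_approx1[of "- (\<xi> \<bullet> v)" 1] by (simp add: power2_eq_square algebra_simps abs_mult)
        also have "(\<xi> \<bullet> v)\<^sup>2 \<le> (R * norm v)\<^sup>2"
          using Cauchy_Schwarz_ineq2[of \<xi> v] mult_right_mono[OF True norm_ge_zero[of v]]
          by (intro abs_le_square_iff[THEN iffD1]) simp
        finally have "norm (exp (freq v \<xi>) - 1 - freq v \<xi>) \<le> R\<^sup>2 / 2 * (norm v)\<^sup>2"
          by (simp add: power_mult_distrib)
        from mult_right_mono[OF this norm_ge_zero[of "g \<xi>"]] show ?thesis by (simp add: norm_mult)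
      next
        case False
        then show ?thesis using g by simp
      qed
      have "norm (\<integral>\<xi>. ?e \<xi> * ?r \<xi> \<partial>lborel) \<le> (\<integral>\<xi>. norm (?e \<xi> * ?r \<xi>) \<partial>lborel)" by (rule integral_norm_bound)
      also have "\<dots> \<le> (\<integral>\<xi>. R\<^sup>2 / 2 * (norm v)\<^sup>2 * norm (g \<xi>) \<partial>lborel)"
        by (rule integral_mono'[OF _ pt]) (use gi in simp_all)
      finally show ?thesis unfolding norm_scaleR abs_of_nonneg[OF c0] by (rule mult_left_mono[OF _ c0])
    qed
    also have "\<dots> = C * (norm v)\<^sup>2" by (simp add: C_def G_def)
    finally show ?thesis .
  qed
  show ?thesis
    unfolding has_derivative_at
  proof (intro conjI bl)
    have lim: "((\<lambda>v::real ^ 'n. C * norm v) \<longlongrightarrow> 0) (at 0)"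
      using tendsto_mult[OF tendsto_const tendsto_norm_zero[OF tendsto_ident_at], of C] by simp
    have "norm (norm (FT g (x + v) - FT g x - ?D v) / norm v) \<le> C * norm v" for v
      using divide_right_mono[OF est[of v] norm_ge_zero[of v]] by (cases "v = 0") (simp_all add: power2_eq_square)
    then show "(\<lambda>v. norm (FT g (x + v) - FT g x - ?D v) / norm v) \<midarrow>0\<rightarrow> 0"
      by (intro Lim_null_comparison[OF _ lim]) simp
  qed
qed

text \<open>The multiplier that differentiation of \<open>FT g\<close> puts in front of
  \<open>g\<close>. For the transform of a derivative of \<open>f\<close> the sign is the opposite
  one for each derivative, so there the factor is (-1)^k \<open>mon\<close> with k the
  order.\<close>

definition mon :: "'n list \<Rightarrow> real ^ 'n \<Rightarrow> complex" where
  "mon js \<xi> = prod_list (map (\<lambda>j. - \<i> * complex_of_real (\<xi> $ j)) js)"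

lemma mon_simps [simp]:
  "mon [] \<xi> = 1" "mon (j # js) \<xi> = - \<i> * complex_of_real (\<xi> $ j) * mon js \<xi>"
  by (simp_all add: mon_def)

lemma mon_rev: "mon (rev js) \<xi> = mon js \<xi>"
  by (simp add: mon_def rev_map[symmetric] prod_list.rev)

lemma mon_measurable [measurable]: "mon js \<in> borel_measurable borel"
proof (induction js)
  case (Cons j js)
  then show ?case unfolding mon_simps[abs_def] by measurable
qed (simp add: mon_def[abs_def])

lemma norm_mon: "norm (mon js \<xi>) \<le> norm \<xi> ^ length js"
  by (induction js) (auto simp: norm_mult component_le_norm_cart intro!: mult_mono)

lemma band_mon:
  assumes g: "band R g" shows "band R (\<lambda>\<xi>. mon js \<xi> * g \<xi>)"
proof (rule band_mult[OF g])
  show "norm (mon js \<xi>) \<le> R ^ length js" if "norm \<xi> \<le> R" for \<xi>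
    using norm_mon[of js \<xi>] power_mono[OF that norm_ge_zero] by (rule order_trans)
qed measurable

lemma Re_FT_has_derivative:
  assumes g: "band R g"
  shows "((\<lambda>x. Re (FT g x)) has_derivative (\<lambda>v. Re (FT (\<lambda>\<xi>. freq v \<xi> * g \<xi>) x))) (at x)"
  by (rule bounded_linear.has_derivative[OF bounded_linear_Re FT_has_derivative[OF g]])

lemma smooth_Re_FT:
  assumes "band R g" shows "smooth_on UNIV (\<lambda>x. Re (FT g x))"
  unfolding smooth_on_def
proof
  fix k show "Ck_on k UNIV (\<lambda>x. Re (FT g x))"
    using assms
  proof (induction k arbitrary: g)
    case 0
    have "isCont (\<lambda>x. Re (FT g x)) x" for x
      using has_derivative_continuous[OF Re_FT_has_derivative[OF 0]] .
    then show ?case by (simp add: continuous_at_imp_continuous_on)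
  next
    case (Suc k)
    show ?case
      by (rule Ck_SucI[OF Re_FT_has_derivative[OF Suc.prems] Suc.IH[OF band_freq[OF Suc.prems]]])
  qed
qed

lemma partials_Re_FT:
  assumes g: "band R g"
  shows "partials js (\<lambda>x. Re (FT g x)) = (\<lambda>x. Re (FT (\<lambda>\<xi>. mon js \<xi> * g \<xi>) x))"
proof (induction js)
  case (Cons j js)
  have "partials (j # js) (\<lambda>x. Re (FT g x)) = partial j (\<lambda>x. Re (FT (\<lambda>\<xi>. mon js \<xi> * g \<xi>) x))"
    by (simp add: Cons.IH)
  also have "\<dots> = (\<lambda>x. Re (FT (\<lambda>\<xi>. mon (j # js) \<xi> * g \<xi>) x))"
    using partial_eq[OF Re_FT_has_derivative[OF band_mon[OF g]]]
    by (simp add: fun_eq_iff inner_axis mult.assoc)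
  finally show ?case .
qed simp

lemma L2_fun_Re: "L2_fun f \<Longrightarrow> L2_fun (\<lambda>x. Re (f x))"
  by (rule L2_fun_bound[where C=1 and f=f]) (auto simp: abs_Re_le_cmod)

lemma L2_norm_Re_le: "L2_fun f \<Longrightarrow> L2_norm (\<lambda>x. Re (f x)) \<le> L2_norm f"
  by (rule L2_norm_mono) (auto simp: abs_Re_le_cmod)

lemma Hinf_Re_FT:
  assumes g: "band R g" shows "Hinf (\<lambda>x. Re (FT g x))"
  unfolding Hinf_def partials_Re_FT[OF g]
  by (intro conjI allI smooth_Re_FT[OF g] L2_fun_Re
      Plancherel_L1_L2(1)[OF band_integrable[OF band_mon[OF g]] conjunct1[OF band_mon[OF g]]])

section \<open>Weak derivatives on the Fourier side\<close>

lemma L2_integral_scaleR_nth: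
  fixes f :: "real ^ 'n \<Rightarrow> real ^ 'm"
  assumes p: "L2_fun p" and f: "L2_fun f"
  shows "(\<integral>x. p x *\<^sub>R f x \<partial>lborel) $ i = (\<integral>x. p x * f x $ i \<partial>lborel)"
proof -
  note [measurable] = L2_fun_measurable[OF p] L2_fun_measurable[OF f]
  have "integrable lborel (\<lambda>x. p x *\<^sub>R f x)" by (rule L2_integrable_bound[OF p f]) auto
  from integral_bounded_linear[OF bounded_linear_vec_nth this, of i] show ?thesis by simp
qed

lemma is_weak_deriv_iff:
  fixes f g :: "real ^ 'n \<Rightarrow> real ^ 'm"
  assumes f: "L2_fun f" and g: "L2_fun g"
  shows "is_weak_deriv js f g \<longleftrightarrow> (\<forall>i \<phi>. test_function \<phi> \<longrightarrow>
    (\<integral>x. partials js \<phi> x * f x $ i \<partial>lborel) = (- 1) ^ length js * (\<integral>x. \<phi> x * g x $ i \<partial>lborel))"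
  unfolding is_weak_deriv_def
  by (auto simp: vec_eq_iff L2_integral_scaleR_nth f g test_function_L2 test_function_partials)

lemma cutoff_sequence:
  fixes \<psi> :: "real ^ 'n \<Rightarrow> real"
  assumes \<psi>: "Hinf \<psi>"
  obtains \<Phi> where "\<And>k::nat. test_function (\<Phi> k)"
    "\<And>js. (\<lambda>k. L2_norm (\<lambda>x. partials js (\<Phi> k) x - partials js \<psi> x)) \<longlonglongrightarrow> 0"
proof -
  obtain \<theta> :: "real ^ 'n \<Rightarrow> real" where \<theta>: "test_function \<theta>" "\<theta> 0 = 1" using test_function_exists by blast
  define \<Phi> where "\<Phi> k x = \<theta> (inverse (real (Suc k)) *\<^sub>R x) * \<psi> x" for k x
  have lim: "filterlim (\<lambda>k. real (Suc k)) at_top sequentially"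
    by (rule filterlim_compose[OF filterlim_real_sequentially filterlim_Suc])
  show ?thesis
  proof
    show "test_function (\<Phi> k)" for k
      unfolding \<Phi>_def by (rule test_function_mult[OF test_function_scale[OF \<theta>(1)] Hinf_smooth[OF \<psi>]]) simp
    show "(\<lambda>k. L2_norm (\<lambda>x. partials js (\<Phi> k) x - partials js \<psi> x)) \<longlonglongrightarrow> 0" for js
      using filterlim_compose[OF cutoff_tendsto[OF \<theta>(1) \<psi>] lim, of js] unfolding \<theta>(2) \<Phi>_def by simp
  qed
qed

lemma weak_identity_Hinf:
  fixes f h :: "real ^ 'n \<Rightarrow> real"
  assumes f: "L2_fun f" and h: "L2_fun h" and \<psi>: "Hinf \<psi>"
    and weak: "\<And>\<phi>. test_function \<phi> \<Longrightarrow> (\<integral>x. partials js \<phi> x * f x \<partial>lborel) = c * (\<integral>x. \<phi> x * h x \<partial>lborel)"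
  shows "(\<integral>x. partials js \<psi> x * f x \<partial>lborel) = c * (\<integral>x. \<psi> x * h x \<partial>lborel)"
proof -
  obtain \<Phi> where \<Phi>: "\<And>k::nat. test_function (\<Phi> k)"
    and lim: "\<And>js. (\<lambda>k. L2_norm (\<lambda>x. partials js (\<Phi> k) x - partials js \<psi> x)) \<longlonglongrightarrow> 0"
    using cutoff_sequence[OF \<psi>] by blast
  note L2 = test_function_L2[OF test_function_partials[OF \<Phi>]]
  have "(\<lambda>k. \<integral>x. f x * partials js (\<Phi> k) x \<partial>lborel) \<longlonglongrightarrow> (\<integral>x. f x * partials js \<psi> x \<partial>lborel)"
    by (rule L2_integral_mult_tendsto[OF f L2 Hinf_L2[OF \<psi>] lim])
  moreover have "(\<lambda>k. c * (\<integral>x. h x * partials [] (\<Phi> k) x \<partial>lborel)) \<longlonglongrightarrow> c * (\<integral>x. h x * partials [] \<psi> x \<partial>lborel)"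
    by (rule tendsto_mult[OF tendsto_const L2_integral_mult_tendsto[OF h L2 Hinf_L2[OF \<psi>] lim]])
  ultimately show ?thesis
    using LIMSEQ_unique weak[OF \<Phi>] by (simp add: mult.commute[of "f _"] mult.commute[of "h _"])
qed

lemma L2_FT_mult_integrable:
  assumes g: "band R g" and f: "L2_fun f"
  shows "integrable lborel (\<lambda>x. FT g x * complex_of_real (f x))"
proof -
  note L = Plancherel_L1_L2(1)[OF band_integrable[OF g] conjunct1[OF g]]
  note [measurable] = L2_fun_measurable[OF L] L2_fun_measurable[OF f]
  show ?thesis by (rule L2_integrable_bound[OF L f]) (auto simp: norm_mult)
qed

lemma Re_integral_FT:
  assumes g: "band R g" and f: "L2_fun f"
  shows "Re (\<integral>x. FT g x * complex_of_real (f x) \<partial>lborel) = (\<integral>x. Re (FT g x) * f x \<partial>lborel)"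
  unfolding integral_Re[OF L2_FT_mult_integrable[OF g f], symmetric] by simp

lemma band_cmult: "band R g \<Longrightarrow> band R (\<lambda>\<xi>. c * g \<xi>)"
  by (rule band_mult[where B="norm c"]) auto

text \<open>Test the weak identity against the transform of an arbitrary band-limited
  \<open>g\<close> and move the transform over to \<open>f\<close> and \<open>h\<close> by the
  multiplication formula; \<open>L2_local_dual_zero\<close> then compares the two sides.\<close>

lemma weak_deriv_fourier:
  fixes f h :: "real ^ 'n \<Rightarrow> real ^ 'm"
  assumes f: "L2_fun f" and h: "L2_fun h" and weak: "is_weak_deriv js f h"
  shows "AE \<xi> in lborel. fourier h \<xi> $ i = (- 1) ^ length js * mon js \<xi> * fourier f \<xi> $ i"
proof -
  let ?s = "(- 1) ^ length js :: complex"
  let ?f = "fourier f" and ?h = "fourier h"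
  define d where "d \<xi> = mon js \<xi> * ?f \<xi> $ i - ?s * ?h \<xi> $ i" for \<xi>
  have fi: "L2_fun (\<lambda>\<xi>. ?f \<xi> $ i)" and hi: "L2_fun (\<lambda>\<xi>. ?h \<xi> $ i)"
    by (intro L2_fun_nth L2_fun_fourier f h)+
  have Z: "(\<integral>x. FT (\<lambda>\<xi>. mon js \<xi> * g \<xi>) x * complex_of_real (f x $ i) \<partial>lborel) =
      ?s * (\<integral>x. FT g x * complex_of_real (h x $ i) \<partial>lborel)" if g: "band R g" for R g
  proof -
    let ?Z = "\<lambda>g. (\<integral>x. FT (\<lambda>\<xi>. mon js \<xi> * g \<xi>) x * complex_of_real (f x $ i) \<partial>lborel)
      - ?s * (\<integral>x. FT g x * complex_of_real (h x $ i) \<partial>lborel)"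
    have ReZ: "Re (?Z g) = 0" if g: "band R g" for g
    proof -
      have "(\<integral>x. partials js (\<lambda>x. Re (FT g x)) x * f x $ i \<partial>lborel) =
          (- 1) ^ length js * (\<integral>x. Re (FT g x) * h x $ i \<partial>lborel)"
        using weak[unfolded is_weak_deriv_iff[OF f h]]
        by (intro weak_identity_Hinf[OF L2_fun_nth[OF f] L2_fun_nth[OF h] Hinf_Re_FT[OF g]]) auto
      then show ?thesis
        unfolding partials_Re_FT[OF g] Re_integral_FT[OF band_mon[OF g] L2_fun_nth[OF f], symmetric]
          Re_integral_FT[OF g L2_fun_nth[OF h], symmetric]
        by (cases "even (length js)") auto
    qed
    \<comment> \<open>Test functions are real, so only the real part of the identity has been
      reached. Replacing \<open>g\<close> by -i g gives the imaginary part.\<close>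
    have lin: "?Z (\<lambda>\<xi>. - \<i> * g \<xi>) = - \<i> * ?Z g"
    proof -
      have "(\<lambda>\<xi>. mon js \<xi> * (- \<i> * g \<xi>)) = (\<lambda>\<xi>. - \<i> * (mon js \<xi> * g \<xi>))" by (simp add: ac_simps)
      then show ?thesis unfolding FT_cmult by (simp only: FT_cmult mult.assoc integral_mult_right_zero) (simp add: algebra_simps)
    qed
    have "Re (?Z (\<lambda>\<xi>. - \<i> * g \<xi>)) = 0" by (rule ReZ[OF band_cmult[OF g]])
    then have "Im (?Z g) = 0" unfolding lin by simp
    with ReZ[OF g] have "?Z g = 0" using complex_eqI[of "?Z g" 0] by simp
    then show ?thesis by simp
  qed
  have "AE \<xi> in lborel. d \<xi> = 0"
  proof (rule L2_local_dual_zero)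
    note [measurable] = L2_fun_measurable[OF fi] L2_fun_measurable[OF hi]
    show "L2_fun (trunc R d)" for R
    proof -
      have "band R (\<lambda>\<xi>. mon js \<xi> * trunc R (\<lambda>\<xi>. ?f \<xi> $ i) \<xi>)"
        by (rule band_mon) (auto intro: L2_fun_trunc[OF fi])
      moreover have "band R (\<lambda>\<xi>. ?s * trunc R (\<lambda>\<xi>. ?h \<xi> $ i) \<xi>)"
        by (rule band_cmult) (auto intro: L2_fun_trunc[OF hi])
      ultimately have "L2_fun (\<lambda>\<xi>. mon js \<xi> * trunc R (\<lambda>\<xi>. ?f \<xi> $ i) \<xi> - ?s * trunc R (\<lambda>\<xi>. ?h \<xi> $ i) \<xi>)"
        by (intro L2_fun_diff) auto
      then show ?thesis unfolding d_def by (simp add: scaleR_diff_right)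
    qed
    fix R and g :: "real ^ 'n \<Rightarrow> complex" assume "L2_fun g" "\<And>\<xi>. norm \<xi> > R \<Longrightarrow> g \<xi> = 0"
    then have g: "band R g" by blast
    have int: "integrable lborel (\<lambda>\<xi>. g' \<xi> * v \<xi>)" if "band R g'" "L2_fun v" for g' v :: "real ^ 'n \<Rightarrow> complex"
      using that by (intro L2_integrable_bound[of g' v]) (auto simp: norm_mult)
    have "(\<integral>\<xi>. g \<xi> * d \<xi> \<partial>lborel) = (\<integral>\<xi>. (mon js \<xi> * g \<xi>) * ?f \<xi> $ i - ?s * (g \<xi> * ?h \<xi> $ i) \<partial>lborel)"
      unfolding d_def by (simp add: algebra_simps)
    also have "\<dots> = (\<integral>\<xi>. (mon js \<xi> * g \<xi>) * ?f \<xi> $ i \<partial>lborel) - ?s * (\<integral>\<xi>. g \<xi> * ?h \<xi> $ i \<partial>lborel)"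
      using int[OF band_mon[OF g] fi] int[OF g hi] by simp
    also have "\<dots> = 0"
      unfolding fourier_multiplication[OF f band_integrable[OF band_mon[OF g]] conjunct1[OF band_mon[OF g]], symmetric]
        fourier_multiplication[OF h band_integrable[OF g] conjunct1[OF g], symmetric]
      using Z[OF g] by simp
    finally show "(\<integral>\<xi>. g \<xi> * d \<xi> \<partial>lborel) = 0" .
  qed
  then show ?thesis
  proof eventually_elim
    case (elim \<xi>)
    have "?s * ?s = 1" by (simp add: power_mult_distrib[symmetric])
    then have "?h \<xi> $ i = ?s * (?s * ?h \<xi> $ i)" by (simp add: mult.assoc[symmetric])
    then show ?case using elim by (simp add: d_def mult.assoc)
  qed
qed

lemma FT_diff:
  assumes "integrable lborel f" "integrable lborel g"
  shows "FT f x - FT g x = FT (\<lambda>\<xi>. f \<xi> - g \<xi>) x"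
  unfolding FT_def right_diff_distrib
    Bochner_Integration.integral_diff[OF FT_integrand_integrable[OF assms(1)] FT_integrand_integrable[OF assms(2)]]
  by (rule scaleR_diff_right[symmetric])

text \<open>Converse to \<open>weak_deriv_fourier\<close>. Band-limited approximations of
  \<open>f\<close> are smooth, and their derivatives form a Cauchy sequence in L^2 because the
  truncations of the multiplied transform do. The limit is the weak derivative, as integration by
  parts survives L^2 limits on both sides.\<close>

lemma weak_deriv_exists:
  fixes f :: "real ^ 'n \<Rightarrow> real ^ 'm"
  assumes f: "L2_fun f" and w: "\<And>i. L2_fun (\<lambda>\<xi>. mon js \<xi> * fourier f \<xi> $ i)"
  shows "\<exists>h. L2_fun h \<and> is_weak_deriv js f h"
proof -
  have "\<exists>H. L2_fun H \<and> (\<forall>\<phi>. test_function \<phi> \<longrightarrow>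
      (\<integral>x. partials js \<phi> x * f x $ i \<partial>lborel) = (- 1) ^ length js * (\<integral>x. \<phi> x * H x \<partial>lborel))" for i
  proof -
    let ?f = "\<lambda>\<xi>. fourier f \<xi> $ i"
    have fi: "L2_fun ?f" by (intro L2_fun_nth L2_fun_fourier f)
    note [measurable] = L2_fun_measurable[OF fi]
    \<comment> \<open>The inversion formula evaluates \<open>FT\<close> at -x. By
      \<open>FT_uminus\<close> this is the conjugate of the transform of the conjugate at x, and
      conjugation does not affect the real part; so \<open>\<psi> k\<close> is the real part of the
      approximation in \<open>fourier_inversion\<close>.\<close>
    define \<gamma> where "\<gamma> k \<xi> = cnj (trunc (real k) ?f \<xi>)" for k \<xi>
    have \<gamma>: "band (real k) (\<gamma> k)" for k
      unfolding \<gamma>_def using L2_fun_cnj[OF L2_fun_trunc[OF fi]] by auto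
    define \<psi> where "\<psi> k x = Re (FT (\<gamma> k) x)" for k x
    have \<psi>: "Hinf (\<psi> k)" for k unfolding \<psi>_def by (rule Hinf_Re_FT[OF \<gamma>])
    have D: "partials is (\<psi> k) = (\<lambda>x. Re (FT (\<lambda>\<xi>. mon is \<xi> * \<gamma> k \<xi>) x))" for "is" k
      unfolding \<psi>_def by (rule partials_Re_FT[OF \<gamma>])
    have conv: "(\<lambda>k. L2_norm (\<lambda>x. \<psi> k x - f x $ i)) \<longlonglongrightarrow> 0"
    proof (rule tendsto_sandwich[OF _ _ tendsto_const filterlim_compose[OF fourier_inversion[OF f, of i] filterlim_real_sequentially]])
      have "L2_norm (\<lambda>x. \<psi> k x - f x $ i) \<le> L2_norm (\<lambda>x. FT (trunc (real k) ?f) (- x) - complex_of_real (f x $ i))" for k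
      proof -
        have "L2_fun (\<lambda>x. FT (trunc (real k) ?f) (- x) - complex_of_real (f x $ i))"
          by (intro L2_fun_diff L2_reflect Plancherel_L1_L2 integrable_trunc L2_fun_trunc L2_fun_of_real L2_fun_nth[OF f] fi)
        moreover have "\<psi> k x - f x $ i = Re (FT (trunc (real k) ?f) (- x) - complex_of_real (f x $ i))" for x
          unfolding FT_uminus \<psi>_def \<gamma>_def by simp
        ultimately show ?thesis by (simp only: L2_norm_Re_le)
      qed
      then show "\<forall>\<^sub>F k in sequentially. L2_norm (\<lambda>x. \<psi> k x - f x $ i) \<le>
          L2_norm (\<lambda>x. FT (trunc (real k) ?f) (- x) - complex_of_real (f x $ i))" by simp
    qed simp
    define W where "W \<xi> = mon js \<xi> * cnj (?f \<xi>)" for \<xi>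
    have W: "L2_fun W"
    proof (rule L2_fun_bound[OF w[of i], where C=1])
      show "W \<in> borel_measurable borel" unfolding W_def by measurable
    qed (simp add: W_def norm_mult)
    have \<gamma>W: "(\<lambda>\<xi>. mon js \<xi> * \<gamma> k \<xi>) = trunc (real k) W" for k
      by (simp add: \<gamma>_def W_def fun_eq_iff)
    let ?d = "\<lambda>k. L2_norm (\<lambda>x. trunc (real k) W x - W x)"
    have d: "?d \<longlonglongrightarrow> 0" by (rule filterlim_compose[OF trunc_tendsto[OF W] filterlim_real_sequentially])
    have "\<exists>N. \<forall>k\<ge>N. \<forall>l\<ge>N. L2_norm (\<lambda>x. partials js (\<psi> k) x - partials js (\<psi> l) x) < e" if e: "e > 0" for e
    proof -
      obtain N where N: "\<And>k. k \<ge> N \<Longrightarrow> norm (?d k - 0) < e / 2" using LIMSEQ_D[OF d, of "e/2"] e by auto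
      have "L2_norm (\<lambda>x. partials js (\<psi> k) x - partials js (\<psi> l) x) < e" if kl: "k \<ge> N" "l \<ge> N" for k l
      proof -
        let ?t = "\<lambda>k. trunc (real k) W"
        note ti = integrable_trunc[OF W] and t = L2_fun_trunc[OF W]
        have FTd: "FT (?t k) x - FT (?t l) x = FT (\<lambda>\<xi>. ?t k \<xi> - ?t l \<xi>) x" for x
          by (rule FT_diff[OF ti ti])
        have di: "integrable lborel (\<lambda>\<xi>. ?t k \<xi> - ?t l \<xi>)" and d2: "L2_fun (\<lambda>\<xi>. ?t k \<xi> - ?t l \<xi>)"
          by (intro Bochner_Integration.integrable_diff ti L2_fun_diff t)+
        have "L2_norm (\<lambda>x. partials js (\<psi> k) x - partials js (\<psi> l) x) = L2_norm (\<lambda>x. Re (FT (\<lambda>\<xi>. ?t k \<xi> - ?t l \<xi>) x))"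
          unfolding D \<gamma>W FTd[symmetric] by simp
        also have "\<dots> \<le> L2_norm (\<lambda>\<xi>. ?t k \<xi> - ?t l \<xi>)"
          using L2_norm_Re_le[OF Plancherel_L1_L2(1)[OF di d2]] Plancherel_L1_L2(2)[OF di d2] by simp
        also have "\<dots> \<le> ?d k + ?d l"
          using L2_norm_triangle_diff[OF t[of "real k"] W t[of "real l"]] L2_norm_minus_commute[of W "?t l"] by simp
        also have "\<dots> < e" using N[OF kl(1)] N[OF kl(2)] by simp
        finally show ?thesis .
      qed
      then show ?thesis by blast
    qed
    from L2_complete[OF Hinf_L2[OF \<psi>] this] obtain H where H: "L2_fun H"
      and limH: "(\<lambda>k. L2_norm (\<lambda>x. partials js (\<psi> k) x - H x)) \<longlonglongrightarrow> 0" by blast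
    have "(\<integral>x. partials js \<phi> x * f x $ i \<partial>lborel) = (- 1) ^ length js * (\<integral>x. \<phi> x * H x \<partial>lborel)"
      if \<phi>: "test_function \<phi>" for \<phi>
    proof (rule LIMSEQ_unique)
      have "L2_fun (\<psi> k)" for k using Hinf_L2[OF \<psi>[of k], of "[]"] by simp
      then show "(\<lambda>k. \<integral>x. partials js \<phi> x * \<psi> k x \<partial>lborel) \<longlonglongrightarrow> (\<integral>x. partials js \<phi> x * f x $ i \<partial>lborel)"
        by (intro L2_integral_mult_tendsto[OF test_function_L2[OF test_function_partials[OF \<phi>]] _ L2_fun_nth[OF f] conv])
      \<comment> \<open>Integration by parts reverses the order of the derivatives; the multiplier
        is a commutative product, which undoes the reversal.\<close>
      have "partials (rev js) (\<psi> k) = partials js (\<psi> k)" for k unfolding D mon_rev ..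
      then have "(\<integral>x. partials js \<phi> x * \<psi> k x \<partial>lborel) = (- 1) ^ length js * (\<integral>x. \<phi> x * partials js (\<psi> k) x \<partial>lborel)" for k
        using integration_by_parts_list[OF \<phi> Hinf_smooth[OF \<psi>], where js=js] by simp
      then show "(\<lambda>k. \<integral>x. partials js \<phi> x * \<psi> k x \<partial>lborel) \<longlonglongrightarrow> (- 1) ^ length js * (\<integral>x. \<phi> x * H x \<partial>lborel)"
        using tendsto_mult[OF tendsto_const L2_integral_mult_tendsto[OF test_function_L2[OF \<phi>] Hinf_L2[OF \<psi>] H limH], of "(- 1) ^ length js"]
        by simp
    qed
    with H show ?thesis by blast
  qed
  then obtain H where H: "\<And>i. L2_fun (H i)" and eq: "\<And>i \<phi>. test_function \<phi> \<Longrightarrow>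
      (\<integral>x. partials js \<phi> x * f x $ i \<partial>lborel) = (- 1) ^ length js * (\<integral>x. \<phi> x * H i x \<partial>lborel)"
    by metis
  let ?h = "\<lambda>x. \<chi> i. H i x"
  have h: "L2_fun ?h" using H by (intro L2_fun_vec) simp
  moreover have "is_weak_deriv js f ?h"
    unfolding is_weak_deriv_iff[OF f h] using eq by simp
  ultimately show ?thesis by blast
qed

section \<open>The Lyapunov function on the Fourier side\<close>

text \<open>From here on C^m is a real Euclidean space: the positivity conditions become statements
  about real quadratic forms, for which compactness of the sphere and orthogonal decomposition are
  available.\<close>

lemma cinner_inner: "Re (cinner x y) = x \<bullet> y"
  by (simp add: cinner_def inner_vec_def inner_complex_def)

abbreviation mop :: "real ^ 'm ^ 'm \<Rightarrow> complex ^ 'm \<Rightarrow> complex ^ 'm" where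
  "mop X z \<equiv> cmat X *v z"

lemma mop_nth: "mop X z $ i = (\<Sum>j\<in>UNIV. complex_of_real (X $ i $ j) * z $ j)"
  by (simp add: matrix_vector_mult_def map_matrix_def)

lemma inner_mop_transpose: "mop X z \<bullet> w = z \<bullet> mop (transpose X) w"
proof -
  have "mop X z \<bullet> w = (\<Sum>i\<in>UNIV. \<Sum>j\<in>UNIV. X $ i $ j * (z $ j \<bullet> w $ i))"
    unfolding inner_vec_def mop_nth inner_sum_left
    by (intro sum.cong refl) (simp add: inner_complex_def algebra_simps)
  also have "\<dots> = (\<Sum>j\<in>UNIV. \<Sum>i\<in>UNIV. X $ i $ j * (z $ j \<bullet> w $ i))" by (rule sum.swap)
  also have "\<dots> = z \<bullet> mop (transpose X) w"
    unfolding inner_vec_def mop_nth inner_sum_right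
    by (intro sum.cong refl) (simp add: inner_complex_def transpose_def algebra_simps)
  finally show ?thesis .
qed

lemma mop_mult: "mop (X ** Y) z = mop X (mop Y z)"
  unfolding vec_eq_iff
proof
  fix i
  have "mop (X ** Y) z $ i = (\<Sum>j\<in>UNIV. \<Sum>k\<in>UNIV. complex_of_real (X $ i $ k) * (complex_of_real (Y $ k $ j) * z $ j))"
    by (simp add: mop_nth matrix_matrix_mult_def sum_distrib_right mult.assoc)
  also have "\<dots> = (\<Sum>k\<in>UNIV. \<Sum>j\<in>UNIV. complex_of_real (X $ i $ k) * (complex_of_real (Y $ k $ j) * z $ j))"
    by (rule sum.swap)
  also have "\<dots> = mop X (mop Y z) $ i"
    by (simp add: mop_nth sum_distrib_left)
  finally show "mop (X ** Y) z $ i = mop X (mop Y z) $ i" .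
qed

lemma mop_add_left: "mop (X + Y) z = mop X z + mop Y z"
  by (simp add: vec_eq_iff mop_nth sum.distrib distrib_right)

lemma mop_uminus_left: "mop (- X) z = - mop X z"
  by (simp add: vec_eq_iff mop_nth sum_negf)

lemma mop_scaleR_left: "mop (c *\<^sub>R X) z = c *\<^sub>R mop X z"
  by (simp add: vec_eq_iff mop_nth scaleR_sum_right scaleR_conv_of_real[where 'a=complex] mult.assoc sum_distrib_left)

lemma mop_zero_left [simp]: "mop 0 z = 0"
  by (simp add: vec_eq_iff mop_nth)

lemma mop_add: "mop X (z + w) = mop X z + mop X w"
  by (simp add: vec_eq_iff mop_nth sum.distrib distrib_left)

lemma mop_scaleR: "mop X (c *\<^sub>R z) = c *\<^sub>R mop X z"
  by (simp add: vec_eq_iff mop_nth scaleR_sum_right)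

lemma linear_mop: "linear (mop X)"
  by (rule linearI) (auto simp: mop_add mop_scaleR)

lemma mop_uminus: "mop X (- z) = - mop X z"
  by (simp add: vec_eq_iff mop_nth sum_negf)

lemma mop_ii: "mop X (c *s z) = c *s mop X z"
  by (simp add: vec_eq_iff mop_nth sum_distrib_left algebra_simps)

lemma continuous_on_mop:
  assumes "continuous_on S f" "continuous_on S g"
  shows "continuous_on S (\<lambda>p. mop (f p) (g p))"
proof -
  have "(\<lambda>p. mop (f p) (g p)) = (\<lambda>p. \<chi> i. \<Sum>j\<in>UNIV. complex_of_real (f p $ i $ j) * g p $ j)"
    by (simp add: fun_eq_iff vec_eq_iff mop_nth)
  then show ?thesis
    by (simp only:) (intro continuous_intros continuous_on_vec_lambda assms)
qed

lemma continuous_on_ii: "continuous_on S f \<Longrightarrow> continuous_on S (\<lambda>p. \<i> *s f p :: complex ^ 'm)"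
  unfolding vector_scalar_mult_def by (intro continuous_intros)

lemma ii_inner: "(\<i> *s z) \<bullet> w = - (z \<bullet> (\<i> *s w))" for z w :: "complex ^ 'm"
  by (simp add: inner_vec_def inner_complex_def sum_negf[symmetric])

lemma norm_ii: "norm (\<i> *s z) = norm z" for z :: "complex ^ 'm"
  by (simp add: norm_vec_def L2_set_def norm_mult)

lemma ii_ii: "\<i> *s (\<i> *s z) = - z" for z :: "complex ^ 'm"
  by (simp add: vec_eq_iff mult.assoc[symmetric])

lemma linear_ii: "linear (\<lambda>z :: complex ^ 'm. \<i> *s z)"
  by (rule linearI) (auto simp: vec_eq_iff distrib_left)

text \<open>Multiplication by i is skew for the real inner product and commutes with the symmetric
  real matrix, so the composition is skew. It is the reason why the transport term drops out of the
  basic energy identity.\<close>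

lemma ii_symmetric_zero:
  assumes "transpose X = X" shows "(\<i> *s mop X z) \<bullet> z = 0"
proof -
  have "(\<i> *s mop X z) \<bullet> z = - (mop X z \<bullet> (\<i> *s z))" by (rule ii_inner)
  also have "mop X z \<bullet> (\<i> *s z) = z \<bullet> mop X (\<i> *s z)" by (simp add: inner_mop_transpose assms)
  also have "\<dots> = (\<i> *s mop X z) \<bullet> z" by (simp add: mop_ii inner_commute)
  finally show ?thesis by simp
qed

lemma sym_part_inner: "mop (sym_part X) z \<bullet> z = mop X z \<bullet> z"
  using inner_mop_transpose[of X z z]
  by (simp add: sym_part_def mop_scaleR_left mop_add_left inner_add_left) (simp add: inner_commute)

lemma transpose_sym_part: "transpose (sym_part X) = sym_part X"
  by (simp add: sym_part_def transpose_def vec_eq_iff add.commute)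

lemma sym_skew: "X = sym_part X + skew_part X"
proof -
  have "sym_part X + skew_part X = (1/2) *\<^sub>R (X + X)"
    unfolding sym_part_def skew_part_def scaleR_add_right[symmetric] by simp
  then show ?thesis by (simp add: scaleR_2[symmetric])
qed

section \<open>Compactness arguments for quadratic forms\<close>

text \<open>If every penalty factor failed, the points of failure would accumulate at some
  \<open>l\<close>. There F is at most 0, while boundedness of F along the sequence forces
  \<open>q l = 0\<close>, against the hypothesis. With \<open>q\<close> = 0 the lemma is the
  attainment of a positive minimum.\<close>

lemma compact_penalty:
  fixes F q :: "'a::metric_space \<Rightarrow> real"
  assumes S: "compact S" and F: "continuous_on S F" and q: "continuous_on S q"
    and q0: "\<And>p. p \<in> S \<Longrightarrow> q p \<ge> 0" and pos: "\<And>p. p \<in> S \<Longrightarrow> q p = 0 \<Longrightarrow> F p > 0"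
  obtains N c where "N \<ge> 0" "c > 0" "\<And>p. p \<in> S \<Longrightarrow> F p + N * q p \<ge> c"
proof -
  \<comment> \<open>A single index serves for the large factor \<open>N\<close> and the small
    constant \<open>c\<close> at once.\<close>
  have "\<exists>k::nat. \<forall>p\<in>S. F p + real k * q p \<ge> 1 / real (Suc k)"
  proof (rule ccontr)
    assume "\<not> ?thesis"
    then have "\<forall>k::nat. \<exists>p\<in>S. F p + real k * q p < 1 / real (Suc k)" by (auto simp: not_le)
    then obtain p where p: "\<And>k. p k \<in> S" "\<And>k. F (p k) + real k * q (p k) < 1 / real (Suc k)" by metis
    obtain l r where l: "l \<in> S" and r: "strict_mono r" and lim: "(p \<circ> r) \<longlonglongrightarrow> l"
      using S p(1) unfolding compact_def by metis
    have Fl: "(\<lambda>k. F (p (r k))) \<longlonglongrightarrow> F l" and ql: "(\<lambda>k. q (p (r k))) \<longlonglongrightarrow> q l"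
      using continuous_on_tendsto_compose[OF F lim l] continuous_on_tendsto_compose[OF q lim l] p(1)
      by (auto simp: comp_def)
    have inv: "(\<lambda>k. 1 / real (Suc (r k))) \<longlonglongrightarrow> 0"
      using LIMSEQ_subseq_LIMSEQ[OF LIMSEQ_Suc[OF lim_const_over_n[of 1]] r] by (simp add: comp_def)
    have "F l \<le> 0"
    proof (rule tendsto_le[OF _ inv Fl])
      have "F (p (r k)) \<le> 1 / real (Suc (r k))" for k
        using p(2)[of "r k"] mult_nonneg_nonneg[OF of_nat_0_le_iff[of "r k"] q0[OF p(1)[of "r k"]]] by linarith
      then show "\<forall>\<^sub>F k in sequentially. F (p (r k)) \<le> 1 / real (Suc (r k))" by simp
    qed simp
    moreover have "q l = 0"
    proof (rule ccontr)
      assume "q l \<noteq> 0"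
      then have ql0: "q l > 0" using q0[OF l] by simp
      have "filterlim (\<lambda>k. q (p (r k)) * real (r k)) at_top sequentially"
        by (rule filterlim_tendsto_pos_mult_at_top[OF ql ql0 filterlim_compose[OF filterlim_real_sequentially filterlim_subseq[OF r]]])
      then have "filterlim (\<lambda>k. F (p (r k)) + q (p (r k)) * real (r k)) at_top sequentially"
        by (rule filterlim_tendsto_add_at_top[OF Fl])
      then have "\<forall>\<^sub>F k in sequentially. F (p (r k)) + q (p (r k)) * real (r k) \<ge> 1"
        by (simp add: filterlim_at_top)
      then obtain k where "F (p (r k)) + q (p (r k)) * real (r k) \<ge> 1"
        by (auto simp: eventually_sequentially)
      moreover have "1 / real (Suc (r k)) \<le> 1" by simp
      ultimately show False using p(2)[of "r k"] by (simp add: mult.commute)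
    qed
    ultimately show False using pos[OF l] by simp
  qed
  then obtain k :: nat where "\<forall>p\<in>S. F p + real k * q p \<ge> 1 / real (Suc k)" by blast
  then show ?thesis by (intro that[of "real k" "1 / real (Suc k)"]) auto
qed

text \<open>A nonnegative symmetric form vanishes only on the kernel of \<open>M\<close>, so it is
  definite on the orthogonal complement and dominates the squared norm there; the kernel component
  is invisible to both sides. Applied to the matrix of condition (S) and \<open>T\<close> =
  \<open>L\<close>, it converts the equality of kernels into a quantitative bound.\<close>

lemma nonneg_form_kernel_bound:
  fixes M T :: "'a::euclidean_space \<Rightarrow> 'a"
  assumes M: "linear M" and sym: "\<And>x y. M x \<bullet> y = x \<bullet> M y" and nonneg: "\<And>x. M x \<bullet> x \<ge> 0"
    and T: "linear T" and ker: "\<And>x. M x = 0 \<Longrightarrow> T x = 0"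
  obtains C where "C > 0" "\<And>x. (norm (T x))\<^sup>2 \<le> C * (M x \<bullet> x)"
proof -
  \<comment> \<open>Moving from \<open>x\<close> along \<open>M x\<close> changes the form to first
    order by 2 t |M x|^2, which would make it negative for small negative \<open>t\<close>.\<close>
  have zero: "M x = 0" if "M x \<bullet> x = 0" for x
  proof -
    let ?y = "M x"
    have quad: "0 \<le> 2 * t * (?y \<bullet> ?y) + t\<^sup>2 * (M ?y \<bullet> ?y)" for t
    proof -
      have "0 \<le> M (x + t *\<^sub>R ?y) \<bullet> (x + t *\<^sub>R ?y)" by (rule nonneg)
      also have "\<dots> = M x \<bullet> x + t * (M x \<bullet> ?y) + t * (M ?y \<bullet> x) + t * t * (M ?y \<bullet> ?y)"
        by (simp add: linear_add[OF M] linear_scale[OF M] inner_add_left inner_add_right algebra_simps)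
      also have "M ?y \<bullet> x = ?y \<bullet> ?y" using sym[of ?y x] by simp
      finally show ?thesis using that by (simp add: power2_eq_square)
    qed
    show ?thesis
    proof (rule ccontr)
      assume "M x \<noteq> 0"
      then have a: "?y \<bullet> ?y > 0" by simp
      let ?b = "M ?y \<bullet> ?y"
      have b: "?b \<ge> 0" by (rule nonneg)
      \<comment> \<open>The minimiser of the quadratic polynomial in \<open>t\<close>, except for
        the 1 that allows \<open>?b\<close> to vanish.\<close>
      define t where "t = - (?y \<bullet> ?y) / (?b + 1)"
      have t0: "t < 0" using a b by (simp add: t_def)
      have "2 * (?y \<bullet> ?y) + t * ?b \<le> 0"
      proof (rule ccontr)
        assume "\<not> ?thesis"
        then have "t * (2 * (?y \<bullet> ?y) + t * ?b) < 0" using t0 by (intro mult_neg_pos) auto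
        then show False using quad[of t] by (simp add: power2_eq_square algebra_simps)
      qed
      moreover have "t * ?b \<ge> - (?y \<bullet> ?y)"
        using a b by (simp add: t_def field_simps)
      ultimately show False using a by simp
    qed
  qed
  let ?K = "{x. M x = 0}"
  have K: "subspace ?K" by (simp add: subspace_def linear_0[OF M] linear_add[OF M] linear_scale[OF M])
  let ?U = "{x. norm x = 1 \<and> (\<forall>y\<in>?K. x \<bullet> y = 0)}"
  have U: "compact ?U"
  proof -
    have eq: "?U = sphere 0 1 \<inter> (\<Inter>y\<in>?K. {x. x \<bullet> y = 0})" by (auto simp: dist_norm)
    have "closed (\<Inter>y\<in>?K. {x. x \<bullet> y = 0})"
      by (intro closed_INT ballI closed_Collect_eq continuous_intros)
    then show ?thesis unfolding eq by (intro compact_Int_closed compact_sphere)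
  qed
  have Mc: "continuous_on ?U (\<lambda>x. M x \<bullet> x)"
    by (intro continuous_intros linear_continuous_on M[unfolded linear_conv_bounded_linear])
  obtain c where c: "c > 0" "\<And>x. x \<in> ?U \<Longrightarrow> M x \<bullet> x \<ge> c"
  proof (rule compact_penalty[OF U Mc continuous_on_const[of _ 0]])
    fix x assume x: "x \<in> ?U"
    have "M x \<bullet> x \<noteq> 0"
    proof
      assume "M x \<bullet> x = 0"
      then have "x \<in> ?K" using zero by simp
      then have "x \<bullet> x = 0" using x by blast
      then show False using x by simp
    qed
    then show "M x \<bullet> x > 0" using nonneg[of x] by simp
  qed auto
  obtain B where B: "B > 0" "\<And>x. norm (T x) \<le> B * norm x"
    using linear_bounded_pos[OF T] by blast
  show ?thesis
  proof
    show "B\<^sup>2 / c > 0" using B c by simp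
    fix x
    obtain y z where y: "y \<in> span ?K" and z: "\<And>w. w \<in> span ?K \<Longrightarrow> orthogonal z w" and x: "x = y + z"
      using orthogonal_subspace_decomp_exists[of ?K x] by blast
    have y0: "M y = 0" using y K by (simp add: span_eq_iff[THEN iffD2])
    have Tx: "T x = T z" using ker[OF y0] x by (simp add: linear_add[OF T])
    have Mx: "M x \<bullet> x = M z \<bullet> z"
      using y0 sym[of z y] x by (simp add: linear_add[OF M] inner_add_right)
    have zq: "c * (norm z)\<^sup>2 \<le> M z \<bullet> z"
    proof (cases "z = 0")
      case False
      have "z /\<^sub>R norm z \<in> ?U"
        using False z by (auto simp: orthogonal_def span_base)
      from c(2)[OF this] have "c \<le> (M z \<bullet> z) / (norm z)\<^sup>2"
        by (simp add: linear_scale[OF M] power2_eq_square field_simps)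
      then show ?thesis using False by (simp add: field_simps)
    qed (simp add: linear_0[OF M])
    have "(norm (T x))\<^sup>2 \<le> (B * norm z)\<^sup>2" unfolding Tx by (intro power_mono B) simp
    also have "\<dots> = B\<^sup>2 / c * (c * (norm z)\<^sup>2)" using c by (simp add: power_mult_distrib)
    also have "\<dots> \<le> B\<^sup>2 / c * (M z \<bullet> z)" using zq c B by (intro mult_left_mono) auto
    finally show "(norm (T x))\<^sup>2 \<le> B\<^sup>2 / c * (M x \<bullet> x)" unfolding Mx .
  qed
qed

lemma transpose_symbol: "(\<And>j. transpose (A j) = A j) \<Longrightarrow> transpose (symbol A \<omega>) = symbol A \<omega>"
  by (simp add: symbol_def transpose_def vec_eq_iff)

lemma continuous_on_symbol: "continuous_on S (symbol A)"
  unfolding symbol_def[abs_def] by (intro continuous_intros continuous_on_component)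

lemma ii_matrix_mult: "map_matrix (\<lambda>a. \<i> * a) (cmat X) *v z = \<i> *s mop X z"
  by (simp add: vec_eq_iff matrix_vector_mult_def map_matrix_def sum_distrib_left mult.assoc)

lemma mop_measurable:
  assumes "f \<in> borel_measurable N" "g \<in> borel_measurable N"
  shows "(\<lambda>x. mop (f x) (g x)) \<in> borel_measurable N"
  by (rule borel_measurable_continuous_Pair[OF assms])
    (intro continuous_on_mop continuous_intros)

lemma uniform_mop_bound:
  fixes f :: "'a::metric_space \<Rightarrow> real ^ 'm ^ 'm"
  assumes S: "compact S" and f: "continuous_on S f"
  obtains k where "k > 0" "\<And>p z. p \<in> S \<Longrightarrow> norm (mop (f p) z) \<le> k * norm z"
proof -
  let ?P = "S \<times> sphere (0 :: complex ^ 'm) 1"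
  have "continuous_on ?P (\<lambda>p. mop (f (fst p)) (snd p))"
    by (intro continuous_on_mop continuous_on_compose2[OF f] continuous_intros) auto
  then have "bounded ((\<lambda>p. mop (f (fst p)) (snd p)) ` ?P)"
    by (intro compact_imp_bounded compact_continuous_image compact_Times S compact_sphere)
  then obtain k where k: "k > 0" "\<And>p. p \<in> ?P \<Longrightarrow> norm (mop (f (fst p)) (snd p)) \<le> k"
    unfolding bounded_pos by blast
  have "norm (mop (f p) z) \<le> k * norm z" if p: "p \<in> S" for p z
  proof (cases "z = 0")
    case False
    then have "(p, z /\<^sub>R norm z) \<in> ?P" using p by simp
    from k(2)[OF this] have "norm (mop (f p) z) / norm z \<le> k" by (simp add: mop_scaleR divide_inverse mult.commute)
    then show ?thesis using False by (simp add: field_simps)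
  qed simp
  with k(1) show ?thesis by (rule that)
qed

text \<open>Gronwall's argument with the integrating factor exp (k t). The derivative is asked for
  in the interior only, as a weak solution satisfies its equation for t > 0.\<close>

lemma exp_decay:
  fixes e :: "real \<Rightarrow> real"
  assumes T: "0 \<le> T" and cont: "continuous_on {0..T} e"
    and D: "\<And>t. 0 < t \<Longrightarrow> t < T \<Longrightarrow> \<exists>d. (e has_real_derivative d) (at t) \<and> d \<le> - k * e t"
  shows "e T \<le> exp (- k * T) * e 0"
proof (cases "T = 0")
  case False
  have "exp (k * T) * e T \<le> exp (k * 0) * e 0"
  proof (rule DERIV_nonpos_imp_decreasing_open[of 0 T "\<lambda>t. exp (k * t) * e t"])
    fix t assume t: "0 < t" "t < T"
    obtain d where d: "(e has_real_derivative d) (at t)" "d \<le> - k * e t" using D[OF t] by blast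
    have "((\<lambda>t. exp (k * t) * e t) has_real_derivative exp (k * t) * k * e t + d * exp (k * t)) (at t)"
      by (auto intro!: derivative_eq_intros d(1))
    moreover have "exp (k * t) * k * e t + d * exp (k * t) = exp (k * t) * (k * e t + d)" by (simp add: algebra_simps)
    moreover have "exp (k * t) * (k * e t + d) \<le> 0" using d(2) by (intro mult_nonneg_nonpos) auto
    ultimately show "\<exists>y. ((\<lambda>t. exp (k * t) * e t) has_real_derivative y) (at t) \<and> y \<le> 0" by auto
  qed (use T in \<open>auto intro!: continuous_intros cont\<close>)
  then have "exp (- k * T) * (exp (k * T) * e T) \<le> exp (- k * T) * e 0"
    by (intro mult_left_mono) auto
  then show ?thesis by (simp add: mult.assoc[symmetric] exp_add[symmetric])
qed simp

text \<open>The three dissipation mechanisms combine: the symmetrizer term controls the component of \<open>z\<close>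
  off the kernel of \<open>L\<close> through \<open>Y\<close>, the compensating term controls the rest through \<open>k\<close>.\<close>

lemma dissipation_estimate:
  fixes X Y k l n T D r N c1 C2 k1 \<alpha> \<beta> :: real
  assumes X: "X \<ge> 0" and Y: "Y \<ge> 0" and D: "D \<ge> 0" and r: "r \<ge> 0" and l: "l \<ge> 0" and n: "n \<ge> 0"
    and K: "k + N * Y \<ge> c1 * n\<^sup>2" and lC: "l\<^sup>2 \<le> C2 * Y" and T: "T \<le> k1 * l * n"
    and c1: "c1 > 0" and N: "N \<ge> 0" and \<alpha>: "\<alpha> > 0" and \<beta>: "\<beta> > 0" "\<beta> \<le> 1"
    and small: "\<alpha> * (N + k1\<^sup>2 * C2 / (2 * c1)) \<le> \<beta>"
  shows "- X - \<beta> * (r * D) - \<beta> * (Y - X) - \<alpha> * (r\<^sup>2 / (1 + r\<^sup>2)) * k + \<alpha> * r / (1 + r\<^sup>2) * T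
    \<le> - (\<alpha> * c1 / 2) * (r\<^sup>2 / (1 + r\<^sup>2)) * n\<^sup>2"
proof -
  \<comment> \<open>Intended values: \<open>X\<close> and \<open>Y\<close> are the forms of
    \<open>L\<close> and of the matrix of condition (S) at z, \<open>k\<close> is the form of K A,
    \<open>D\<close> the term signed by condition (S)_2, \<open>T\<close> the mixed term of K and L,
    and \<open>l\<close>, \<open>n\<close>, \<open>r\<close> are |Lz|, |z|, |xi|.\<close>
  define \<rho> where "\<rho> = r\<^sup>2 / (1 + r\<^sup>2)"
  have pos: "1 + r\<^sup>2 > 0" by (simp add: add_pos_nonneg)
  have \<rho>: "0 \<le> \<rho>" "\<rho> \<le> 1" using pos by (auto simp: \<rho>_def divide_le_eq_1)
  \<comment> \<open>The S term yields \<open>Y\<close> - \<open>X\<close> instead of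
    \<open>Y\<close>; the excess is paid by the basic dissipation, which requires \<beta> <=
    1.\<close>
  have 1: "- X + \<beta> * X \<le> 0" using mult_right_mono[OF \<beta>(2) X] by simp
  have 2: "\<beta> * (r * D) \<ge> 0" using \<beta> r D by simp
  have 3: "\<alpha> * \<rho> * k \<ge> \<alpha> * \<rho> * (c1 * n\<^sup>2) - \<alpha> * N * Y"
  proof -
    have "\<alpha> * \<rho> * (c1 * n\<^sup>2 - N * Y) \<le> \<alpha> * \<rho> * k" using K \<alpha> \<rho> by (intro mult_left_mono) auto
    moreover have "\<alpha> * \<rho> * (N * Y) \<le> \<alpha> * 1 * (N * Y)"
      using \<alpha> \<rho> N Y by (intro mult_right_mono mult_left_mono) auto
    ultimately show ?thesis by (simp add: algebra_simps)
  qed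
  \<comment> \<open>Young's inequality, with the square chosen so that half of the gain
    \<open>c1\<close> is spent. The factor 1 / (1 + r^2) left on the \<open>Y\<close> part is
    estimated by 1.\<close>
  have 4: "\<alpha> * r / (1 + r\<^sup>2) * T \<le> \<alpha> * \<rho> * (c1 / 2 * n\<^sup>2) + \<alpha> * (k1\<^sup>2 * C2 / (2 * c1)) * Y"
  proof -
    have "0 \<le> (c1 * r * n - k1 * l)\<^sup>2 / (2 * c1)" using c1 by simp
    also have "\<dots> = c1 / 2 * (r\<^sup>2 * n\<^sup>2) + k1\<^sup>2 * l\<^sup>2 / (2 * c1) - r * (k1 * l * n)"
      using c1 by (simp add: power2_eq_square field_simps)
    finally have a: "r * (k1 * l * n) \<le> c1 / 2 * (r\<^sup>2 * n\<^sup>2) + k1\<^sup>2 * l\<^sup>2 / (2 * c1)" by simp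
    have "r * T \<le> r * (k1 * l * n)" using T r by (intro mult_left_mono)
    also note a
    also have "k1\<^sup>2 * l\<^sup>2 / (2 * c1) \<le> k1\<^sup>2 * (C2 * Y) / (2 * c1)"
      using lC c1 by (intro divide_right_mono mult_left_mono) auto
    finally have b: "r * T \<le> c1 / 2 * (r\<^sup>2 * n\<^sup>2) + k1\<^sup>2 * C2 / (2 * c1) * Y" by simp
    have "\<alpha> * r / (1 + r\<^sup>2) * T = \<alpha> * ((r * T) / (1 + r\<^sup>2))" by simp
    also have "\<dots> \<le> \<alpha> * ((c1 / 2 * (r\<^sup>2 * n\<^sup>2) + k1\<^sup>2 * C2 / (2 * c1) * Y) / (1 + r\<^sup>2))"
      using b \<alpha> pos by (intro mult_left_mono divide_right_mono) auto
    also have "\<dots> = \<alpha> * \<rho> * (c1 / 2 * n\<^sup>2) + \<alpha> * ((k1\<^sup>2 * C2 / (2 * c1) * Y) / (1 + r\<^sup>2))"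
      by (simp add: \<rho>_def add_divide_distrib algebra_simps)
    also have "(k1\<^sup>2 * C2 / (2 * c1) * Y) / (1 + r\<^sup>2) \<le> k1\<^sup>2 * C2 / (2 * c1) * Y / 1"
    proof (rule divide_left_mono)
      have "0 \<le> C2 * Y" using lC zero_le_power2[of l] by linarith
      then have "0 \<le> k1\<^sup>2 * (C2 * Y) / (2 * c1)" using c1 by simp
      then show "0 \<le> k1\<^sup>2 * C2 / (2 * c1) * Y" by (simp add: mult.assoc)
    qed (use pos in auto)
    finally show ?thesis using \<alpha> by (simp add: mult.assoc)
  qed
  have 5: "\<alpha> * N * Y + \<alpha> * (k1\<^sup>2 * C2 / (2 * c1)) * Y \<le> \<beta> * Y"
    using mult_right_mono[OF small Y] by (simp add: algebra_simps)
  have "\<alpha> * \<rho> * (c1 * n\<^sup>2) = 2 * (\<alpha> * \<rho> * (c1 / 2 * n\<^sup>2))" by simp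
  moreover have "(\<alpha> * c1 / 2) * \<rho> * n\<^sup>2 = \<alpha> * \<rho> * (c1 / 2 * n\<^sup>2)" by simp
  ultimately show ?thesis
    unfolding \<rho>_def[symmetric] using 1 2 3 4 5 by (simp add: algebra_simps) 
qed

section \<open>Construction of the Lyapunov form\<close>

text \<open>The dissipation is stated algebraically, for any \<open>z\<close> and \<open>w\<close>
  linked by the equation with \<open>w\<close> in the place of the time derivative. Thus one form
  serves both genuine solutions at a frequency and weak solutions; the measurability clause is for
  the latter, where the form is integrated over frequencies.\<close>

lemma Lyapunov:
  fixes A0 L S :: "real ^ 'm ^ 'm" and A :: "'n::finite \<Rightarrow> real ^ 'm ^ 'm"
  assumes cA: "condition_A A0 A L" and cS: "condition_S A0 L S"
    and cS2: "condition_S2 A S" and cK: "condition_K A0 A L"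
  obtains H :: "real ^ 'n \<Rightarrow> complex ^ 'm \<Rightarrow> complex ^ 'm" and a b c where
    "a > 0" "b > 0" "c > 0" "\<And>\<xi>. linear (H \<xi>)" "\<And>\<xi> z w. H \<xi> z \<bullet> w = z \<bullet> H \<xi> w"
    "\<And>\<xi> z. a * (norm z)\<^sup>2 \<le> H \<xi> z \<bullet> z" "\<And>\<xi> z. norm (H \<xi> z) \<le> b * norm z"
    "\<And>\<xi> z w. mop A0 w + (\<i> * complex_of_real (norm \<xi>)) *s mop (symbol A (sgn \<xi>)) z + mop L z = 0 \<Longrightarrow>
      H \<xi> z \<bullet> w \<le> - c * rho \<xi> * (H \<xi> z \<bullet> z)"
    "\<And>V. V \<in> borel_measurable borel \<Longrightarrow> (\<lambda>\<xi>. H \<xi> (V \<xi>)) \<in> borel_measurable borel"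
proof -
  have A0T: "transpose A0 = A0" and AT: "\<And>j. transpose (A j) = A j"
    and A0pos: "\<And>z. z \<noteq> 0 \<Longrightarrow> mop A0 z \<bullet> z > 0" and Lnn: "\<And>z. mop L z \<bullet> z \<ge> 0"
    using cA by (auto simp: condition_A_def pos_on_def nonneg_on_def cinner_inner)
  note symT = transpose_symbol[of A, OF AT]
  define M where "M = sym_part (S ** L) + sym_part L"
  have SA0T: "transpose (S ** A0) = S ** A0" and Mnn: "\<And>z. mop M z \<bullet> z \<ge> 0" and Mker: "\<And>z. mop M z = 0 \<Longrightarrow> mop L z = 0"
    using cS by (auto simp: condition_S_def nonneg_on_def cinner_inner M_def Ker_def)
  have Mform: "mop M z \<bullet> z = mop S (mop L z) \<bullet> z + mop L z \<bullet> z" for z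
    by (simp add: M_def mop_add_left inner_add_left sym_part_inner mop_mult)
  have Msym: "mop M z \<bullet> w = z \<bullet> mop M w" for z w
  proof -
    have "transpose M = transpose (sym_part (S ** L)) + transpose (sym_part L)"
      by (simp add: M_def transpose_def vec_eq_iff)
    then have "transpose M = M" unfolding transpose_sym_part M_def .
    then show ?thesis by (simp add: inner_mop_transpose)
  qed
  obtain C2 where C2: "C2 > 0" "\<And>z. (norm (mop L z))\<^sup>2 \<le> C2 * (mop M z \<bullet> z)"
    using nonneg_form_kernel_bound[OF linear_mop Msym Mnn linear_mop Mker] by blast
  \<comment> \<open>Condition (S)_2 speaks of the skew part of S A only, but i times the symmetric
    part contributes nothing to the real form.\<close>
  have Dnn: "(\<i> *s mop S (mop (symbol A \<omega>) z)) \<bullet> z \<ge> 0" if \<omega>: "\<omega> \<in> sphere 0 1" for \<omega> z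
  proof -
    let ?X = "S ** symbol A \<omega>"
    have "mop ?X z = mop (sym_part ?X) z + mop (skew_part ?X) z"
      using arg_cong[OF sym_skew[of ?X], of "\<lambda>X. mop X z"] by (simp only: mop_add_left)
    then have "(\<i> *s mop ?X z) \<bullet> z = (\<i> *s mop (sym_part ?X) z) \<bullet> z + (\<i> *s mop (skew_part ?X) z) \<bullet> z"
      by (simp only: linear_add[OF linear_ii] inner_add_left)
    moreover have "(\<i> *s mop (sym_part ?X) z) \<bullet> z = 0" by (rule ii_symmetric_zero[OF transpose_sym_part])
    moreover have "(\<i> *s mop (skew_part ?X) z) \<bullet> z \<ge> 0"
      using cS2 \<omega> by (simp add: condition_S2_def nonneg_on_def cinner_inner ii_matrix_mult)
    ultimately show ?thesis by (simp add: mop_mult)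
  qed
  obtain K :: "real ^ 'n \<Rightarrow> real ^ 'm ^ 'm" where Ksm: "smooth_extendable (sphere 0 1) K"
    and KT: "\<And>\<omega>. \<omega> \<in> sphere 0 1 \<Longrightarrow> transpose (K \<omega> ** A0) = - (K \<omega> ** A0)"
    and Kpos: "\<And>\<omega> z. \<omega> \<in> sphere 0 1 \<Longrightarrow> mop L z = 0 \<Longrightarrow> z \<noteq> 0 \<Longrightarrow> mop (K \<omega>) (mop (symbol A \<omega>) z) \<bullet> z > 0"
    using cK by (auto simp: condition_K_def pos_on_def cinner_inner Ker_def sym_part_inner mop_mult)
  have Kcont: "continuous_on (sphere 0 1) K"
  proof -
    obtain U g where g: "sphere 0 1 \<subseteq> U" "smooth_on U g" "\<And>x. x \<in> sphere 0 1 \<Longrightarrow> g x = K x"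
      using Ksm by (auto simp: smooth_extendable_def)
    have "Ck_on 0 U g" using g(2) unfolding smooth_on_def by blast
    then have "continuous_on (sphere 0 1) g" using continuous_on_subset[OF _ g(1)] by simp
    then show ?thesis by (rule continuous_on_eq) (rule g(3))
  qed
  \<comment> \<open>\<open>sgn 0\<close> is 0 and lies off the sphere, where \<open>K\<close> is
    arbitrary. The value 0 is imposed there to keep measurability and the bounds; the weight
    \<open>\<delta>\<close> vanishes at this frequency anyway.\<close>
  define Kt where "Kt \<xi> = indicat_real (- {0}) \<xi> *\<^sub>R K (sgn \<xi>)" for \<xi> :: "real ^ 'n"
  have sgn1: "sgn \<xi> \<in> sphere 0 1" if "\<xi> \<noteq> 0" for \<xi> :: "real ^ 'n" using that by (simp add: norm_sgn)
  have Kt_measurable: "Kt \<in> borel_measurable borel"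
    unfolding Kt_def
  proof (rule borel_measurable_continuous_on_indicator)
    show "continuous_on (- {0}) (\<lambda>\<xi>. K (sgn \<xi>))"
      by (rule continuous_on_compose2[OF Kcont continuous_on_sgn[OF continuous_on_id]]) (auto simp: norm_sgn split: if_splits)
  qed simp
  obtain s0 where s0: "s0 > 0" "\<And>z. norm (mop (S ** A0) z) \<le> s0 * norm z" using linear_bounded_pos[OF linear_mop] by blast
  obtain e0 where e0: "e0 > 0" "\<And>z. norm (mop A0 z) \<le> e0 * norm z" using linear_bounded_pos[OF linear_mop] by blast
  obtain k1 where k1: "k1 > 0" "\<And>\<omega> z. \<omega> \<in> sphere 0 1 \<Longrightarrow> norm (mop (K \<omega>) z) \<le> k1 * norm z"
    using uniform_mop_bound[OF compact_sphere Kcont] by blast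
  have Kt0: "norm (mop (Kt \<xi> ** A0) z) \<le> k1 * e0 * norm z" for \<xi> z
  proof (cases "\<xi> = 0")
    case True
    then show ?thesis using k1(1) e0(1) by (simp add: Kt_def mop_mult)
  next
    case False
    have "norm (mop (K (sgn \<xi>)) (mop A0 z)) \<le> k1 * (e0 * norm z)"
      using k1(2)[OF sgn1[OF False], of "mop A0 z"] mult_left_mono[OF e0(2)[of z] less_imp_le[OF k1(1)]] by linarith
    then show ?thesis using False by (simp add: Kt_def mop_mult)
  qed
  have KtT: "transpose (Kt \<xi> ** A0) = - (Kt \<xi> ** A0)" for \<xi>
  proof (cases "\<xi> = 0")
    case False
    then show ?thesis using KT[OF sgn1[OF False]] by (simp add: Kt_def)
  qed (simp add: Kt_def transpose_def vec_eq_iff)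
  obtain a0 where a0: "a0 > 0" "\<And>z. z \<in> sphere 0 1 \<Longrightarrow> mop A0 z \<bullet> z \<ge> a0"
  proof (rule compact_penalty[of "sphere (0 :: complex ^ 'm) 1" "\<lambda>z. mop A0 z \<bullet> z" "\<lambda>_. 0"])
    show "continuous_on (sphere 0 1) (\<lambda>z. mop A0 z \<bullet> z)" by (intro continuous_intros continuous_on_mop)
    show "mop A0 z \<bullet> z > 0" if "z \<in> sphere 0 1" for z using that by (intro A0pos) auto
  qed auto
  have A0lower: "a0 * (norm z)\<^sup>2 \<le> mop A0 z \<bullet> z" for z
  proof (cases "z = 0")
    case False
    then have "z /\<^sub>R norm z \<in> sphere 0 1" by simp
    from a0(2)[OF this] have "a0 \<le> (mop A0 z \<bullet> z) / (norm z)\<^sup>2"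
      by (simp add: mop_scaleR power2_eq_square field_simps)
    then show ?thesis using False by (simp add: field_simps)
  qed simp
  \<comment> \<open>The form of K A is positive on Ker L alone. Adding a large multiple of the form
    of \<open>M\<close>, whose zeros lie in Ker L, makes it positive on all unit vectors, uniformly
    in the direction.\<close>
  obtain N c1 where N: "N \<ge> 0" and c1: "c1 > 0"
    and pen: "\<And>p. p \<in> sphere (0 :: real ^ 'n) 1 \<times> sphere (0 :: complex ^ 'm) 1 \<Longrightarrow>
      mop (K (fst p)) (mop (symbol A (fst p)) (snd p)) \<bullet> snd p + N * (mop M (snd p) \<bullet> snd p) \<ge> c1"
  proof (rule compact_penalty[of "sphere (0 :: real ^ 'n) 1 \<times> sphere (0 :: complex ^ 'm) 1"
        "\<lambda>p. mop (K (fst p)) (mop (symbol A (fst p)) (snd p)) \<bullet> snd p" "\<lambda>p. mop M (snd p) \<bullet> snd p"])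
    let ?P = "sphere (0 :: real ^ 'n) 1 \<times> sphere (0 :: complex ^ 'm) 1"
    show "compact ?P" by (intro compact_Times compact_sphere)
    show "continuous_on ?P (\<lambda>p. mop (K (fst p)) (mop (symbol A (fst p)) (snd p)) \<bullet> snd p)"
      by (intro continuous_on_inner continuous_on_mop continuous_on_compose2[OF Kcont]
          continuous_on_compose2[OF continuous_on_symbol[of UNIV]] continuous_intros) auto
    show "continuous_on ?P (\<lambda>p. mop M (snd p) \<bullet> snd p)"
      by (intro continuous_on_inner continuous_on_mop continuous_intros)
    show "mop M (snd p) \<bullet> snd p \<ge> 0" for p :: "(real ^ 'n) \<times> (complex ^ 'm)" by (rule Mnn)
    fix p assume p: "p \<in> ?P" and q: "mop M (snd p) \<bullet> snd p = 0"
    have "(norm (mop L (snd p)))\<^sup>2 \<le> 0" using C2(2)[of "snd p"] q by simp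
    then have "mop L (snd p) = 0" by simp
    then show "mop (K (fst p)) (mop (symbol A (fst p)) (snd p)) \<bullet> snd p > 0"
      using p by (intro Kpos) auto
  qed blast
  have pen': "mop (K \<omega>) (mop (symbol A \<omega>) z) \<bullet> z + N * (mop M z \<bullet> z) \<ge> c1 * (norm z)\<^sup>2" if \<omega>: "\<omega> \<in> sphere 0 1" for \<omega> z
  proof (cases "z = 0")
    case False
    then have "(\<omega>, z /\<^sub>R norm z) \<in> sphere 0 1 \<times> sphere 0 1" using \<omega> by simp
    from pen[OF this] have "c1 \<le> (mop (K \<omega>) (mop (symbol A \<omega>) z) \<bullet> z + N * (mop M z \<bullet> z)) / (norm z)\<^sup>2"
      by (simp add: mop_scaleR power2_eq_square add_divide_distrib) (simp add: field_simps)
    then show ?thesis using False by (simp add: field_simps)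
  qed simp
  \<comment> \<open>The second bound keeps the S term below a quarter of the lower bound
    \<open>a0\<close> of A0.\<close>
  define \<beta> where "\<beta> = min 1 (a0 / (4 * s0))"
  have \<beta>: "\<beta> > 0" "\<beta> \<le> 1" "\<beta> * s0 \<le> a0 / 4"
    using a0(1) s0(1) by (auto simp: \<beta>_def min_def field_simps)
  define G where "G = N + k1\<^sup>2 * C2 / (2 * c1)"
  have G: "G \<ge> 0" using N C2(1) c1 by (simp add: G_def)
  \<comment> \<open>The first bound is the smallness required by
    \<open>dissipation_estimate\<close>. The second, together with \<delta> <= \<alpha>/2, keeps the
    K term below another quarter of \<open>a0\<close>, so that half of \<open>a0\<close>
    remains.\<close>
  define \<alpha> where "\<alpha> = min (\<beta> / (G + 1)) (a0 / (2 * (k1 * e0)))"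
  have ke: "k1 * e0 > 0" using k1(1) e0(1) by simp
  have \<alpha>: "\<alpha> > 0" using \<beta>(1) G a0(1) ke by (simp add: \<alpha>_def)
  have \<alpha>G: "\<alpha> * G \<le> \<beta>"
  proof -
    have "\<alpha> * (G + 1) \<le> \<beta> / (G + 1) * (G + 1)" using G by (intro mult_right_mono) (auto simp: \<alpha>_def)
    also have "\<dots> = \<beta>" using G by simp
    finally show ?thesis using \<alpha> by (simp add: algebra_simps)
  qed
  have \<alpha>k: "\<alpha> * (k1 * e0) \<le> a0 / 2"
  proof -
    have "\<alpha> * (k1 * e0) \<le> a0 / (2 * (k1 * e0)) * (k1 * e0)" using ke by (intro mult_right_mono) (auto simp: \<alpha>_def)
    also have "\<dots> = a0 / 2" using k1(1) e0(1) by simp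
    finally show ?thesis .
  qed
  define \<delta> where "\<delta> \<xi> = \<alpha> * norm \<xi> / (1 + (norm \<xi>)\<^sup>2)" for \<xi> :: "real ^ 'n"
  have \<delta>0: "0 \<le> \<delta> \<xi>" for \<xi> using \<alpha> by (simp add: \<delta>_def)
  have \<delta>1: "\<delta> \<xi> \<le> \<alpha> / 2" for \<xi>
  proof -
    have "2 * norm \<xi> \<le> 1 + (norm \<xi>)\<^sup>2" using sum_squares_bound[of 1 "norm \<xi>"] by simp
    then have "\<alpha> * (2 * norm \<xi>) \<le> \<alpha> * (1 + (norm \<xi>)\<^sup>2)" using \<alpha> by (intro mult_left_mono) auto
    moreover have "1 + (norm \<xi>)\<^sup>2 > 0" by (simp add: add_pos_nonneg)
    ultimately show ?thesis by (simp add: \<delta>_def field_simps)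
  qed
  define H where "H \<xi> z = mop A0 z + \<beta> *\<^sub>R mop (S ** A0) z - \<delta> \<xi> *\<^sub>R (\<i> *s mop (Kt \<xi> ** A0) z)" for \<xi> z
  have Hlin: "linear (H \<xi>)" for \<xi>
    unfolding H_def
    by (intro linear_compose_sub linear_compose_add linear_compose_scale_right linear_mop
        linear_compose[OF linear_mop linear_ii, unfolded comp_def])
  \<comment> \<open>The third summand is symmetric because K A0 and multiplication by i are both
    skew and commute.\<close>
  have Hsym: "H \<xi> z \<bullet> w = z \<bullet> H \<xi> w" for \<xi> z w
  proof -
    have "mop A0 z \<bullet> w = z \<bullet> mop A0 w" by (simp add: inner_mop_transpose A0T)
    moreover have "mop (S ** A0) z \<bullet> w = z \<bullet> mop (S ** A0) w" by (simp add: inner_mop_transpose SA0T)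
    moreover have "(\<i> *s mop (Kt \<xi> ** A0) z) \<bullet> w = z \<bullet> (\<i> *s mop (Kt \<xi> ** A0) w)"
      unfolding ii_inner inner_mop_transpose KtT by (simp add: mop_uminus_left mop_ii)
    ultimately show ?thesis unfolding H_def by (simp add: inner_diff_left inner_diff_right inner_add_left inner_add_right)
  qed
  have term2: "\<bar>\<beta> * (mop (S ** A0) z \<bullet> z)\<bar> \<le> a0 / 4 * (norm z)\<^sup>2" for z
  proof -
    have "\<bar>mop (S ** A0) z \<bullet> z\<bar> \<le> s0 * norm z * norm z"
      using Cauchy_Schwarz_ineq2[of "mop (S ** A0) z" z] mult_right_mono[OF s0(2)[of z] norm_ge_zero[of z]] by linarith
    then have "\<beta> * \<bar>mop (S ** A0) z \<bullet> z\<bar> \<le> \<beta> * (s0 * norm z * norm z)" using \<beta> by (intro mult_left_mono) auto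
    also have "\<dots> \<le> a0 / 4 * (norm z * norm z)"
      using mult_right_mono[OF \<beta>(3), of "norm z * norm z"] by (simp add: mult.assoc)
    finally show ?thesis using \<beta> by (simp add: abs_mult power2_eq_square)
  qed
  have term3: "\<bar>\<delta> \<xi> * ((\<i> *s mop (Kt \<xi> ** A0) z) \<bullet> z)\<bar> \<le> a0 / 4 * (norm z)\<^sup>2" for \<xi> z
  proof -
    have "\<bar>(\<i> *s mop (Kt \<xi> ** A0) z) \<bullet> z\<bar> \<le> k1 * e0 * norm z * norm z"
      using Cauchy_Schwarz_ineq2[of "\<i> *s mop (Kt \<xi> ** A0) z" z] mult_right_mono[OF Kt0[of \<xi> z] norm_ge_zero[of z]]
      unfolding norm_ii by linarith
    then have "\<delta> \<xi> * \<bar>(\<i> *s mop (Kt \<xi> ** A0) z) \<bullet> z\<bar> \<le> \<alpha> / 2 * (k1 * e0 * norm z * norm z)"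
      using \<delta>0 \<delta>1 \<alpha> by (intro mult_mono) auto
    also have "\<dots> = (\<alpha> * (k1 * e0)) * (norm z * norm z) / 2" by simp
    also have "\<dots> \<le> (a0 / 2) * (norm z * norm z) / 2"
      by (intro divide_right_mono mult_right_mono \<alpha>k) auto
    finally show ?thesis using \<delta>0[of \<xi>] by (simp add: abs_mult power2_eq_square)
  qed
  have Hform: "H \<xi> z \<bullet> z = mop A0 z \<bullet> z + \<beta> * (mop (S ** A0) z \<bullet> z) - \<delta> \<xi> * ((\<i> *s mop (Kt \<xi> ** A0) z) \<bullet> z)" for \<xi> z
    by (simp add: H_def inner_diff_left inner_add_left)
  have Hlow: "a0 / 2 * (norm z)\<^sup>2 \<le> H \<xi> z \<bullet> z" for \<xi> z
    using A0lower[of z] term2[of z] term3[of \<xi> z] unfolding Hform by (simp add: abs_le_iff)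
  define b where "b = e0 + \<beta> * s0 + \<alpha> * (k1 * e0)"
  have b: "b > 0" using e0 \<beta> s0 \<alpha> ke by (simp add: b_def add_pos_pos)
  have Hup: "norm (H \<xi> z) \<le> b * norm z" for \<xi> z
  proof -
    have "norm (H \<xi> z) \<le> norm (mop A0 z) + norm (\<beta> *\<^sub>R mop (S ** A0) z) + norm (\<delta> \<xi> *\<^sub>R (\<i> *s mop (Kt \<xi> ** A0) z))"
      unfolding H_def by (rule order_trans[OF norm_triangle_ineq4 add_right_mono[OF norm_triangle_ineq]])
    also have "norm (\<beta> *\<^sub>R mop (S ** A0) z) \<le> \<beta> * s0 * norm z"
      using \<beta> mult_left_mono[OF s0(2)[of z], of \<beta>] by simp
    also have "norm (\<delta> \<xi> *\<^sub>R (\<i> *s mop (Kt \<xi> ** A0) z)) \<le> \<alpha> * (k1 * e0 * norm z)"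
    proof -
      have "\<delta> \<xi> \<le> \<alpha>" using \<delta>1[of \<xi>] \<alpha> by simp
      then show ?thesis using \<delta>0[of \<xi>] Kt0[of \<xi> z] \<alpha> by (simp add: norm_ii) (intro mult_mono, auto)
    qed
    also note e0(2)[of z]
    finally show ?thesis by (simp add: b_def algebra_simps)
  qed
  \<comment> \<open>The dissipation controls \<alpha> c1 / 2 times \<open>rho\<close> |z|^2, and the
    form is at most b |z|^2.\<close>
  define c where "c = \<alpha> * c1 / (2 * b)"
  have c: "c > 0" using \<alpha> c1 b by (simp add: c_def)
  have dissip: "H \<xi> z \<bullet> w \<le> - c * rho \<xi> * (H \<xi> z \<bullet> z)"
    if eq: "mop A0 w + (\<i> * complex_of_real (norm \<xi>)) *s mop (symbol A (sgn \<xi>)) z + mop L z = 0" for \<xi> z w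
  proof -
    let ?r = "norm \<xi>" and ?A = "symbol A (sgn \<xi>)"
    have sc: "(\<i> * complex_of_real ?r) *s y = ?r *\<^sub>R (\<i> *s y)" for y :: "complex ^ 'm"
      by (simp add: vec_eq_iff scaleR_conv_of_real[where 'a=complex])
    have u: "mop A0 w = - (?r *\<^sub>R (\<i> *s mop ?A z)) - mop L z"
    proof -
      have "mop A0 w = (mop A0 w + ?r *\<^sub>R (\<i> *s mop ?A z) + mop L z) - ?r *\<^sub>R (\<i> *s mop ?A z) - mop L z" by simp
      then show ?thesis unfolding eq[unfolded sc] by simp
    qed
    have u1: "mop A0 w \<bullet> z = - (mop L z \<bullet> z)"
      unfolding u using ii_symmetric_zero[OF symT, of "sgn \<xi>" z] by (simp add: inner_diff_left)
    have u2: "mop S (mop A0 w) \<bullet> z = - (?r * ((\<i> *s mop S (mop ?A z)) \<bullet> z)) - mop S (mop L z) \<bullet> z"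
      unfolding u by (simp add: linear_diff[OF linear_mop] mop_uminus mop_scaleR mop_ii inner_diff_left)
    have u3: "(\<i> *s mop (Kt \<xi>) (mop A0 w)) \<bullet> z =
        ?r * (mop (Kt \<xi>) (mop ?A z) \<bullet> z) - (\<i> *s mop (Kt \<xi>) (mop L z)) \<bullet> z"
      unfolding u by (simp add: linear_diff[OF linear_mop] mop_uminus mop_scaleR mop_ii inner_diff_left
          linear_diff[OF linear_ii] linear_neg[OF linear_ii] linear_scale[OF linear_ii] ii_ii)
    \<comment> \<open>Each summand of \<open>H\<close> ends in \<open>A0\<close>. After
      \<open>H\<close> is moved to \<open>w\<close> by symmetry, only \<open>mop A0 w\<close>
      occurs, and the equation can be substituted for it.\<close>
    have "H \<xi> z \<bullet> w = H \<xi> w \<bullet> z" using Hsym[of \<xi> z w] by (simp add: inner_commute)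
    also have "\<dots> = mop A0 w \<bullet> z + \<beta> * (mop S (mop A0 w) \<bullet> z) - \<delta> \<xi> * ((\<i> *s mop (Kt \<xi>) (mop A0 w)) \<bullet> z)"
      by (simp add: H_def inner_diff_left inner_add_left mop_mult)
    also have "\<dots> = - (mop L z \<bullet> z) - \<beta> * (?r * ((\<i> *s mop S (mop ?A z)) \<bullet> z)) - \<beta> * (mop M z \<bullet> z - mop L z \<bullet> z)
        - \<delta> \<xi> * ?r * (mop (Kt \<xi>) (mop ?A z) \<bullet> z) + \<delta> \<xi> * ((\<i> *s mop (Kt \<xi>) (mop L z)) \<bullet> z)"
      unfolding u1 u2 u3 Mform by (simp add: algebra_simps)
    also have "\<dots> \<le> - (\<alpha> * c1 / 2) * (?r\<^sup>2 / (1 + ?r\<^sup>2)) * (norm z)\<^sup>2"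
    \<comment> \<open>At frequency 0 there is no direction on the sphere to which (S)_2 or K could
      be applied, but only the two terms with \<open>L\<close> remain.\<close>
    proof (cases "\<xi> = 0")
      case True
      have "- (mop L z \<bullet> z) + \<beta> * (mop L z \<bullet> z) \<le> 0" using mult_right_mono[OF \<beta>(2) Lnn[of z]] by simp
      moreover have "\<beta> * (mop M z \<bullet> z) \<ge> 0" using \<beta>(1) Mnn[of z] by simp
      ultimately show ?thesis using True by (simp add: \<delta>_def algebra_simps)
    next
      case False
      note \<omega> = sgn1[OF False]
      have Kt: "Kt \<xi> = K (sgn \<xi>)" using False by (simp add: Kt_def)
      have T: "(\<i> *s mop (Kt \<xi>) (mop L z)) \<bullet> z \<le> k1 * norm (mop L z) * norm z"
        using Cauchy_Schwarz_ineq2[of "\<i> *s mop (Kt \<xi>) (mop L z)" z]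
          mult_right_mono[OF k1(2)[OF \<omega>, of "mop L z"] norm_ge_zero[of z]]
        unfolding norm_ii Kt by linarith
      have d: "\<delta> \<xi> * ?r = \<alpha> * (?r\<^sup>2 / (1 + ?r\<^sup>2))" by (simp add: \<delta>_def power2_eq_square)
      show ?thesis
        unfolding d unfolding \<delta>_def Kt
        by (rule dissipation_estimate[OF Lnn Mnn Dnn[OF \<omega>] norm_ge_zero norm_ge_zero norm_ge_zero
            pen'[OF \<omega>] C2(2) T[unfolded Kt] c1 N \<alpha> \<beta>(1,2) \<alpha>G[unfolded G_def]])
    qed
    also have "\<dots> \<le> - c * rho \<xi> * (H \<xi> z \<bullet> z)"
    proof -
      have "H \<xi> z \<bullet> z \<le> b * (norm z)\<^sup>2"
        using norm_cauchy_schwarz[of "H \<xi> z" z] mult_right_mono[OF Hup[of \<xi> z] norm_ge_zero[of z]]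
        by (simp add: power2_eq_square)
      then have "c * rho \<xi> * (H \<xi> z \<bullet> z) \<le> c * rho \<xi> * (b * (norm z)\<^sup>2)"
        using c by (intro mult_left_mono) (auto simp: rho_def)
      also have "\<dots> = (\<alpha> * c1 / 2) * (?r\<^sup>2 / (1 + ?r\<^sup>2)) * (norm z)\<^sup>2"
        using b by (simp add: c_def rho_def)
      finally show ?thesis by simp
    qed
    finally show ?thesis .
  qed
  have Hmeas: "(\<lambda>\<xi>. H \<xi> (V \<xi>)) \<in> borel_measurable borel" if V: "V \<in> borel_measurable borel" for V
  proof -
    have m: "(\<lambda>\<xi>. mop X (V \<xi>)) \<in> borel_measurable borel" for X
      by (rule mop_measurable[OF borel_measurable_const V])
    have k: "(\<lambda>\<xi>. \<i> *s mop (Kt \<xi>) (mop A0 (V \<xi>))) \<in> borel_measurable borel"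
      by (rule borel_measurable_continuous_on[OF continuous_on_ii[OF continuous_on_id] mop_measurable[OF Kt_measurable m]])
    show ?thesis unfolding H_def mop_mult[of "Kt _"] \<delta>_def using m k by measurable
  qed
  show ?thesis
    by (rule that[OF _ b c Hlin Hsym Hlow Hup dissip Hmeas]) (use a0 in simp)
qed

section \<open>Decay along solutions at one frequency\<close>

lemma Fourier_ODE_decay:
  fixes H :: "complex ^ 'm \<Rightarrow> complex ^ 'm"
  assumes lin: "linear H" and sym: "\<And>z w. H z \<bullet> w = z \<bullet> H w"
    and dissip: "\<And>z w. mop A0 w + (\<i> * complex_of_real (norm \<xi>)) *s mop (symbol A (sgn \<xi>)) z + mop L z = 0 \<Longrightarrow>
      H z \<bullet> w \<le> - k * (H z \<bullet> z)"
    and ode: "Fourier_ODE A0 A L \<xi> v" and T: "T \<ge> 0"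
  shows "H (v T) \<bullet> v T \<le> exp (- (2 * k) * T) * (H (v 0) \<bullet> v 0)"
proof (rule exp_decay[OF T])
  have bl: "bounded_linear H" using lin by (simp add: linear_conv_bounded_linear)
  have D: "\<exists>v'. (v has_vector_derivative v') (at t within {0..}) \<and>
      mop A0 v' + (\<i> * complex_of_real (norm \<xi>)) *s mop (symbol A (sgn \<xi>)) (v t) + mop L (v t) = 0" if "t \<ge> 0" for t
    using ode that by (auto simp: Fourier_ODE_def)
  have "continuous_on {0..} v"
    using D has_vector_derivative_continuous by (force simp: continuous_on_eq_continuous_within)
  then have cv: "continuous_on {0..T} v" by (rule continuous_on_subset) auto
  then show "continuous_on {0..T} (\<lambda>t. H (v t) \<bullet> v t)"
    by (intro continuous_on_inner bounded_linear.continuous_on[OF bl])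
  fix t assume t: "0 < t" "t < T"
  obtain v' where v': "(v has_vector_derivative v') (at t within {0..})"
    and eq: "mop A0 v' + (\<i> * complex_of_real (norm \<xi>)) *s mop (symbol A (sgn \<xi>)) (v t) + mop L (v t) = 0"
    using D[of t] t by auto
  have "t \<in> interior {0..}" using t by simp
  then have d: "(v has_derivative (\<lambda>h. h *\<^sub>R v')) (at t)"
    using v' at_within_interior[of t "{0..}"] by (simp add: has_vector_derivative_def)
  have "((\<lambda>t. H (v t) \<bullet> v t) has_derivative (\<lambda>h. H (v t) \<bullet> (h *\<^sub>R v') + H (h *\<^sub>R v') \<bullet> v t)) (at t)"
    by (rule has_derivative_inner[OF bounded_linear.has_derivative[OF bl d] d])
  then have "((\<lambda>t. H (v t) \<bullet> v t) has_real_derivative 2 * (H (v t) \<bullet> v')) (at t)"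
    unfolding has_field_derivative_def
    by (rule has_derivative_eq_rhs) (simp add: fun_eq_iff linear_scale[OF lin] sym[of v'] inner_commute[of v'])
  moreover have "2 * (H (v t) \<bullet> v') \<le> - (2 * k) * (H (v t) \<bullet> v t)" using dissip[OF eq] by simp
  ultimately show "\<exists>d. ((\<lambda>t. H (v t) \<bullet> v t) has_real_derivative d) (at t) \<and> d \<le> - (2 * k) * (H (v t) \<bullet> v t)" by blast
qed

section \<open>The energy argument for weak solutions\<close>

text \<open>With this operator the equation at a frequency reads A0 v' + gen v = 0.\<close>

abbreviation gen :: "('n::finite \<Rightarrow> real ^ 'm ^ 'm) \<Rightarrow> real ^ 'm ^ 'm \<Rightarrow> real ^ 'n \<Rightarrow> complex ^ 'm \<Rightarrow> complex ^ 'm" where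
  "gen A L \<xi> z \<equiv> (\<i> * complex_of_real (norm \<xi>)) *s mop (symbol A (sgn \<xi>)) z + mop L z"

text \<open>Since |xi| \<open>sgn\<close> xi is xi, the direction disappears and the operator is a
  polynomial of degree one in the frequency. Written with \<open>mon\<close>, it matches the
  derivatives of transforms of band-limited functions; the minus sign comes from the -i in
  \<open>mon\<close>.\<close>

lemma gen_nth:
  "gen A L \<xi> z $ i = (\<Sum>k\<in>UNIV. complex_of_real (L $ i $ k) * z $ k)
    - (\<Sum>j\<in>UNIV. \<Sum>k\<in>UNIV. complex_of_real (A j $ i $ k) * (mon [j] \<xi> * z $ k))"
proof -
  have s: "norm \<xi> * sgn \<xi> $ j = \<xi> $ j" for j by (cases "\<xi> = 0") (simp_all add: sgn_div_norm)
  have "(\<i> * complex_of_real (norm \<xi>)) * mop (symbol A (sgn \<xi>)) z $ i =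
      (\<Sum>k\<in>UNIV. \<Sum>j\<in>UNIV. \<i> * complex_of_real (norm \<xi> * sgn \<xi> $ j) * complex_of_real (A j $ i $ k) * z $ k)"
    by (simp add: mop_nth symbol_def sum_distrib_left sum_distrib_right ac_simps)
  also have "\<dots> = (\<Sum>j\<in>UNIV. \<Sum>k\<in>UNIV. \<i> * complex_of_real (\<xi> $ j) * complex_of_real (A j $ i $ k) * z $ k)"
    unfolding s by (rule sum.swap)
  also have "\<dots> = - (\<Sum>j\<in>UNIV. \<Sum>k\<in>UNIV. complex_of_real (A j $ i $ k) * (mon [j] \<xi> * z $ k))"
    by (simp add: sum_negf[symmetric] ac_simps)
  finally show ?thesis by (simp add: mop_nth)
qed

lemma L2_integral_scaleR_bound:
  fixes f :: "real ^ 'n \<Rightarrow> real ^ 'm"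
  assumes "L2_fun \<phi>" "L2_fun f"
  shows "norm (\<integral>x. \<phi> x *\<^sub>R f x \<partial>lborel) \<le> L2_norm \<phi> * L2_norm f"
  by (rule L2_integral_norm_le[OF assms]) simp

lemma L2_integrable_scaleR:
  fixes f :: "real ^ 'n \<Rightarrow> real ^ 'm"
  assumes p: "L2_fun \<phi>" and f: "L2_fun f"
  shows "integrable lborel (\<lambda>x. \<phi> x *\<^sub>R f x)"
proof -
  note [measurable] = L2_fun_measurable[OF p] L2_fun_measurable[OF f]
  show ?thesis by (rule L2_integrable_bound[OF p f]) auto
qed

lemma L2_integral_scaleR_diff:
  fixes f :: "real ^ 'n \<Rightarrow> real ^ 'm"
  assumes p: "L2_fun \<phi>" "L2_fun \<psi>" and f: "L2_fun f" "L2_fun g"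
  shows "(\<integral>x. \<phi> x *\<^sub>R f x \<partial>lborel) - (\<integral>x. \<phi> x *\<^sub>R g x \<partial>lborel) = (\<integral>x. \<phi> x *\<^sub>R (f x - g x) \<partial>lborel)"
    and "(\<integral>x. \<phi> x *\<^sub>R f x \<partial>lborel) - (\<integral>x. \<psi> x *\<^sub>R f x \<partial>lborel) = (\<integral>x. (\<phi> x - \<psi> x) *\<^sub>R f x \<partial>lborel)"
  using L2_integrable_scaleR[OF p(1) f(1)] L2_integrable_scaleR[OF p(1) f(2)] L2_integrable_scaleR[OF p(2) f(1)]
  by (simp_all add: scaleR_diff_right scaleR_diff_left)

definition pairing :: "(real ^ 'n \<Rightarrow> real) \<Rightarrow> (real ^ 'n \<Rightarrow> real ^ 'm) \<Rightarrow> real ^ 'm" where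
  "pairing \<phi> f = (\<integral>x. \<phi> x *\<^sub>R f x \<partial>lborel)"

lemma pairing_matrix:
  fixes X :: "real ^ 'm ^ 'm"
  assumes "L2_fun \<phi>" "L2_fun f"
  shows "(\<integral>x. \<phi> x *\<^sub>R (X *v f x) \<partial>lborel) = X *v pairing \<phi> f"
    and "integrable lborel (\<lambda>x. \<phi> x *\<^sub>R (X *v f x))"
proof -
  have bl: "bounded_linear (\<lambda>y. X *v y)" by (rule matrix_vector_mul_bounded_linear)
  note i = L2_integrable_scaleR[OF assms]
  show "(\<integral>x. \<phi> x *\<^sub>R (X *v f x) \<partial>lborel) = X *v pairing \<phi> f"
    using integral_bounded_linear[OF bl i] by (simp add: pairing_def matrix_vector_mult_scaleR)
  show "integrable lborel (\<lambda>x. \<phi> x *\<^sub>R (X *v f x))"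
    using integrable_bounded_linear[OF bl i] by (simp add: matrix_vector_mult_scaleR)
qed

text \<open>The right side of the weak equation, expressed by pairings alone. In this form it
  depends continuously on \<open>\<phi>\<close> in the L^2 norms of \<open>\<phi>\<close> and its
  first derivatives, so it still makes sense beyond compact support.\<close>

definition flux :: "('n::finite \<Rightarrow> real ^ 'm ^ 'm) \<Rightarrow> real ^ 'm ^ 'm \<Rightarrow> (real ^ 'n \<Rightarrow> real) \<Rightarrow> (real ^ 'n \<Rightarrow> real ^ 'm) \<Rightarrow> real ^ 'm" where
  "flux A L \<phi> f = (\<Sum>j\<in>UNIV. A j *v pairing (partial j \<phi>) f) - L *v pairing \<phi> f"

lemma Cauchy_solution_pairing_derivative:
  fixes A :: "'n::finite \<Rightarrow> real ^ 'm ^ 'm"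
  assumes sol: "Cauchy_solution A0 A L u0 u" and \<phi>: "test_function \<phi>" and t: "t > 0"
  shows "((\<lambda>s. A0 *v pairing \<phi> (u s)) has_vector_derivative flux A L \<phi> (u t)) (at t)"
proof -
  have L2: "L2_fun (u s)" if "s \<ge> 0" for s using sol that by (auto simp: Cauchy_solution_def)
  note p = test_function_L2[OF \<phi>] and pj = test_function_L2[OF test_function_partial[OF \<phi>]]
  have "(\<integral>x. (\<Sum>j\<in>UNIV. partial j \<phi> x *\<^sub>R (A j *v u t x)) - \<phi> x *\<^sub>R (L *v u t x) \<partial>lborel) = flux A L \<phi> (u t)"
    using pairing_matrix[OF p L2[of t]] pairing_matrix[OF pj L2[of t]] t
    by (simp add: flux_def)
  moreover have "((\<lambda>s. \<integral>x. \<phi> x *\<^sub>R (A0 *v u s x) \<partial>lborel) has_vector_derivative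
      (\<integral>x. (\<Sum>j\<in>UNIV. partial j \<phi> x *\<^sub>R (A j *v u t x)) - \<phi> x *\<^sub>R (L *v u t x) \<partial>lborel)) (at t)"
    using sol \<phi> t by (auto simp: Cauchy_solution_def)
  ultimately have "((\<lambda>s. \<integral>x. \<phi> x *\<^sub>R (A0 *v u s x) \<partial>lborel) has_vector_derivative flux A L \<phi> (u t)) (at t)" by simp
  then show ?thesis
    by (rule has_vector_derivative_transform_within_open[of _ _ _ "{0<..}"])
      (use t pairing_matrix(1)[OF p L2] in auto)
qed

text \<open>Linearisation in time. The derivative of the pairing is the flux, and by Cauchy-Schwarz
  the flux varies along the segment by no more than \<open>\<delta>\<close> allows. The bound sees
  the test function only through L^2 norms up to first order and therefore passes to the limit under
  cut-off.\<close>

lemma Cauchy_solution_estimate: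
  fixes A :: "'n::finite \<Rightarrow> real ^ 'm ^ 'm"
  assumes sol: "Cauchy_solution A0 A L u0 u" and \<psi>: "Hinf \<psi>"
    and seg: "closed_segment t s \<subseteq> {0<..}"
    and \<delta>: "\<And>\<tau>. \<tau> \<in> closed_segment t s \<Longrightarrow> L2_norm (\<lambda>x. u \<tau> x - u t x) \<le> \<delta>"
    and a: "\<And>j y. norm (A j *v y) \<le> a * norm y" "\<And>y. norm (L *v y) \<le> a * norm y" "a \<ge> 0"
  shows "norm (A0 *v pairing \<psi> (u s) - A0 *v pairing \<psi> (u t) - (s - t) *\<^sub>R flux A L \<psi> (u t))
    \<le> \<bar>s - t\<bar> * (a * \<delta> * ((\<Sum>j\<in>UNIV. L2_norm (partial j \<psi>)) + L2_norm \<psi>))"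
proof -
  have L2: "L2_fun (u \<tau>)" if "\<tau> \<in> closed_segment t s" for \<tau>
    using sol seg that by (force simp: Cauchy_solution_def)
  have tin: "t \<in> closed_segment t s" "s \<in> closed_segment t s" by auto
  have \<delta>0: "\<delta> \<ge> 0" using \<delta>[OF tin(1)] L2_norm_nonneg[of "\<lambda>x. u t x - u t x"] by linarith
  have test: "norm (A0 *v pairing \<phi> (u s) - A0 *v pairing \<phi> (u t) - (s - t) *\<^sub>R flux A L \<phi> (u t))
      \<le> \<bar>s - t\<bar> * (a * \<delta> * ((\<Sum>j\<in>UNIV. L2_norm (partial j \<phi>)) + L2_norm \<phi>))" if \<phi>: "test_function \<phi>" for \<phi>
  proof -
    note p = test_function_L2[OF \<phi>] and pj = test_function_L2[OF test_function_partial[OF \<phi>]]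
    have pd: "norm (pairing \<eta> (u \<tau>) - pairing \<eta> (u t)) \<le> L2_norm \<eta> * \<delta>"
      if "L2_fun \<eta>" and \<tau>: "\<tau> \<in> closed_segment t s" for \<eta> \<tau>
      unfolding pairing_def L2_integral_scaleR_diff(1)[OF that(1,1) L2[OF \<tau>] L2[OF tin(1)]]
      using L2_integral_scaleR_bound[OF that(1) L2_fun_diff[OF L2[OF \<tau>] L2[OF tin(1)]]]
        mult_left_mono[OF \<delta>[OF \<tau>] L2_norm_nonneg[of \<eta>]] by linarith
    have "norm (A0 *v pairing \<phi> (u s) - A0 *v pairing \<phi> (u t) - (s - t) *\<^sub>R flux A L \<phi> (u t))
        \<le> norm (s - t) * (a * \<delta> * ((\<Sum>j\<in>UNIV. L2_norm (partial j \<phi>)) + L2_norm \<phi>))"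
    proof (rule vector_differentiable_bound_linearization[where S="closed_segment t s"])
      show "((\<lambda>s. A0 *v pairing \<phi> (u s)) has_vector_derivative flux A L \<phi> (u \<tau>)) (at \<tau> within closed_segment t s)"
        if "\<tau> \<in> closed_segment t s" for \<tau>
        using seg that by (intro has_vector_derivative_at_within[OF Cauchy_solution_pairing_derivative[OF sol \<phi>]]) auto
      fix \<tau> assume \<tau>: "\<tau> \<in> closed_segment t s"
      have "flux A L \<phi> (u \<tau>) - flux A L \<phi> (u t) =
          (\<Sum>j\<in>UNIV. A j *v (pairing (partial j \<phi>) (u \<tau>) - pairing (partial j \<phi>) (u t)))
          - L *v (pairing \<phi> (u \<tau>) - pairing \<phi> (u t))"
        by (simp add: flux_def matrix_vector_mult_diff_distrib sum_subtractf)
      also have "norm \<dots> \<le> (\<Sum>j\<in>UNIV. a * (L2_norm (partial j \<phi>) * \<delta>)) + a * (L2_norm \<phi> * \<delta>)"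
      proof (rule order_trans[OF norm_triangle_ineq4 add_mono])
        show "norm (\<Sum>j\<in>UNIV. A j *v (pairing (partial j \<phi>) (u \<tau>) - pairing (partial j \<phi>) (u t)))
            \<le> (\<Sum>j\<in>UNIV. a * (L2_norm (partial j \<phi>) * \<delta>))"
          by (rule sum_norm_le) (use a(1) mult_left_mono[OF pd[OF pj \<tau>] a(3)] order_trans in blast)
        show "norm (L *v (pairing \<phi> (u \<tau>) - pairing \<phi> (u t))) \<le> a * (L2_norm \<phi> * \<delta>)"
          using a(2) mult_left_mono[OF pd[OF p \<tau>] a(3)] order_trans by blast
      qed
      also have "\<dots> = a * \<delta> * ((\<Sum>j\<in>UNIV. L2_norm (partial j \<phi>)) + L2_norm \<phi>)"
        by (simp add: sum_distrib_left algebra_simps)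
      finally show "norm (flux A L \<phi> (u \<tau>) - flux A L \<phi> (u t)) \<le> a * \<delta> * ((\<Sum>j\<in>UNIV. L2_norm (partial j \<phi>)) + L2_norm \<phi>)" .
    qed auto
    then show ?thesis by simp
  qed
  obtain \<Phi> where \<Phi>: "\<And>k::nat. test_function (\<Phi> k)"
    and lim: "\<And>js. (\<lambda>k. L2_norm (\<lambda>x. partials js (\<Phi> k) x - partials js \<psi> x)) \<longlonglongrightarrow> 0"
    using cutoff_sequence[OF \<psi>] by blast
  note pL2 = test_function_L2[OF test_function_partials[OF \<Phi>]] and \<psi>L2 = Hinf_L2[OF \<psi>]
  have pair: "(\<lambda>k. pairing (partials js (\<Phi> k)) (u \<tau>)) \<longlonglongrightarrow> pairing (partials js \<psi>) (u \<tau>)"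
    if \<tau>: "\<tau> \<in> closed_segment t s" for js \<tau>
  proof (rule LIM_zero_cancel, rule Lim_null_comparison)
    show "\<forall>\<^sub>F k in sequentially. norm (pairing (partials js (\<Phi> k)) (u \<tau>) - pairing (partials js \<psi>) (u \<tau>))
        \<le> L2_norm (\<lambda>x. partials js (\<Phi> k) x - partials js \<psi> x) * L2_norm (u \<tau>)"
      unfolding pairing_def L2_integral_scaleR_diff(2)[OF pL2 \<psi>L2 L2[OF \<tau>] L2[OF \<tau>]]
      by (intro always_eventually allI L2_integral_scaleR_bound L2_fun_diff pL2 \<psi>L2 L2 \<tau>)
    show "(\<lambda>k. L2_norm (\<lambda>x. partials js (\<Phi> k) x - partials js \<psi> x) * L2_norm (u \<tau>)) \<longlonglongrightarrow> 0"
      using tendsto_mult[OF lim tendsto_const] by simp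
  qed
  note nrm = L2_norm_tendsto[OF pL2 \<psi>L2 lim]
  have mv: "(\<lambda>k. X *v f k) \<longlonglongrightarrow> X *v y" if "f \<longlonglongrightarrow> y" for X :: "real ^ 'm ^ 'm" and f :: "nat \<Rightarrow> real ^ 'm" and y
    by (rule bounded_linear.tendsto[OF matrix_vector_mul_bounded_linear that])
  have fl: "(\<lambda>k. flux A L (\<Phi> k) (u t)) \<longlonglongrightarrow> flux A L \<psi> (u t)"
    unfolding flux_def using pair[OF tin(1), of "[]"] pair[OF tin(1), of "[_]"]
    by (intro tendsto_diff tendsto_sum mv) auto
  show ?thesis
  proof (rule tendsto_le[OF trivial_limit_sequentially])
    show "(\<lambda>k. norm (A0 *v pairing (\<Phi> k) (u s) - A0 *v pairing (\<Phi> k) (u t) - (s - t) *\<^sub>R flux A L (\<Phi> k) (u t)))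
        \<longlonglongrightarrow> norm (A0 *v pairing \<psi> (u s) - A0 *v pairing \<psi> (u t) - (s - t) *\<^sub>R flux A L \<psi> (u t))"
      using pair[OF tin(1), of "[]"] pair[OF tin(2), of "[]"]
      by (intro tendsto_norm tendsto_diff tendsto_scaleR tendsto_const fl mv) auto
    show "(\<lambda>k. \<bar>s - t\<bar> * (a * \<delta> * ((\<Sum>j\<in>UNIV. L2_norm (partial j (\<Phi> k))) + L2_norm (\<Phi> k))))
        \<longlonglongrightarrow> \<bar>s - t\<bar> * (a * \<delta> * ((\<Sum>j\<in>UNIV. L2_norm (partial j \<psi>)) + L2_norm \<psi>))"
      using nrm[of "[]"] nrm[of "[_]"] by (intro tendsto_mult tendsto_const tendsto_add tendsto_sum) auto
  qed (use test[OF \<Phi>] in simp)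
qed

lemma pairing_Re_FT:
  assumes g: "band R g" and f: "L2_fun f"
  shows "pairing (\<lambda>x. Re (FT g x)) f $ k = Re (\<integral>\<xi>. g \<xi> * fourier f \<xi> $ k \<partial>lborel)"
  unfolding pairing_def
    L2_integral_scaleR_nth[OF L2_fun_Re[OF Plancherel_L1_L2(1)[OF band_integrable[OF g] conjunct1[OF g]]] f]
    Re_integral_FT[OF g L2_fun_nth[OF f], symmetric]
    fourier_multiplication[OF f band_integrable[OF g] conjunct1[OF g]] ..

lemma L2_fun_trunc_gen:
  assumes f: "L2_fun f"
  shows "L2_fun (trunc R (\<lambda>\<xi>. gen A L \<xi> (f \<xi>)))"
proof (rule L2_fun_vec)
  fix i
  have b: "band R (trunc R (\<lambda>\<xi>. f \<xi> $ k))" for k using L2_fun_trunc[OF L2_fun_nth[OF f]] by auto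
  have "L2_fun (\<lambda>\<xi>. (\<Sum>k\<in>UNIV. complex_of_real (L $ i $ k) * trunc R (\<lambda>\<xi>. f \<xi> $ k) \<xi>)
    - (\<Sum>j\<in>UNIV. \<Sum>k\<in>UNIV. complex_of_real (A j $ i $ k) * (mon [j] \<xi> * trunc R (\<lambda>\<xi>. f \<xi> $ k) \<xi>)))"
    by (intro L2_fun_diff L2_fun_sum conjunct1[OF band_cmult[OF b]] conjunct1[OF band_cmult[OF band_mon[OF b]]])
  moreover have "trunc R (\<lambda>\<xi>. gen A L \<xi> (f \<xi>)) \<xi> $ i = (\<Sum>k\<in>UNIV. complex_of_real (L $ i $ k) * trunc R (\<lambda>\<xi>. f \<xi> $ k) \<xi>)
    - (\<Sum>j\<in>UNIV. \<Sum>k\<in>UNIV. complex_of_real (A j $ i $ k) * (mon [j] \<xi> * trunc R (\<lambda>\<xi>. f \<xi> $ k) \<xi>))" for \<xi>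
    unfolding vector_scaleR_component gen_nth
    by (cases "norm \<xi> \<le> R") (simp_all add: indicator_def)
  ultimately show "L2_fun (\<lambda>\<xi>. trunc R (\<lambda>\<xi>. gen A L \<xi> (f \<xi>)) \<xi> $ i)" by simp
qed

text \<open>Testing the estimate of the pairing against \<open>g = cnj (trunc R D\<^sub>i)\<close> itself turns the weak
  equation into a bound of \<open>D\<close> in \<open>L\<^sup>2\<close>.\<close>

lemma fourier_increment_bound:
  fixes A :: "'n::finite \<Rightarrow> real ^ 'm ^ 'm"
  assumes sol: "Cauchy_solution A0 A L u0 u" and R: "R \<ge> 0"
    and seg: "closed_segment t s \<subseteq> {0<..}"
    and \<delta>: "\<And>\<tau>. \<tau> \<in> closed_segment t s \<Longrightarrow> L2_norm (\<lambda>x. u \<tau> x - u t x) \<le> \<delta>"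
    and a: "\<And>j y. norm (A j *v y) \<le> a * norm y" "\<And>y. norm (L *v y) \<le> a * norm y" "a \<ge> 0"
  defines "D \<equiv> \<lambda>\<xi>. mop A0 (fourier (u s) \<xi> - fourier (u t) \<xi>) + (s - t) *\<^sub>R gen A L \<xi> (fourier (u t) \<xi>)"
  shows "L2_fun (trunc R D)"
    and "L2_norm (\<lambda>\<xi>. trunc R D \<xi> $ i) \<le> \<bar>s - t\<bar> * (a * \<delta> * (real CARD('n) * R + 1))"
proof -
  have L2: "L2_fun (u \<tau>)" if "\<tau> \<in> closed_segment t s" for \<tau>
    using sol seg that by (force simp: Cauchy_solution_def)
  have us: "L2_fun (u s)" and ut: "L2_fun (u t)" by (auto intro: L2)
  let ?s = "fourier (u s)" and ?t = "fourier (u t)"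
  have Us: "L2_fun ?s" and Ut: "L2_fun ?t" by (auto intro: L2_fun_fourier us ut)
  have dec: "trunc R D = (\<lambda>\<xi>. mop A0 (trunc R (\<lambda>\<xi>. ?s \<xi> - ?t \<xi>) \<xi>) + (s - t) *\<^sub>R trunc R (\<lambda>\<xi>. gen A L \<xi> (?t \<xi>)) \<xi>)"
    by (simp add: D_def fun_eq_iff mop_scaleR scaleR_add_right mult.commute)
  have mopL2: "L2_fun (\<lambda>\<xi>. mop A0 (f \<xi>))" if "L2_fun f" for f :: "real ^ 'n \<Rightarrow> complex ^ 'm"
  proof -
    obtain B where "B > 0" "\<And>z. norm (mop A0 z) \<le> B * norm z" using linear_bounded_pos[OF linear_mop] by blast
    then show ?thesis
      using mop_measurable[OF borel_measurable_const L2_fun_measurable[OF that], of A0]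
      by (intro L2_fun_bound[OF that, where C=B]) auto
  qed
  show DL2: "L2_fun (trunc R D)"
    unfolding dec by (intro L2_fun_add mopL2 L2_fun_trunc L2_fun_diff Us Ut L2_fun_scaleR L2_fun_trunc_gen)
  have Di: "L2_fun (\<lambda>\<xi>. trunc R D \<xi> $ i)" by (rule L2_fun_nth[OF DL2])
  define g where "g \<xi> = cnj (trunc R D \<xi> $ i)" for \<xi>
  have g: "band R g" unfolding g_def using L2_fun_cnj[OF Di] by (auto simp: indicator_def)
  have gn: "L2_norm g = L2_norm (\<lambda>\<xi>. trunc R D \<xi> $ i)" by (simp add: g_def L2_norm_def)
  define \<psi> where "\<psi> x = Re (FT g x)" for x
  have \<psi>: "Hinf \<psi>" unfolding \<psi>_def by (rule Hinf_Re_FT[OF g])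
  have pj: "partial j \<psi> = (\<lambda>x. Re (FT (\<lambda>\<xi>. mon [j] \<xi> * g \<xi>) x))" for j
    using partials_Re_FT[OF g, of "[j]"] by (simp add: \<psi>_def[abs_def])
  have n0: "L2_norm \<psi> \<le> L2_norm g"
    using L2_norm_Re_le[OF Plancherel_L1_L2(1)[OF band_integrable[OF g] conjunct1[OF g]]]
      Plancherel_L1_L2(2)[OF band_integrable[OF g] conjunct1[OF g]] by (simp add: \<psi>_def[abs_def])
  \<comment> \<open>On the band a derivative costs a factor of at most \<open>R\<close>. Without a
    bound on the frequencies the right side of the estimate could not be measured by the norm of
    \<open>g\<close>.\<close>
  have nj: "L2_norm (partial j \<psi>) \<le> R * L2_norm g" for j
  proof -
    note gj = band_mon[OF g, of "[j]"]
    have "L2_norm (partial j \<psi>) \<le> L2_norm (\<lambda>\<xi>. mon [j] \<xi> * g \<xi>)"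
      using L2_norm_Re_le[OF Plancherel_L1_L2(1)[OF band_integrable[OF gj] conjunct1[OF gj]]]
        Plancherel_L1_L2(2)[OF band_integrable[OF gj] conjunct1[OF gj]] by (simp add: pj)
    also have "\<dots> \<le> L2_norm (\<lambda>\<xi>. R *\<^sub>R g \<xi>)"
    proof (rule L2_norm_mono[OF L2_fun_scaleR[OF conjunct1[OF g]] L2_fun_measurable[OF conjunct1[OF gj]]], rule AE_I2)
      fix \<xi>
      show "norm (mon [j] \<xi> * g \<xi>) \<le> norm (R *\<^sub>R g \<xi>)"
      proof (cases "norm \<xi> \<le> R")
        case True
        have "norm (mon [j] \<xi>) \<le> R" using norm_mon[of "[j]" \<xi>] True by simp
        then show ?thesis using R by (simp add: norm_mult mult_right_mono)
      qed (use g in simp)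
    qed
    also have "\<dots> = R * L2_norm g" using R by (simp add: L2_norm_scaleR)
    finally show ?thesis .
  qed
  have sum_n: "(\<Sum>j\<in>UNIV. L2_norm (partial j \<psi>)) + L2_norm \<psi> \<le> (real CARD('n) * R + 1) * L2_norm g"
    using sum_mono[of UNIV "\<lambda>j. L2_norm (partial j \<psi>)" "\<lambda>_. R * L2_norm g"] nj n0 by (simp add: algebra_simps)
  have \<delta>0: "\<delta> \<ge> 0" using \<delta>[of t] L2_norm_nonneg[of "\<lambda>x. u t x - u t x"] by (simp del: L2_norm_nonneg)
  have intg: "integrable lborel (\<lambda>\<xi>. g' \<xi> * v \<xi> $ k)" if "band R g'" "L2_fun v" for g' k and v :: "real ^ 'n \<Rightarrow> complex ^ 'm"
    using that L2_fun_nth[OF that(2), of k] by (intro L2_integrable_bound[of g' "\<lambda>\<xi>. v \<xi> $ k"]) (auto simp: norm_mult)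
  let ?P = "\<lambda>v k. \<integral>\<xi>. g \<xi> * v \<xi> $ k \<partial>lborel" and ?Q = "\<lambda>j k. \<integral>\<xi>. (mon [j] \<xi> * g \<xi>) * ?t \<xi> $ k \<partial>lborel"
  have main: "(\<integral>\<xi>. g \<xi> * D \<xi> $ i \<partial>lborel) = (\<Sum>k\<in>UNIV. complex_of_real (A0 $ i $ k) * (?P ?s k - ?P ?t k))
      + complex_of_real (s - t) * ((\<Sum>k\<in>UNIV. complex_of_real (L $ i $ k) * ?P ?t k)
      - (\<Sum>j\<in>UNIV. \<Sum>k\<in>UNIV. complex_of_real (A j $ i $ k) * ?Q j k))"
  proof -
    have eq: "g \<xi> * D \<xi> $ i = (\<Sum>k\<in>UNIV. complex_of_real (A0 $ i $ k) * (g \<xi> * ?s \<xi> $ k - g \<xi> * ?t \<xi> $ k))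
      + complex_of_real (s - t) * ((\<Sum>k\<in>UNIV. complex_of_real (L $ i $ k) * (g \<xi> * ?t \<xi> $ k))
      - (\<Sum>j\<in>UNIV. \<Sum>k\<in>UNIV. complex_of_real (A j $ i $ k) * ((mon [j] \<xi> * g \<xi>) * ?t \<xi> $ k)))" for \<xi>
    proof -
      have 1: "g \<xi> * mop A0 (?s \<xi> - ?t \<xi>) $ i = (\<Sum>k\<in>UNIV. complex_of_real (A0 $ i $ k) * (g \<xi> * ?s \<xi> $ k - g \<xi> * ?t \<xi> $ k))"
        unfolding mop_nth sum_distrib_left by (intro sum.cong refl) (simp add: algebra_simps)
      have 2: "g \<xi> * gen A L \<xi> (?t \<xi>) $ i = (\<Sum>k\<in>UNIV. complex_of_real (L $ i $ k) * (g \<xi> * ?t \<xi> $ k))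
        - (\<Sum>j\<in>UNIV. \<Sum>k\<in>UNIV. complex_of_real (A j $ i $ k) * ((mon [j] \<xi> * g \<xi>) * ?t \<xi> $ k))"
        unfolding gen_nth right_diff_distrib sum_distrib_left
        by (intro arg_cong2[where f="(-)"] sum.cong refl) (simp_all only: ac_simps)
      have "g \<xi> * D \<xi> $ i = g \<xi> * mop A0 (?s \<xi> - ?t \<xi>) $ i + complex_of_real (s - t) * (g \<xi> * gen A L \<xi> (?t \<xi>) $ i)"
        unfolding D_def vector_add_component vector_scaleR_component scaleR_conv_of_real[where 'a=complex]
        by (simp only: distrib_left ac_simps)
      then show ?thesis unfolding 1 2 .
    qed
    note hb = has_bochner_integral_integrable[OF intg[OF g Us]] has_bochner_integral_integrable[OF intg[OF g Ut]]
      has_bochner_integral_integrable[OF intg[OF band_mon[OF g] Ut]]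
    show ?thesis
      unfolding eq
      by (rule has_bochner_integral_integral_eq)
        (intro has_bochner_integral_add has_bochner_integral_diff has_bochner_integral_sum
          has_bochner_integral_mult_right hb)
  qed
  have Re_main: "Re (\<integral>\<xi>. g \<xi> * D \<xi> $ i \<partial>lborel) =
      (A0 *v pairing \<psi> (u s) - A0 *v pairing \<psi> (u t) - (s - t) *\<^sub>R flux A L \<psi> (u t)) $ i"
    unfolding main flux_def pj unfolding \<psi>_def[abs_def]
    by (simp add: matrix_vector_mult_def pairing_Re_FT[OF g us] pairing_Re_FT[OF g ut] pairing_Re_FT[OF band_mon[OF g] ut]
        right_diff_distrib sum_subtractf sum_negf[symmetric] del: mon_simps)
  have "(\<integral>\<xi>. g \<xi> * D \<xi> $ i \<partial>lborel) = (\<integral>\<xi>. complex_of_real ((norm (trunc R D \<xi> $ i))\<^sup>2) \<partial>lborel)"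
  proof (intro Bochner_Integration.integral_cong refl)
    fix \<xi>
    show "g \<xi> * D \<xi> $ i = complex_of_real ((norm (trunc R D \<xi> $ i))\<^sup>2)"
      using complex_norm_square[of "D \<xi> $ i"] by (simp add: g_def indicator_def mult.commute)
  qed
  then have "(L2_norm g)\<^sup>2 = Re (\<integral>\<xi>. g \<xi> * D \<xi> $ i \<partial>lborel)"
    unfolding gn L2_norm_square integral_complex_of_real by simp
  also have "\<dots> \<le> norm (A0 *v pairing \<psi> (u s) - A0 *v pairing \<psi> (u t) - (s - t) *\<^sub>R flux A L \<psi> (u t))"
    unfolding Re_main using component_le_norm_cart abs_le_D1 by blast
  also have "\<dots> \<le> \<bar>s - t\<bar> * (a * \<delta> * ((\<Sum>j\<in>UNIV. L2_norm (partial j \<psi>)) + L2_norm \<psi>))"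
    by (rule Cauchy_solution_estimate[OF sol \<psi> seg \<delta> a])
  also have "\<dots> \<le> \<bar>s - t\<bar> * (a * \<delta> * ((real CARD('n) * R + 1) * L2_norm g))"
    using sum_n a(3) \<delta>0 by (intro mult_left_mono) auto
  finally have "L2_norm g * L2_norm g \<le> (\<bar>s - t\<bar> * (a * \<delta> * (real CARD('n) * R + 1))) * L2_norm g"
    by (simp add: power2_eq_square mult.assoc)
  moreover have "0 \<le> \<bar>s - t\<bar> * (a * \<delta> * (real CARD('n) * R + 1))" using a(3) \<delta>0 R by simp
  ultimately show "L2_norm (\<lambda>\<xi>. trunc R D \<xi> $ i) \<le> \<bar>s - t\<bar> * (a * \<delta> * (real CARD('n) * R + 1))"
    unfolding gn[symmetric] using L2_norm_nonneg[of g] by (cases "L2_norm g = 0") (auto simp del: L2_norm_nonneg)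
qed

section \<open>Energy integrated over a set of frequencies\<close>

lemma L2_norm_le_scale:
  assumes f: "L2_fun f" and g: "g \<in> borel_measurable borel"
    and le: "\<And>x. norm (g x) \<le> C * norm (f x)" and C: "C \<ge> 0"
  shows "L2_norm g \<le> C * L2_norm f"
proof -
  have "L2_norm g \<le> L2_norm (\<lambda>x. C *\<^sub>R f x)"
    by (rule L2_norm_mono[OF L2_fun_scaleR[OF f] g]) (use le C in simp)
  then show ?thesis using C by (simp add: L2_norm_scaleR)
qed

lemma L2_linear:
  fixes T :: "'b::euclidean_space \<Rightarrow> 'b"
  assumes T: "linear T" and f: "L2_fun f" and \<kappa>: "\<And>z. norm (T z) \<le> \<kappa> * norm z" "\<kappa> \<ge> 0"
  shows "L2_fun (\<lambda>x. T (f x))" and "L2_norm (\<lambda>x. T (f x)) \<le> \<kappa> * L2_norm f"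
proof -
  have m: "(\<lambda>x. T (f x)) \<in> borel_measurable borel"
    using T by (intro borel_measurable_continuous_on[OF _ L2_fun_measurable[OF f]] linear_continuous_on)
      (simp add: linear_conv_bounded_linear)
  show "L2_fun (\<lambda>x. T (f x))" by (rule L2_fun_bound[OF f m \<kappa>(1)])
  show "L2_norm (\<lambda>x. T (f x)) \<le> \<kappa> * L2_norm f" by (rule L2_norm_le_scale[OF f m \<kappa>])
qed

lemma L2_integrable_inner:
  assumes f: "L2_fun f" and g: "L2_fun g"
  shows "integrable lborel (\<lambda>x. f x \<bullet> g x)"
proof -
  note [measurable] = L2_fun_measurable[OF f] L2_fun_measurable[OF g]
  show ?thesis by (rule L2_integrable_bound[OF f g]) (auto simp: Cauchy_Schwarz_ineq2)
qed

lemma L2_integral_inner_le: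
  assumes f: "L2_fun f" and g: "L2_fun g"
  shows "\<bar>\<integral>x. f x \<bullet> g x \<partial>lborel\<bar> \<le> L2_norm f * L2_norm g"
  using L2_integral_norm_le[OF f g, of "\<lambda>x. f x \<bullet> g x"] by (simp add: Cauchy_Schwarz_ineq2)

lemma L2_norm_le_sum_nth:
  fixes f :: "real ^ 'n \<Rightarrow> 'b::euclidean_space ^ 'm"
  assumes f: "L2_fun f"
  shows "L2_norm f \<le> (\<Sum>i\<in>UNIV. L2_norm (\<lambda>x. f x $ i))"
proof -
  have "L2_norm f = L2_set (\<lambda>i. L2_norm (\<lambda>x. f x $ i)) UNIV"
    using L2_norm_vec[OF f] by (simp add: L2_set_def real_sqrt_unique)
  also have "\<dots> \<le> (\<Sum>i\<in>UNIV. L2_norm (\<lambda>x. f x $ i))" by (rule L2_set_le_sum) simp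
  finally show ?thesis .
qed

lemma L2_norm_fourier_diff:
  assumes f: "L2_fun f" and g: "L2_fun g"
  shows "L2_norm (\<lambda>\<xi>. fourier f \<xi> - fourier g \<xi>) = L2_norm (\<lambda>x. f x - g x)"
proof -
  let ?Ff = "\<lambda>R. fourier_L1 (trunc R f)" and ?Fg = "\<lambda>R. fourier_L1 (trunc R g)"
  note tf = L2_fun_trunc[OF f] and tg = L2_fun_trunc[OF g] and fi = integrable_trunc[OF f] and gi = integrable_trunc[OF g]
  note Pf = Plancherel_fourier_L1(1)[OF fi tf] and Pg = Plancherel_fourier_L1(1)[OF gi tg]
  note Ff = L2_fun_fourier[OF f] and Fg = L2_fun_fourier[OF g]
  have F: "((\<lambda>R. L2_norm (\<lambda>\<xi>. (?Ff R \<xi> - ?Fg R \<xi>) - (fourier f \<xi> - fourier g \<xi>))) \<longlongrightarrow> 0) at_top"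
  proof (rule tendsto_sandwich[OF _ _ tendsto_const])
    show "((\<lambda>R. L2_norm (\<lambda>\<xi>. ?Ff R \<xi> - fourier f \<xi>) + L2_norm (\<lambda>\<xi>. ?Fg R \<xi> - fourier g \<xi>)) \<longlongrightarrow> 0) at_top"
      using tendsto_add[OF fourier_L1_trunc_tendsto[OF f] fourier_L1_trunc_tendsto[OF g]] by simp
    have "L2_norm (\<lambda>\<xi>. (?Ff R \<xi> - ?Fg R \<xi>) - (fourier f \<xi> - fourier g \<xi>)) \<le>
        L2_norm (\<lambda>\<xi>. ?Ff R \<xi> - fourier f \<xi>) + L2_norm (\<lambda>\<xi>. ?Fg R \<xi> - fourier g \<xi>)" for R
    proof -
      have "(\<lambda>\<xi>. (?Ff R \<xi> - ?Fg R \<xi>) - (fourier f \<xi> - fourier g \<xi>)) =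
          (\<lambda>\<xi>. (?Ff R \<xi> - fourier f \<xi>) + (fourier g \<xi> - ?Fg R \<xi>))" by (simp add: algebra_simps)
      then show ?thesis
        using L2_norm_triangle[OF L2_fun_diff[OF Pf[of R] Ff] L2_fun_diff[OF Fg Pg[of R]]]
          L2_norm_minus_commute[of "fourier g" "?Fg R"] by simp
    qed
    then show "\<forall>\<^sub>F R in at_top. L2_norm (\<lambda>\<xi>. (?Ff R \<xi> - ?Fg R \<xi>) - (fourier f \<xi> - fourier g \<xi>)) \<le>
        L2_norm (\<lambda>\<xi>. ?Ff R \<xi> - fourier f \<xi>) + L2_norm (\<lambda>\<xi>. ?Fg R \<xi> - fourier g \<xi>)" by simp
  qed simp
  have "((\<lambda>R. L2_norm (\<lambda>\<xi>. ?Ff R \<xi> - ?Fg R \<xi>)) \<longlongrightarrow> L2_norm (\<lambda>\<xi>. fourier f \<xi> - fourier g \<xi>)) at_top"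
    by (rule L2_norm_tendsto[OF L2_fun_diff[OF Pf Pg] L2_fun_diff[OF Ff Fg] F])
  moreover have "L2_norm (\<lambda>\<xi>. ?Ff R \<xi> - ?Fg R \<xi>) = L2_norm (trunc R (\<lambda>x. f x - g x))" for R
    unfolding fourier_L1_diff[OF fi gi]
    using Plancherel_fourier_L1(2)[OF Bochner_Integration.integrable_diff[OF fi[of R] gi[of R]] L2_fun_diff[OF tf[of R] tg[of R]]]
    by (simp add: scaleR_diff_right)
  moreover have "((\<lambda>R. L2_norm (trunc R (\<lambda>x. f x - g x))) \<longlongrightarrow> L2_norm (\<lambda>x. f x - g x)) at_top"
    by (rule L2_norm_tendsto[OF L2_fun_trunc[OF L2_fun_diff[OF f g]] L2_fun_diff[OF f g] trunc_tendsto[OF L2_fun_diff[OF f g]]])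
  ultimately show ?thesis using tendsto_unique[OF trivial_limit_at_top_linorder] by simp
qed

text \<open>The transforms of the truncations are integrals and agree at every frequency, so both
  choices are made from the same predicate. That is why the conclusion is equality
  everywhere.\<close>

lemma fourier_cong_AE:
  assumes "AE x in lborel. f x = g x" and f: "L2_fun f" and g: "L2_fun g"
  shows "fourier f = fourier g"
proof -
  have m: "trunc R h \<in> borel_measurable lborel \<and> (\<lambda>x. exp (- \<i> * complex_of_real (x \<bullet> \<xi>)) *s cvec (trunc R h x)) \<in> borel_measurable lborel"
    if "L2_fun h" for h :: "real ^ 'a \<Rightarrow> real ^ 'b" and R \<xi>
  proof
    note [measurable] = L2_fun_measurable[OF L2_fun_trunc[OF that, of R]]
    show "trunc R h \<in> borel_measurable lborel" by simp
    show "(\<lambda>x. exp (- \<i> * complex_of_real (x \<bullet> \<xi>)) *s cvec (trunc R h x)) \<in> borel_measurable lborel"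
      using borel_measurable_cvec_nth[OF L2_fun_measurable[OF L2_fun_trunc[OF that, of R]]]
      by (intro borel_measurable_vec) (simp del: vector_scaleR_component)
  qed
  have "fourier_L1 (trunc R f) \<xi> = fourier_L1 (trunc R g) \<xi>" for R \<xi>
    unfolding fourier_L1_def
    by (intro arg_cong[where f="scaleR _"] integral_cong_AE)
      (use m[OF f] m[OF g] assms(1) in \<open>auto elim: eventually_mono\<close>)
  then show ?thesis unfolding fourier_def by simp
qed

text \<open>On bounded frequencies the increment of the transform is (s - t) \<open>W\<close> +
  \<open>E\<close>, where \<open>W\<close> is the time derivative predicted by the equation and
  \<open>E\<close> is of smaller order in L^2 by \<open>fourier_increment_bound\<close>. The energy
  is quadratic, hence differentiable in time, with derivative twice the integral of the form paired
  with \<open>W\<close>; there the algebraic dissipation applies frequency by frequency.\<close>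

lemma fourier_energy_decay:
  fixes A :: "'n::finite \<Rightarrow> real ^ 'm ^ 'm" and H :: "real ^ 'n \<Rightarrow> complex ^ 'm \<Rightarrow> complex ^ 'm"
  assumes sol: "Cauchy_solution A0 A L u0 u" and cA: "condition_A A0 A L"
    and b: "b > 0" and c: "c > 0"
    and lin: "\<And>\<xi>. linear (H \<xi>)" and sym: "\<And>\<xi> z w. H \<xi> z \<bullet> w = z \<bullet> H \<xi> w"
    and nonneg: "\<And>\<xi> z. 0 \<le> H \<xi> z \<bullet> z" and up: "\<And>\<xi> z. norm (H \<xi> z) \<le> b * norm z"
    and dissip: "\<And>\<xi> z w. mop A0 w + gen A L \<xi> z = 0 \<Longrightarrow> H \<xi> z \<bullet> w \<le> - c * rho \<xi> * (H \<xi> z \<bullet> z)"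
    and meas: "\<And>V. V \<in> borel_measurable borel \<Longrightarrow> (\<lambda>\<xi>. H \<xi> (V \<xi>)) \<in> borel_measurable borel"
    and B: "B \<in> sets borel" "B \<subseteq> cball 0 R" "R \<ge> 0" and q: "\<And>\<xi>. \<xi> \<in> B \<Longrightarrow> q \<le> rho \<xi>" and T: "T \<ge> 0"
  shows "(\<integral>\<xi>. indicat_real B \<xi> * (H \<xi> (fourier (u T) \<xi>) \<bullet> fourier (u T) \<xi>) \<partial>lborel) \<le>
    exp (- (2 * c * q) * T) * (\<integral>\<xi>. indicat_real B \<xi> * (H \<xi> (fourier (u 0) \<xi>) \<bullet> fourier (u 0) \<xi>) \<partial>lborel)"
proof -
  have uL2: "L2_fun (u s)" if "s \<ge> 0" for s using sol that by (auto simp: Cauchy_solution_def)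
  have ucont: "((\<lambda>s. L2_norm (\<lambda>x. u s x - u t x)) \<longlongrightarrow> 0) (at t within {0..})" if "t \<ge> 0" for t
    using sol that by (auto simp: Cauchy_solution_def)
  let ?U = "\<lambda>s. fourier (u s)"
  have U: "L2_fun (?U s)" if "s \<ge> 0" for s by (rule L2_fun_fourier[OF uL2[OF that]])
  define V where "V s \<xi> = indicat_real B \<xi> *\<^sub>R ?U s \<xi>" for s \<xi>
  have V: "L2_fun (V s)" if "s \<ge> 0" for s unfolding V_def by (rule L2_fun_indicator[OF U[OF that] B(1)])
  have HL2: "L2_fun (\<lambda>\<xi>. H \<xi> (f \<xi>))" and Hn: "L2_norm (\<lambda>\<xi>. H \<xi> (f \<xi>)) \<le> b * L2_norm f" if f: "L2_fun f" for f
    using L2_fun_bound[OF f meas[OF L2_fun_measurable[OF f]] up]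
      L2_norm_le_scale[OF f meas[OF L2_fun_measurable[OF f]] up less_imp_le[OF b]] by auto
  have Hin: "\<bar>\<integral>\<xi>. H \<xi> (f \<xi>) \<bullet> g \<xi> \<partial>lborel\<bar> \<le> b * L2_norm f * L2_norm g" if "L2_fun f" "L2_fun g" for f g
    using L2_integral_inner_le[OF HL2[OF that(1)] that(2)] mult_right_mono[OF Hn[OF that(1)] L2_norm_nonneg[of g]] by linarith
  note Hint = L2_integrable_inner[OF HL2]
  define e where "e s = (\<integral>\<xi>. H \<xi> (V s \<xi>) \<bullet> V s \<xi> \<partial>lborel)" for s
  have e_eq: "e s = (\<integral>\<xi>. indicat_real B \<xi> * (H \<xi> (?U s \<xi>) \<bullet> ?U s \<xi>) \<partial>lborel)" for s
    unfolding e_def V_def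
    by (intro Bochner_Integration.integral_cong refl) (simp add: linear_scale[OF lin] indicator_def)
  have expand: "e s - e t = 2 * (\<integral>\<xi>. H \<xi> (V t \<xi>) \<bullet> (V s \<xi> - V t \<xi>) \<partial>lborel)
      + (\<integral>\<xi>. H \<xi> (V s \<xi> - V t \<xi>) \<bullet> (V s \<xi> - V t \<xi>) \<partial>lborel)" if st: "s \<ge> 0" "t \<ge> 0" for s t
  proof -
    have eq: "H \<xi> (V s \<xi>) \<bullet> V s \<xi> - H \<xi> (V t \<xi>) \<bullet> V t \<xi> =
        2 * (H \<xi> (V t \<xi>) \<bullet> (V s \<xi> - V t \<xi>)) + H \<xi> (V s \<xi> - V t \<xi>) \<bullet> (V s \<xi> - V t \<xi>)" for \<xi>
      using sym[of \<xi> "V s \<xi>" "V t \<xi>"]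
      by (simp add: linear_diff[OF lin] inner_diff_left inner_diff_right inner_commute)
    note d = L2_fun_diff[OF V[OF st(1)] V[OF st(2)]]
    have "e s - e t = (\<integral>\<xi>. H \<xi> (V s \<xi>) \<bullet> V s \<xi> - H \<xi> (V t \<xi>) \<bullet> V t \<xi> \<partial>lborel)"
      unfolding e_def using Hint[OF V[OF st(1)] V[OF st(1)]] Hint[OF V[OF st(2)] V[OF st(2)]] by simp
    also have "\<dots> = (\<integral>\<xi>. 2 * (H \<xi> (V t \<xi>) \<bullet> (V s \<xi> - V t \<xi>)) + H \<xi> (V s \<xi> - V t \<xi>) \<bullet> (V s \<xi> - V t \<xi>) \<partial>lborel)"
      unfolding eq ..
    also have "\<dots> = 2 * (\<integral>\<xi>. H \<xi> (V t \<xi>) \<bullet> (V s \<xi> - V t \<xi>) \<partial>lborel)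
        + (\<integral>\<xi>. H \<xi> (V s \<xi> - V t \<xi>) \<bullet> (V s \<xi> - V t \<xi>) \<partial>lborel)"
      by (subst Bochner_Integration.integral_add[OF integrable_mult_right[OF Hint[OF V[OF st(2)] d]] Hint[OF d d]]) simp
    finally show ?thesis .
  qed
  have Vdiff: "L2_norm (\<lambda>\<xi>. V s \<xi> - V t \<xi>) \<le> L2_norm (\<lambda>x. u s x - u t x)" if st: "s \<ge> 0" "t \<ge> 0" for s t
  proof -
    have "L2_norm (\<lambda>\<xi>. V s \<xi> - V t \<xi>) \<le> L2_norm (\<lambda>\<xi>. ?U s \<xi> - ?U t \<xi>)"
      by (rule L2_norm_mono[OF L2_fun_diff[OF U[OF st(1)] U[OF st(2)]] L2_fun_measurable[OF L2_fun_diff[OF V[OF st(1)] V[OF st(2)]]]])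
        (simp add: V_def indicator_def)
    then show ?thesis unfolding L2_norm_fourier_diff[OF uL2[OF st(1)] uL2[OF st(2)]] .
  qed
  \<comment> \<open>The derivative exists for t > 0 only, so continuity at 0 is what brings in the
    initial data.\<close>
  have cont: "continuous_on {0..} e"
    unfolding continuous_on_def
  proof
    fix t :: real assume "t \<in> {0..}"
    then have t: "t \<ge> 0" by simp
    let ?\<eta> = "\<lambda>s. L2_norm (\<lambda>x. u s x - u t x)"
    have lim: "((\<lambda>s. 2 * (b * L2_norm (V t) * ?\<eta> s) + b * ?\<eta> s * ?\<eta> s) \<longlongrightarrow> 0) (at t within {0..})"
      using tendsto_add[OF tendsto_mult[OF tendsto_const tendsto_mult[OF tendsto_const ucont[OF t]]]
          tendsto_mult[OF tendsto_mult[OF tendsto_const ucont[OF t]] ucont[OF t]], of 2 "b * L2_norm (V t)" b] by simp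
    have "norm (e s - e t) \<le> 2 * (b * L2_norm (V t) * ?\<eta> s) + b * ?\<eta> s * ?\<eta> s" if s: "s \<ge> 0" for s
    proof -
      note d = L2_fun_diff[OF V[OF s] V[OF t]]
      let ?d = "L2_norm (\<lambda>\<xi>. V s \<xi> - V t \<xi>)"
      have "norm (e s - e t) \<le> 2 * (b * L2_norm (V t) * ?d) + b * ?d * ?d"
        unfolding expand[OF s t] using Hin[OF V[OF t] d] Hin[OF d d] by (simp only: real_norm_def)
      also have "\<dots> \<le> 2 * (b * L2_norm (V t) * ?\<eta> s) + b * ?\<eta> s * ?\<eta> s"
        using Vdiff[OF s t] b by (intro add_mono mult_mono mult_left_mono) auto
      finally show ?thesis .
    qed
    then have "((\<lambda>s. e s - e t) \<longlongrightarrow> 0) (at t within {0..})"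
      by (intro Lim_null_comparison[OF _ lim]) (auto simp: eventually_at_filter)
    then show "(e \<longlongrightarrow> e t) (at t within {0..})" by (rule LIM_zero_cancel)
  qed
  have A0pos: "z \<noteq> 0 \<Longrightarrow> mop A0 z \<bullet> z > 0" for z using cA by (auto simp: condition_A_def pos_on_def cinner_inner)
  have "inj (mop A0)"
  proof (rule linear_injective_0[OF linear_mop, THEN iffD2], intro allI impI)
    fix z assume "mop A0 z = 0"
    then show "z = 0" using A0pos[of z] by auto
  qed
  \<comment> \<open>Here \<open>S\<close> denotes the inverse of the operator of \<open>A0\<close>,
    not the matrix of condition (S).\<close>
  then obtain S where S: "linear S" "\<And>z. S (mop A0 z) = z" "\<And>z. mop A0 (S z) = z"
    using linear_injective_isomorphism[OF linear_mop] by blast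
  obtain \<kappa> where \<kappa>: "\<kappa> > 0" "\<And>z. norm (S z) \<le> \<kappa> * norm z" using linear_bounded_pos[OF S(1)] by blast
  have "\<exists>a\<ge>0. (\<forall>j y. norm (A j *v y) \<le> a * norm y) \<and> (\<forall>y. norm (L *v y) \<le> a * norm y)"
  proof -
    have "\<exists>k>0. \<forall>y. norm (X *v y) \<le> k * norm y" for X :: "real ^ 'm ^ 'm"
      using bounded_linear.pos_bounded[OF matrix_vector_mul_bounded_linear[of X]] by (auto simp: mult.commute)
    then obtain k :: "real ^ 'm ^ 'm \<Rightarrow> real" where k: "\<And>X. k X > 0" "\<And>X y. norm (X *v y) \<le> k X * norm y" by metis
    let ?a = "(\<Sum>j\<in>UNIV. k (A j)) + k L"
    have nn: "(\<Sum>j\<in>UNIV. k (A j)) \<ge> 0" by (intro sum_nonneg less_imp_le k)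
    have "k (A j) \<le> ?a" for j
      using member_le_sum[of j UNIV "\<lambda>j. k (A j)"] k(1) by (simp add: less_imp_le add_increasing2)
    moreover have "k L \<le> ?a" using nn by simp
    ultimately show ?thesis
      using k(2) nn less_imp_le[OF k(1)[of L]] by (intro exI[of _ ?a] conjI allI add_nonneg_nonneg) (meson mult_right_mono norm_ge_zero order_trans)+
  qed
  then obtain a where a: "\<And>j y. norm (A j *v y) \<le> a * norm y" "\<And>y. norm (L *v y) \<le> a * norm y" "a \<ge> 0" by blast
  \<comment> \<open>The factors are the norm bound of the inverse of \<open>A0\<close>, the number
    of components summed, and the constant of \<open>fourier_increment_bound\<close>.\<close>
  define M where "M = \<kappa> * (real CARD('m) * (a * (real CARD('n) * R + 1)))"
  have M0: "M \<ge> 0" using \<kappa>(1) a(3) B(3) by (simp add: M_def)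
  have deriv: "\<exists>d. (e has_real_derivative d) (at t) \<and> d \<le> - (2 * c * q) * e t" if t: "t > 0" for t
  proof -
    have t0: "t \<ge> 0" using t by simp
    define w where "w \<xi> = S (- gen A L \<xi> (?U t \<xi>))" for \<xi>
    define W where "W \<xi> = indicat_real B \<xi> *\<^sub>R w \<xi>" for \<xi>
    \<comment> \<open>The truncation changes nothing on \<open>B\<close>, but \<open>gen\<close>
      grows with the frequency and is known to be in L^2 only after truncation.\<close>
    have W_eq: "W = (\<lambda>\<xi>. S (- (indicat_real B \<xi> *\<^sub>R trunc R (\<lambda>\<xi>. gen A L \<xi> (?U t \<xi>)) \<xi>)))"
      using B(2) by (auto simp: W_def w_def fun_eq_iff indicator_def linear_0[OF S(1)])
    have W: "L2_fun W"
      unfolding W_eq using L2_fun_scaleR[OF L2_fun_indicator[OF L2_fun_trunc_gen[OF U[OF t0]] B(1)], of "- 1"]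
      by (intro L2_linear(1)[OF S(1) _ \<kappa>(2)]) (use \<kappa>(1) in auto)
    define d0 where "d0 = 2 * (\<integral>\<xi>. H \<xi> (V t \<xi>) \<bullet> W \<xi> \<partial>lborel)"
    have d0: "d0 \<le> - (2 * c * q) * e t"
    proof -
      have "(\<integral>\<xi>. H \<xi> (V t \<xi>) \<bullet> W \<xi> \<partial>lborel) \<le> (\<integral>\<xi>. - (c * q) * (H \<xi> (V t \<xi>) \<bullet> V t \<xi>) \<partial>lborel)"
      proof (rule integral_mono[OF Hint[OF V[OF t0] W] integrable_mult_right[OF Hint[OF V[OF t0] V[OF t0]]]])
        fix \<xi>
        show "H \<xi> (V t \<xi>) \<bullet> W \<xi> \<le> - (c * q) * (H \<xi> (V t \<xi>) \<bullet> V t \<xi>)"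
        proof (cases "\<xi> \<in> B")
          case True
          have "H \<xi> (?U t \<xi>) \<bullet> w \<xi> \<le> - c * rho \<xi> * (H \<xi> (?U t \<xi>) \<bullet> ?U t \<xi>)"
            by (rule dissip) (simp add: w_def S(3))
          also have "\<dots> \<le> - (c * q) * (H \<xi> (?U t \<xi>) \<bullet> ?U t \<xi>)"
            using mult_right_mono[OF mult_left_mono[OF q[OF True] less_imp_le[OF c]] nonneg[of \<xi> "?U t \<xi>"]] by simp
          finally show ?thesis using True by (simp add: V_def W_def)
        next
          case False
          then show ?thesis by (simp add: V_def W_def)
        qed
      qed
      then show ?thesis unfolding d0_def e_def by simp
    qed
    have est: "norm ((e s - e t) / (s - t) - d0) \<le> 2 * b * L2_norm (V t) * (M * \<delta>) + b * \<bar>s - t\<bar> * (L2_norm W + M * \<delta>)\<^sup>2"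
      if s: "s \<noteq> t" and seg: "closed_segment t s \<subseteq> {0<..}"
        and \<delta>: "\<And>\<tau>. \<tau> \<in> closed_segment t s \<Longrightarrow> L2_norm (\<lambda>x. u \<tau> x - u t x) \<le> \<delta>" for s \<delta>
    proof -
      have s0: "s \<ge> 0" using seg by (auto dest: subsetD[of _ _ s])
      define D where "D \<xi> = mop A0 (?U s \<xi> - ?U t \<xi>) + (s - t) *\<^sub>R gen A L \<xi> (?U t \<xi>)" for \<xi>
      note inc = fourier_increment_bound[OF sol B(3) seg \<delta> a, folded D_def]
      define E where "E \<xi> = indicat_real B \<xi> *\<^sub>R S (D \<xi>)" for \<xi>
      have E_eq: "E = (\<lambda>\<xi>. S (indicat_real B \<xi> *\<^sub>R trunc R D \<xi>))"
        using B(2) by (auto simp: E_def fun_eq_iff indicator_def linear_0[OF S(1)])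
      have iL2: "L2_fun (\<lambda>\<xi>. indicat_real B \<xi> *\<^sub>R trunc R D \<xi>)" by (rule L2_fun_indicator[OF inc(1) B(1)])
      have E: "L2_fun E" unfolding E_eq by (rule L2_linear(1)[OF S(1) iL2 \<kappa>(2)]) (use \<kappa>(1) in simp)
      have En: "L2_norm E \<le> \<bar>s - t\<bar> * (M * \<delta>)"
      proof -
        have "L2_norm E \<le> \<kappa> * L2_norm (\<lambda>\<xi>. indicat_real B \<xi> *\<^sub>R trunc R D \<xi>)"
          unfolding E_eq by (rule L2_linear(2)[OF S(1) iL2 \<kappa>(2)]) (use \<kappa>(1) in simp)
        also have "L2_norm (\<lambda>\<xi>. indicat_real B \<xi> *\<^sub>R trunc R D \<xi>) \<le> L2_norm (trunc R D)"
        proof -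
          have le: "norm (indicat_real B \<xi> *\<^sub>R trunc R D \<xi>) \<le> 1 * norm (trunc R D \<xi>)" for \<xi>
            by (cases "\<xi> \<in> B") simp_all
          show ?thesis using L2_norm_le_scale[OF inc(1) L2_fun_measurable[OF iL2] le] \<kappa>(1) by simp
        qed
        also have "\<dots> \<le> (\<Sum>i\<in>UNIV. L2_norm (\<lambda>\<xi>. trunc R D \<xi> $ i))" by (rule L2_norm_le_sum_nth[OF inc(1)])
        also have "\<dots> \<le> (\<Sum>i::'m\<in>UNIV. \<bar>s - t\<bar> * (a * \<delta> * (real CARD('n) * R + 1)))" by (intro sum_mono inc(2))
        finally show ?thesis using \<kappa>(1) by (simp add: M_def ac_simps)
      qed
      have Vd: "V s \<xi> - V t \<xi> = (s - t) *\<^sub>R W \<xi> + E \<xi>" for \<xi>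
      proof -
        have "S (D \<xi>) = (?U s \<xi> - ?U t \<xi>) + (s - t) *\<^sub>R S (gen A L \<xi> (?U t \<xi>))"
          unfolding D_def linear_add[OF S(1)] linear_scale[OF S(1)] S(2) ..
        then have "(s - t) *\<^sub>R w \<xi> + S (D \<xi>) = ?U s \<xi> - ?U t \<xi>"
          unfolding w_def linear_neg[OF S(1)] by simp
        from arg_cong[OF this, of "\<lambda>z. indicat_real B \<xi> *\<^sub>R z"] show ?thesis
          unfolding V_def W_def E_def by (simp add: scaleR_add_right scaleR_diff_right mult.commute)
      qed
      have sW: "L2_fun (\<lambda>\<xi>. (s - t) *\<^sub>R W \<xi>)" by (rule L2_fun_scaleR[OF W])
      have d: "L2_fun (\<lambda>\<xi>. (s - t) *\<^sub>R W \<xi> + E \<xi>)" by (rule L2_fun_add[OF sW E])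
      have "e s - e t - (s - t) * d0 = 2 * (\<integral>\<xi>. H \<xi> (V t \<xi>) \<bullet> E \<xi> \<partial>lborel)
          + (\<integral>\<xi>. H \<xi> ((s - t) *\<^sub>R W \<xi> + E \<xi>) \<bullet> ((s - t) *\<^sub>R W \<xi> + E \<xi>) \<partial>lborel)"
      proof -
        have "(\<integral>\<xi>. H \<xi> (V t \<xi>) \<bullet> ((s - t) *\<^sub>R W \<xi> + E \<xi>) \<partial>lborel) =
            (s - t) * (\<integral>\<xi>. H \<xi> (V t \<xi>) \<bullet> W \<xi> \<partial>lborel) + (\<integral>\<xi>. H \<xi> (V t \<xi>) \<bullet> E \<xi> \<partial>lborel)"
          using Hint[OF V[OF t0] W] Hint[OF V[OF t0] E] by (simp add: inner_add_right)
        then show ?thesis unfolding expand[OF s0 t0] Vd d0_def by (simp add: algebra_simps)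
      qed
      also have "norm \<dots> \<le> 2 * (b * L2_norm (V t) * L2_norm E) + b * L2_norm (\<lambda>\<xi>. (s - t) *\<^sub>R W \<xi> + E \<xi>) * L2_norm (\<lambda>\<xi>. (s - t) *\<^sub>R W \<xi> + E \<xi>)"
        using Hin[OF V[OF t0] E] Hin[OF d d] by (simp only: real_norm_def)
      also have "\<dots> \<le> 2 * (b * L2_norm (V t) * (\<bar>s - t\<bar> * (M * \<delta>)))
          + b * (\<bar>s - t\<bar> * (L2_norm W + M * \<delta>)) * (\<bar>s - t\<bar> * (L2_norm W + M * \<delta>))"
      proof -
        have dn: "L2_norm (\<lambda>\<xi>. (s - t) *\<^sub>R W \<xi> + E \<xi>) \<le> \<bar>s - t\<bar> * (L2_norm W + M * \<delta>)"
          using L2_norm_triangle[OF sW E] En unfolding L2_norm_scaleR by (simp add: distrib_left)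
        have 1: "b * L2_norm (V t) * L2_norm E \<le> b * L2_norm (V t) * (\<bar>s - t\<bar> * (M * \<delta>))"
          using En b by (intro mult_left_mono) auto
        have 2: "b * L2_norm (\<lambda>\<xi>. (s - t) *\<^sub>R W \<xi> + E \<xi>) * L2_norm (\<lambda>\<xi>. (s - t) *\<^sub>R W \<xi> + E \<xi>)
            \<le> b * (\<bar>s - t\<bar> * (L2_norm W + M * \<delta>)) * (\<bar>s - t\<bar> * (L2_norm W + M * \<delta>))"
          using dn b order_trans[OF L2_norm_nonneg dn] by (intro mult_mono mult_left_mono) auto
        show ?thesis using 1 2 by linarith
      qed
      also have "\<dots> = \<bar>s - t\<bar> * (2 * b * L2_norm (V t) * (M * \<delta>) + b * \<bar>s - t\<bar> * (L2_norm W + M * \<delta>)\<^sup>2)"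
        by (simp add: power2_eq_square algebra_simps)
      finally have fin: "norm (e s - e t - (s - t) * d0) \<le>
          \<bar>s - t\<bar> * (2 * b * L2_norm (V t) * (M * \<delta>) + b * \<bar>s - t\<bar> * (L2_norm W + M * \<delta>)\<^sup>2)" .
      have "(e s - e t) / (s - t) - d0 = (e s - e t - (s - t) * d0) / (s - t)" using s by (simp add: field_simps)
      then have "norm ((e s - e t) / (s - t) - d0) = norm (e s - e t - (s - t) * d0) / \<bar>s - t\<bar>" by simp
      also have "\<dots> \<le> 2 * b * L2_norm (V t) * (M * \<delta>) + b * \<bar>s - t\<bar> * (L2_norm W + M * \<delta>)\<^sup>2"
        using fin s by (simp add: pos_divide_le_eq mult.commute)
      finally show ?thesis .
    qed
    have "((\<lambda>s. (e s - e t) / (s - t)) \<longlongrightarrow> d0) (at t)"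
    proof (rule LIM_I)
      fix \<epsilon> :: real assume \<epsilon>: "\<epsilon> > 0"
      \<comment> \<open>It collects the coefficients of both error terms; the added 1 makes division
        by \<open>K\<close> possible.\<close>
      define K where "K = 2 * b * L2_norm (V t) * M + b * (L2_norm W + M)\<^sup>2 + 1"
      have K1: "K \<ge> 1" using b M0 by (simp add: K_def)
      define \<delta> where "\<delta> = min 1 (\<epsilon> / (4 * K))"
      have \<delta>0: "\<delta> > 0" "\<delta> \<le> 1" "K * \<delta> \<le> \<epsilon> / 4" using \<epsilon> K1 by (auto simp: \<delta>_def min_def field_simps)
      have "\<forall>\<^sub>F s in at t within {0..}. L2_norm (\<lambda>x. u s x - u t x) < \<delta>"
        using order_tendstoD(2)[OF ucont[OF t0] \<delta>0(1)] .
      then obtain r where r: "r > 0" "\<And>s. s \<ge> 0 \<Longrightarrow> s \<noteq> t \<Longrightarrow> dist s t < r \<Longrightarrow> L2_norm (\<lambda>x. u s x - u t x) < \<delta>"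
        unfolding eventually_at by auto
      \<comment> \<open>The three bounds ensure that u varies by at most \<open>\<delta>\<close>
        along the segment, that the segment stays in positive times, and that |s - t| <=
        \<open>\<delta>\<close>.\<close>
      define r' where "r' = min (min r t) \<delta>"
      have r': "r' > 0" using r t \<delta>0 by (simp add: r'_def)
      have "norm ((e s - e t) / (s - t) - d0) < \<epsilon>" if s: "s \<noteq> t" "norm (s - t) < r'" for s
      proof -
        have near: "\<bar>\<tau> - t\<bar> \<le> \<bar>s - t\<bar>" if "\<tau> \<in> closed_segment t s" for \<tau>
          using that by (auto simp: closed_segment_eq_real_ivl split: if_splits)
        have seg: "closed_segment t s \<subseteq> {0<..}"
        proof
          fix \<tau> assume "\<tau> \<in> closed_segment t s"
          from near[OF this] s show "\<tau> \<in> {0<..}" by (auto simp: r'_def)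
        qed
        have small: "L2_norm (\<lambda>x. u \<tau> x - u t x) \<le> \<delta>" if \<tau>: "\<tau> \<in> closed_segment t s" for \<tau>
        proof (cases "\<tau> = t")
          case True
          then show ?thesis using \<delta>0 by (simp add: L2_norm_def)
        next
          case False
          have "\<tau> \<ge> 0" using seg \<tau> by auto
          then show ?thesis using r(2)[OF _ False] near[OF \<tau>] s by (auto simp: r'_def dist_real_def less_imp_le)
        qed
        have "norm ((e s - e t) / (s - t) - d0) \<le> 2 * b * L2_norm (V t) * (M * \<delta>) + b * \<bar>s - t\<bar> * (L2_norm W + M * \<delta>)\<^sup>2"
          by (rule est[OF s(1) seg small])
        also have "\<dots> \<le> 2 * b * L2_norm (V t) * M * \<delta> + b * (L2_norm W + M)\<^sup>2 * \<delta>"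
        proof -
          have "M * \<delta> \<le> M" using M0 \<delta>0 by (simp add: mult_left_le)
          then have "(L2_norm W + M * \<delta>)\<^sup>2 \<le> (L2_norm W + M)\<^sup>2" using M0 \<delta>0 by (intro power_mono) auto
          moreover have "\<bar>s - t\<bar> \<le> \<delta>" using s by (simp add: r'_def)
          ultimately have "b * \<bar>s - t\<bar> * (L2_norm W + M * \<delta>)\<^sup>2 \<le> b * \<delta> * (L2_norm W + M)\<^sup>2"
            using b \<delta>0 by (intro mult_mono mult_left_mono) auto
          then show ?thesis by (simp add: ac_simps)
        qed
        also have "\<dots> \<le> K * \<delta>" using \<delta>0 by (simp add: K_def algebra_simps)
        also have "\<dots> < \<epsilon>" using \<delta>0 \<epsilon> by simp
        finally show ?thesis .
      qed
      with r' show "\<exists>r>0. \<forall>s. s \<noteq> t \<and> norm (s - t) < r \<longrightarrow> norm ((e s - e t) / (s - t) - d0) < \<epsilon>" by blast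
    qed
    then have "(e has_real_derivative d0) (at t)" by (simp add: has_field_derivative_iff)
    with d0 show ?thesis by blast
  qed
  have "e T \<le> exp (- (2 * c * q) * T) * e 0"
    by (rule exp_decay[OF T continuous_on_subset[OF cont] deriv]) auto
  then show ?thesis unfolding e_eq .
qed

lemma norm_le_of_energy:
  fixes a b p q y :: real
  assumes a: "a > 0" and b: "b > 0" and p: "a * (norm x)\<^sup>2 \<le> p" and pq: "p \<le> exp (- (2 * y)) * q" and q: "q \<le> b * (norm z)\<^sup>2"
  shows "norm x \<le> sqrt (b / a) * exp (- y) * norm z"
proof (rule power2_le_imp_le)
  have "a * (norm x)\<^sup>2 \<le> exp (- (2 * y)) * (b * (norm z)\<^sup>2)"
    by (rule order_trans[OF p order_trans[OF pq mult_left_mono[OF q exp_ge_zero]]])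
  then have "(norm x)\<^sup>2 \<le> exp (- (2 * y)) * (b * (norm z)\<^sup>2) / a"
    using a by (simp add: pos_le_divide_eq mult.commute)
  also have "\<dots> = (sqrt (b / a) * exp (- y) * norm z)\<^sup>2"
    unfolding exp_double[of "- y", simplified] using a b by (simp add: power_mult_distrib)
  finally show "(norm x)\<^sup>2 \<le> (sqrt (b / a) * exp (- y) * norm z)\<^sup>2" .
qed (use a b in simp)

lemma rho_measurable: "rho \<in> borel_measurable borel"
  unfolding rho_def[abs_def] by measurable

text \<open>The integrated decay holds for every bounded Borel set on which \<open>rho\<close> is at
  least \<open>q\<close>, in particular for the set where the pointwise bound with rate
  \<open>q\<close> fails; that set must be null. Rational rates and integer radii leave countably
  many null sets.\<close>

lemma fourier_pointwise_decay:
  fixes A :: "'n::finite \<Rightarrow> real ^ 'm ^ 'm" and H :: "real ^ 'n \<Rightarrow> complex ^ 'm \<Rightarrow> complex ^ 'm"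
  assumes sol: "Cauchy_solution A0 A L u0 u" and u0: "L2_fun u0" and cA: "condition_A A0 A L"
    and a: "a > 0" and b: "b > 0" and c: "c > 0"
    and lin: "\<And>\<xi>. linear (H \<xi>)" and sym: "\<And>\<xi> z w. H \<xi> z \<bullet> w = z \<bullet> H \<xi> w"
    and low: "\<And>\<xi> z. a * (norm z)\<^sup>2 \<le> H \<xi> z \<bullet> z" and up: "\<And>\<xi> z. norm (H \<xi> z) \<le> b * norm z"
    and dissip: "\<And>\<xi> z w. mop A0 w + gen A L \<xi> z = 0 \<Longrightarrow> H \<xi> z \<bullet> w \<le> - c * rho \<xi> * (H \<xi> z \<bullet> z)"
    and meas: "\<And>V. V \<in> borel_measurable borel \<Longrightarrow> (\<lambda>\<xi>. H \<xi> (V \<xi>)) \<in> borel_measurable borel"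
    and T: "T \<ge> 0"
  shows "AE \<xi> in lborel. norm (fourier (u T) \<xi>) \<le> sqrt (b / a) * exp (- c * rho \<xi> * T) * norm (fourier u0 \<xi>)"
proof -
  have uL2: "L2_fun (u s)" if "s \<ge> 0" for s using sol that by (auto simp: Cauchy_solution_def)
  have U0: "fourier (u 0) = fourier u0"
    by (rule fourier_cong_AE[OF _ uL2 u0]) (use sol in \<open>auto simp: Cauchy_solution_def\<close>)
  let ?U = "\<lambda>s. fourier (u s)"
  have U: "L2_fun (?U s)" if "s \<ge> 0" for s by (rule L2_fun_fourier[OF uL2[OF that]])
  have nonneg: "0 \<le> H \<xi> z \<bullet> z" for \<xi> z
    by (rule order_trans[OF _ low]) (use a in simp)
  define f where "f s \<xi> = H \<xi> (?U s \<xi>) \<bullet> ?U s \<xi>" for s \<xi>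
  have HU: "L2_fun (\<lambda>\<xi>. H \<xi> (?U s \<xi>))" if "s \<ge> 0" for s
    by (rule L2_fun_bound[OF U[OF that] meas[OF L2_fun_measurable[OF U[OF that]]] up])
  have f: "integrable lborel (f s)" if "s \<ge> 0" for s
    unfolding f_def by (rule L2_integrable_inner[OF HU[OF that] U[OF that]])
  have fm [measurable]: "f T \<in> borel_measurable borel" "f 0 \<in> borel_measurable borel"
    using borel_measurable_integrable[OF f[OF T]] borel_measurable_integrable[OF f[of 0]] by auto
  note rho_measurable [measurable]
  have slab: "AE \<xi> in lborel. norm \<xi> \<le> R \<longrightarrow> q \<le> rho \<xi> \<longrightarrow> f T \<xi> \<le> exp (- (2 * c * q) * T) * f 0 \<xi>" if R: "R \<ge> 0" for q R
  proof -
    let ?\<kappa> = "exp (- (2 * c * q) * T)"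
    \<comment> \<open>On this set the integrand f T - exp(..) f 0 is positive, whereas the energy
      estimate gives it an integral of at most 0.\<close>
    define B where "B = {\<xi> :: real ^ 'n. norm \<xi> \<le> R \<and> q \<le> rho \<xi> \<and> ?\<kappa> * f 0 \<xi> < f T \<xi>}"
    have B: "B \<in> sets borel" unfolding B_def by measurable
    have i: "integrable lborel (\<lambda>\<xi>. indicat_real B \<xi> * f s \<xi>)" if "s \<ge> 0" for s
      using integrable_mult_indicator[of B lborel "f s"] B f[OF that] by simp
    have E: "(\<integral>\<xi>. indicat_real B \<xi> * f T \<xi> \<partial>lborel) \<le> ?\<kappa> * (\<integral>\<xi>. indicat_real B \<xi> * f 0 \<xi> \<partial>lborel)"
      unfolding f_def
      by (rule fourier_energy_decay[OF sol cA b c lin sym nonneg up dissip meas B _ R _ T]) (auto simp: B_def)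
    have split: "indicat_real B \<xi> * (f T \<xi> - ?\<kappa> * f 0 \<xi>) = indicat_real B \<xi> * f T \<xi> - ?\<kappa> * (indicat_real B \<xi> * f 0 \<xi>)" for \<xi>
      by (simp only: right_diff_distrib mult.left_commute)
    note i' = i[OF T] integrable_mult_right[OF i[of 0], of ?\<kappa>]
    from E have le: "(\<integral>\<xi>. indicat_real B \<xi> * (f T \<xi> - ?\<kappa> * f 0 \<xi>) \<partial>lborel) \<le> 0"
      unfolding split Bochner_Integration.integral_diff[OF i'(1) i'(2)[OF order_refl]] by simp
    have nn: "0 \<le> indicat_real B \<xi> * (f T \<xi> - ?\<kappa> * f 0 \<xi>)" for \<xi> by (auto simp: B_def indicator_def)
    have int: "integrable lborel (\<lambda>\<xi>. indicat_real B \<xi> * (f T \<xi> - ?\<kappa> * f 0 \<xi>))"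
      unfolding split by (rule Bochner_Integration.integrable_diff[OF i'(1) i'(2)[OF order_refl]])
    have "(\<integral>\<xi>. indicat_real B \<xi> * (f T \<xi> - ?\<kappa> * f 0 \<xi>) \<partial>lborel) = 0"
      by (rule antisym[OF le Bochner_Integration.integral_nonneg]) (rule nn)
    then have "AE \<xi> in lborel. indicat_real B \<xi> * (f T \<xi> - ?\<kappa> * f 0 \<xi>) = 0"
      using integral_nonneg_eq_0_iff_AE[OF int] nn by simp
    then show ?thesis
      by eventually_elim (auto simp: B_def indicator_def split: if_splits)
  qed
  have "AE \<xi> in lborel. \<forall>q\<in>\<rat>. norm \<xi> \<le> real R \<longrightarrow> q \<le> rho \<xi> \<longrightarrow> f T \<xi> \<le> exp (- (2 * c * q) * T) * f 0 \<xi>" for R :: nat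
    by (subst AE_ball_countable[OF countable_rat]) (intro ballI slab, simp)
  then have "AE \<xi> in lborel. \<forall>R::nat. \<forall>q\<in>\<rat>. norm \<xi> \<le> real R \<longrightarrow> q \<le> rho \<xi> \<longrightarrow> f T \<xi> \<le> exp (- (2 * c * q) * T) * f 0 \<xi>"
    by (intro AE_all_countable[THEN iffD2] allI)
  then show ?thesis
  proof eventually_elim
    case (elim \<xi>)
    obtain R :: nat where R: "norm \<xi> \<le> real R" using real_arch_simple by blast
    have q: "f T \<xi> \<le> exp (- (2 * c * q) * T) * f 0 \<xi>" if "q \<in> \<rat>" "q \<le> rho \<xi>" for q
      using elim R that by blast
    \<comment> \<open>\<open>rho \<xi>\<close> need not be rational; the bound is carried to it by
      rational rates increasing to it.\<close>
    have "f T \<xi> \<le> exp (- (2 * c * rho \<xi>) * T) * f 0 \<xi>"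
    proof (rule ccontr)
      assume "\<not> ?thesis"
      moreover have "((\<lambda>q. exp (- (2 * c * q) * T) * f 0 \<xi>) \<longlongrightarrow> exp (- (2 * c * rho \<xi>) * T) * f 0 \<xi>) (at_left (rho \<xi>))"
        by (intro tendsto_intros)
      ultimately have "\<forall>\<^sub>F q in at_left (rho \<xi>). exp (- (2 * c * q) * T) * f 0 \<xi> < f T \<xi>"
        by (intro order_tendstoD(2)) auto
      then obtain l where l: "l < rho \<xi>" "\<And>q. l < q \<Longrightarrow> q < rho \<xi> \<Longrightarrow> exp (- (2 * c * q) * T) * f 0 \<xi> < f T \<xi>"
        using eventually_at_left[of "rho \<xi> - 1" "rho \<xi>"] by auto
      obtain r where "r \<in> \<rat>" "l < r" "r < rho \<xi>" using Rats_dense_in_real[OF l(1)] by blast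
      then show False using l(2)[of r] q[of r] by simp
    qed
    moreover have "f 0 \<xi> \<le> b * (norm (fourier u0 \<xi>))\<^sup>2"
    proof -
      have "f 0 \<xi> \<le> norm (H \<xi> (fourier u0 \<xi>)) * norm (fourier u0 \<xi>)"
        unfolding f_def U0 by (rule norm_cauchy_schwarz)
      also have "\<dots> \<le> b * norm (fourier u0 \<xi>) * norm (fourier u0 \<xi>)" by (intro mult_right_mono up) simp
      finally show ?thesis by (simp add: power2_eq_square)
    qed
    ultimately have "norm (?U T \<xi>) \<le> sqrt (b / a) * exp (- (c * rho \<xi> * T)) * norm (fourier u0 \<xi>)"
      using low[of "?U T \<xi>" \<xi>] by (intro norm_le_of_energy[OF a b, where p="f T \<xi>" and q="f 0 \<xi>"]) (auto simp: f_def mult.assoc)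
    then show ?case by simp
  qed
qed

section \<open>Decay of derivatives\<close>

lemma power_le_fact_exp:
  fixes x :: real
  assumes "x \<ge> 0" shows "x ^ k \<le> fact k * exp x"
proof -
  have "sum (\<lambda>n. x ^ n /\<^sub>R fact n) {k} \<le> (\<Sum>n. x ^ n /\<^sub>R fact n)"
    using assms by (intro sum_le_suminf summable_exp_generic) auto
  then have "x ^ k / fact k \<le> exp x" by (simp add: exp_def divide_inverse mult.commute)
  then show ?thesis by (simp add: pos_divide_le_eq mult.commute)
qed

definition gauss_moment :: "nat \<Rightarrow> real \<Rightarrow> real ^ 'n \<Rightarrow> real" where
  "gauss_moment k c \<xi> = norm \<xi> ^ (2 * k) * exp (- c * (norm \<xi>)\<^sup>2)"

lemma gauss_moment_measurable [measurable]: "gauss_moment k c \<in> borel_measurable borel"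
  unfolding gauss_moment_def[abs_def] by measurable

text \<open>Half of the exponent absorbs the power of the norm through
  \<open>power_le_fact_exp\<close>, and the other half is still a Gaussian.\<close>

lemma gauss_moment_integrable:
  assumes c: "c > 0"
  shows "integrable lborel (gauss_moment k c :: real ^ 'n \<Rightarrow> real)"
proof (rule Bochner_Integration.integrable_bound)
  let ?K = "(2 / c) ^ k * fact k"
  show "integrable lborel (\<lambda>\<xi>::real ^ 'n. ?K * gauss (sqrt c *\<^sub>R \<xi>))"
    using lborel_integrable_affine[OF gauss_integrable, of "sqrt c" 0] c by (intro integrable_mult_right) simp
  have "norm (gauss_moment k c \<xi>) \<le> ?K * gauss (sqrt c *\<^sub>R \<xi>)" for \<xi> :: "real ^ 'n"
  proof -
    let ?y = "c * (norm \<xi>)\<^sup>2 / 2"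
    have "norm \<xi> ^ (2 * k) = (2 / c) ^ k * ?y ^ k"
      using c by (simp add: power_mult power_mult_distrib[symmetric])
    also have "\<dots> \<le> (2 / c) ^ k * (fact k * exp ?y)"
      using c by (intro mult_left_mono power_le_fact_exp) auto
    finally have "norm \<xi> ^ (2 * k) * exp (- c * (norm \<xi>)\<^sup>2) \<le> (2 / c) ^ k * (fact k * exp ?y) * exp (- c * (norm \<xi>)\<^sup>2)"
      by (intro mult_right_mono) auto
    also have "\<dots> = ?K * (exp ?y * exp (- c * (norm \<xi>)\<^sup>2))" by simp
    also have "exp ?y * exp (- c * (norm \<xi>)\<^sup>2) = gauss (sqrt c *\<^sub>R \<xi>)"
      using c by (simp add: gauss_def exp_add[symmetric] power_mult_distrib)
    finally show ?thesis by (simp add: gauss_moment_def)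
  qed
  then show "AE \<xi> in lborel. norm (gauss_moment k c (\<xi> :: real ^ 'n)) \<le> norm (?K * gauss (sqrt c *\<^sub>R \<xi>))"
    using c by (intro AE_I2) (simp add: abs_mult abs_of_pos[OF gauss_bounds(1)])
qed measurable

text \<open>Under the scaling by the square root of \<open>r\<close> the volume contributes n/2 and
  the power \<open>k\<close> to the exponent. With \<open>r\<close> = 1 + t this is the source of
  the algebraic decay rate.\<close>

lemma gauss_moment_scaled:
  assumes c: "c > 0" and r: "r > 0"
  shows "integral\<^sup>L lborel (gauss_moment k (c * r) :: real ^ 'n \<Rightarrow> real) =
    r powr (- real CARD('n) / 2 - real k) * integral\<^sup>L lborel (gauss_moment k c :: real ^ 'n \<Rightarrow> real)"
proof -
  let ?s = "sqrt r" and ?n = "CARD('n)"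
  have s: "?s > 0" using r by simp
  have "gauss_moment k c (0 + ?s *\<^sub>R \<xi>) = ?s ^ (2 * k) * gauss_moment k (c * r) \<xi>" for \<xi> :: "real ^ 'n"
    using r by (simp add: gauss_moment_def power_mult_distrib mult.assoc)
  then have "integral\<^sup>L lborel (gauss_moment k c :: real ^ 'n \<Rightarrow> real) =
      ?s ^ ?n * (?s ^ (2 * k) * integral\<^sup>L lborel (gauss_moment k (c * r) :: real ^ 'n \<Rightarrow> real))"
    using lborel_integral_affine[of "gauss_moment k c :: real ^ 'n \<Rightarrow> real" ?s 0] s by simp
  moreover have "?s ^ ?n * ?s ^ (2 * k) = r powr (real ?n / 2 + real k)"
    using r by (simp add: powr_half_sqrt[symmetric] powr_power power_add[symmetric] add_divide_distrib powr_add[symmetric])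
  ultimately have "integral\<^sup>L lborel (gauss_moment k c :: real ^ 'n \<Rightarrow> real) =
      r powr (real ?n / 2 + real k) * integral\<^sup>L lborel (gauss_moment k (c * r) :: real ^ 'n \<Rightarrow> real)"
    by (simp add: mult.assoc[symmetric])
  moreover have "r powr (- real ?n / 2 - real k) * r powr (real ?n / 2 + real k) = 1"
    using r by (simp add: powr_add[symmetric])
  ultimately show ?thesis by (simp add: mult.assoc[symmetric])
qed

lemma norm_smult_vec: "norm (c *s v) = norm c * norm v" for v :: "complex ^ 'm"
  by (simp add: norm_vec_def norm_mult L2_set_right_distrib)

lemma norm_fourier_weak_deriv:
  assumes f: "L2_fun f" and h: "L2_fun h" and weak: "is_weak_deriv js f h"
  shows "AE \<xi> in lborel. norm (fourier h \<xi>) = norm (mon js \<xi>) * norm (fourier f \<xi>)"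
proof -
  have "AE \<xi> in lborel. \<forall>i\<in>UNIV. fourier h \<xi> $ i = (- 1) ^ length js * mon js \<xi> * fourier f \<xi> $ i"
    by (intro AE_finite_all[THEN iffD2] ballI weak_deriv_fourier[OF f h weak]) simp
  then show ?thesis
  proof eventually_elim
    case (elim \<xi>)
    then have "fourier h \<xi> = ((- 1) ^ length js * mon js \<xi>) *s fourier f \<xi>" by (simp add: vec_eq_iff)
    then show ?case by (simp add: norm_smult_vec norm_mult norm_power)
  qed
qed

lemma norm_fourier_L1_le:
  fixes f :: "real ^ 'n \<Rightarrow> real ^ 'm"
  shows "norm (fourier_L1 f \<xi>) \<le> (2 * pi) powr (- real CARD('n) / 2) * L1_norm f"
proof -
  have "norm (exp (- \<i> * complex_of_real (x \<bullet> \<xi>)) *s cvec (f x)) = norm (f x)" for x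
    by (simp add: norm_smult_vec) (simp add: norm_vec_def L2_set_def)
  then have "norm (\<integral>x. exp (- \<i> * complex_of_real (x \<bullet> \<xi>)) *s cvec (f x) \<partial>lborel) \<le> L1_norm f"
    using integral_norm_bound[of lborel "\<lambda>x. exp (- \<i> * complex_of_real (x \<bullet> \<xi>)) *s cvec (f x)"]
    by (simp add: L1_norm_def)
  then show ?thesis unfolding fourier_L1_def norm_scaleR by (simp add: mult_left_mono)
qed

lemma L2_fun_bound_AE:
  assumes f: "L2_fun f" and [measurable]: "g \<in> borel_measurable borel"
    and le: "AE x in lborel. norm (g x) \<le> C * norm (f x)"
  shows "L2_fun g"
  unfolding L2_fun_def
proof
  show "integrable lborel (\<lambda>x. (norm (g x))\<^sup>2)"
  proof (rule Bochner_Integration.integrable_bound)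
    show "integrable lborel (\<lambda>x. C\<^sup>2 * (norm (f x))\<^sup>2)"
      using L2_fun_square_integrable[OF f] by simp
    show "AE x in lborel. norm ((norm (g x))\<^sup>2) \<le> norm (C\<^sup>2 * (norm (f x))\<^sup>2)"
      using le
    proof eventually_elim
      case (elim x)
      have "(norm (g x))\<^sup>2 \<le> (C * norm (f x))\<^sup>2" by (intro power_mono elim) simp
      then show ?case by (simp add: power_mult_distrib)
    qed
  qed simp
qed simp

lemma rho_bounds: "norm \<xi> \<le> 1 \<Longrightarrow> (norm \<xi>)\<^sup>2 / 2 \<le> rho \<xi>" "norm \<xi> \<ge> 1 \<Longrightarrow> 1 / 2 \<le> rho \<xi>" "0 \<le> rho \<xi>"
proof -
  have pos: "1 + (norm \<xi>)\<^sup>2 > 0" by (simp add: add_pos_nonneg)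
  show "0 \<le> rho \<xi>" by (simp add: rho_def)
  show "(norm \<xi>)\<^sup>2 / 2 \<le> rho \<xi>" if "norm \<xi> \<le> 1"
    unfolding rho_def using pos power_le_one[OF norm_ge_zero that, of 2] by (intro divide_left_mono) auto
  show "1 / 2 \<le> rho \<xi>" if "norm \<xi> \<ge> 1"
    unfolding rho_def using pos one_le_power[OF that, of 2] by (simp add: field_simps)
qed

text \<open>Existence rests on \<open>weak_deriv_exists\<close>: since the decay factor is at most
  1, the transform of v times the monomial is dominated by that of the derivative \<open>h0\<close>
  of the data. The quantitative bound is stated for any representative \<open>h\<close>, because
  \<open>weak_deriv\<close> is a choice.\<close>

lemma weak_deriv_decay:
  fixes u0 v :: "real ^ 'n \<Rightarrow> real ^ 'm"
  assumes u0: "L2_fun u0" and u01: "integrable lborel u0" and v: "L2_fun v"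
    and h0: "L2_fun h0" "is_weak_deriv js u0 h0"
    and C: "C > 0" and c: "c > 0" and t: "t \<ge> 0"
    and decay: "AE \<xi> in lborel. norm (fourier v \<xi>) \<le> C * exp (- c * rho \<xi> * t) * norm (fourier u0 \<xi>)"
  shows "\<exists>h. L2_fun h \<and> is_weak_deriv js v h"
    and "L2_fun h \<Longrightarrow> is_weak_deriv js v h \<Longrightarrow> (L2_norm h)\<^sup>2 \<le>
      C\<^sup>2 * ((2 * pi) powr (- real CARD('n) / 2) * L1_norm u0)\<^sup>2 * (exp c *
        ((1 + t) powr (- real CARD('n) / 2 - real (length js)) * integral\<^sup>L lborel (gauss_moment (length js) c :: real ^ 'n \<Rightarrow> real)))
      + C\<^sup>2 * exp (- c * t) * (L2_norm h0)\<^sup>2"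
proof -
  let ?k = "length js"
  note Fh0 = norm_fourier_weak_deriv[OF u0 h0]
  note Fv = L2_fun_fourier[OF v]
  have mv: "AE \<xi> in lborel. norm (mon js \<xi>) * norm (fourier v \<xi>) \<le> C * norm (fourier h0 \<xi>)"
    using decay Fh0
  proof eventually_elim
    case (elim \<xi>)
    have "exp (- c * rho \<xi> * t) \<le> 1" using c t rho_bounds(3)[of \<xi>] by simp
    then have "C * exp (- c * rho \<xi> * t) * norm (fourier u0 \<xi>) \<le> C * 1 * norm (fourier u0 \<xi>)"
      using C by (intro mult_right_mono mult_left_mono) auto
    then have "norm (fourier v \<xi>) \<le> C * norm (fourier u0 \<xi>)" using elim(1) by simp
    from mult_left_mono[OF this norm_ge_zero[of "mon js \<xi>"]] show ?case using elim(2) by (simp add: ac_simps)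
  qed
  show "\<exists>h. L2_fun h \<and> is_weak_deriv js v h"
  proof (rule weak_deriv_exists[OF v])
    fix i
    note [measurable] = L2_fun_measurable[OF L2_fun_nth[OF Fv, of i]]
    show "L2_fun (\<lambda>\<xi>. mon js \<xi> * fourier v \<xi> $ i)"
    proof (rule L2_fun_bound_AE[OF L2_fun_fourier[OF h0(1)]])
      show "AE \<xi> in lborel. norm (mon js \<xi> * fourier v \<xi> $ i) \<le> C * norm (fourier h0 \<xi>)"
        using mv
      proof eventually_elim
        case (elim \<xi>)
        have "norm (mon js \<xi> * fourier v \<xi> $ i) \<le> norm (mon js \<xi>) * norm (fourier v \<xi>)"
          unfolding norm_mult by (intro mult_left_mono Finite_Cartesian_Product.norm_nth_le norm_ge_zero)
        then show ?case using elim by linarith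
      qed
    qed measurable
  qed
  let ?Y = "(2 * pi) powr (- real CARD('n) / 2) * L1_norm u0"
  \<comment> \<open>For |xi| <= 1 the factor \<open>exp c\<close> pays for replacing t by 1 + t in
    the Gaussian. This keeps the low-frequency bound finite at t = 0.\<close>
  let ?w = "\<lambda>\<xi> :: real ^ 'n. exp c * gauss_moment ?k (c * (1 + t)) \<xi>"
  have ct: "c * (1 + t) > 0" using c t by simp
  have wint: "integrable lborel ?w" by (intro integrable_mult_right gauss_moment_integrable[OF ct])
  assume h: "L2_fun h" "is_weak_deriv js v h"
  note Fh = norm_fourier_weak_deriv[OF v h]
  have u0Y: "AE \<xi> in lborel. norm (fourier u0 \<xi>) \<le> ?Y"
    using fourier_eq_fourier_L1[OF u0 u01] by eventually_elim (simp only: norm_fourier_L1_le)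
  have pt: "AE \<xi> in lborel. (norm (fourier h \<xi>))\<^sup>2 \<le> C\<^sup>2 * ?Y\<^sup>2 * ?w \<xi> + C\<^sup>2 * exp (- c * t) * (norm (fourier h0 \<xi>))\<^sup>2"
    using Fh Fh0 decay u0Y
  proof eventually_elim
    case (elim \<xi>)
    let ?m = "norm (mon js \<xi>)" and ?y = "norm (fourier u0 \<xi>)" and ?x = "norm \<xi>"
    have w0: "?w \<xi> \<ge> 0" by (simp add: gauss_moment_def)
    have "norm (fourier h \<xi>) \<le> ?m * (C * exp (- c * rho \<xi> * t) * ?y)"
      unfolding elim(1) by (intro mult_left_mono elim(3)) simp
    then have "(norm (fourier h \<xi>))\<^sup>2 \<le> (?m * (C * exp (- c * rho \<xi> * t) * ?y))\<^sup>2"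
      by (intro power_mono) auto
    also have "\<dots> = C\<^sup>2 * (?m\<^sup>2 * exp (- (2 * c * rho \<xi> * t)) * ?y\<^sup>2)"
    proof -
      have "exp (- (2 * c * rho \<xi> * t)) = (exp (- c * rho \<xi> * t))\<^sup>2"
        using exp_double[of "- c * rho \<xi> * t"] by (simp add: mult.assoc)
      then show ?thesis by (simp only: power_mult_distrib ac_simps)
    qed
    finally have main: "(norm (fourier h \<xi>))\<^sup>2 \<le> C\<^sup>2 * (?m\<^sup>2 * exp (- (2 * c * rho \<xi> * t)) * ?y\<^sup>2)" .
    show ?case
    proof (cases "?x \<le> 1")
      case True
      have "?m\<^sup>2 \<le> (?x ^ ?k)\<^sup>2" by (intro power_mono norm_mon) simp
      then have m: "?m\<^sup>2 \<le> ?x ^ (2 * ?k)" by (simp add: power_mult[symmetric] mult.commute)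
      have x1: "?x\<^sup>2 \<le> 1" using power_le_one[OF norm_ge_zero True] by simp
      have "c * ?x\<^sup>2 * t \<le> 2 * c * rho \<xi> * t"
        using mult_right_mono[OF mult_left_mono[OF rho_bounds(1)[OF True], of "2 * c"] t] c by simp
      moreover have "c * ?x\<^sup>2 \<le> c" using mult_left_mono[OF x1, of c] c by simp
      ultimately have "- (2 * c * rho \<xi> * t) \<le> c + (- (c * (1 + t)) * ?x\<^sup>2)" by (simp add: algebra_simps)
      then have e: "exp (- (2 * c * rho \<xi> * t)) \<le> exp c * exp (- (c * (1 + t)) * ?x\<^sup>2)"
        unfolding exp_add[symmetric] by simp
      have "?m\<^sup>2 * exp (- (2 * c * rho \<xi> * t)) * ?y\<^sup>2 \<le> ?x ^ (2 * ?k) * (exp c * exp (- (c * (1 + t)) * ?x\<^sup>2)) * ?Y\<^sup>2"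
        by (intro mult_mono m e power_mono elim(4)) auto
      also have "\<dots> = ?Y\<^sup>2 * ?w \<xi>" by (simp add: gauss_moment_def)
      finally have "C\<^sup>2 * (?m\<^sup>2 * exp (- (2 * c * rho \<xi> * t)) * ?y\<^sup>2) \<le> C\<^sup>2 * (?Y\<^sup>2 * ?w \<xi>)"
        by (rule mult_left_mono) simp
      moreover have "0 \<le> C\<^sup>2 * exp (- c * t) * (norm (fourier h0 \<xi>))\<^sup>2" by simp
      ultimately show ?thesis using main by (simp only: mult.assoc)
    next
      case False
      have "c * t \<le> 2 * c * rho \<xi> * t"
        using mult_right_mono[OF mult_left_mono[OF rho_bounds(2)[of \<xi>], of "2 * c"] t] c False by simp
      \<comment> \<open>At high frequencies the monomial is not traded for decay: it is left on the
        data, where it forms the derivative \<open>h0\<close>.\<close>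
      then have e: "exp (- (2 * c * rho \<xi> * t)) \<le> exp (- c * t)" by simp
      have "?m\<^sup>2 * exp (- (2 * c * rho \<xi> * t)) * ?y\<^sup>2 \<le> ?m\<^sup>2 * exp (- c * t) * ?y\<^sup>2"
        by (intro mult_right_mono mult_left_mono e) auto
      also have "\<dots> = exp (- c * t) * (norm (fourier h0 \<xi>))\<^sup>2"
        unfolding elim(2) by (simp add: power_mult_distrib)
      finally have "C\<^sup>2 * (?m\<^sup>2 * exp (- (2 * c * rho \<xi> * t)) * ?y\<^sup>2) \<le> C\<^sup>2 * (exp (- c * t) * (norm (fourier h0 \<xi>))\<^sup>2)"
        by (rule mult_left_mono) simp
      moreover have "0 \<le> C\<^sup>2 * ?Y\<^sup>2 * ?w \<xi>" using w0 by simp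
      ultimately show ?thesis using main by (simp only: mult.assoc)
    qed
  qed
  note sqh = L2_fun_square_integrable[OF L2_fun_fourier[OF h(1)]] and sqh0 = L2_fun_square_integrable[OF L2_fun_fourier[OF h0(1)]]
  have "(L2_norm h)\<^sup>2 = (\<integral>\<xi>. (norm (fourier h \<xi>))\<^sup>2 \<partial>lborel)"
    unfolding Plancherel[OF h(1), symmetric] L2_norm_square ..
  also have "\<dots> \<le> (\<integral>\<xi>. C\<^sup>2 * ?Y\<^sup>2 * ?w \<xi> + C\<^sup>2 * exp (- c * t) * (norm (fourier h0 \<xi>))\<^sup>2 \<partial>lborel)"
    by (rule integral_mono_AE[OF sqh Bochner_Integration.integrable_add[OF integrable_mult_right[OF wint] integrable_mult_right[OF sqh0]] pt])
  also have "\<dots> = C\<^sup>2 * ?Y\<^sup>2 * (\<integral>\<xi>. ?w \<xi> \<partial>lborel) + C\<^sup>2 * exp (- c * t) * (\<integral>\<xi>. (norm (fourier h0 \<xi>))\<^sup>2 \<partial>lborel)"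
    unfolding Bochner_Integration.integral_add[OF integrable_mult_right[OF wint] integrable_mult_right[OF sqh0]] by simp
  also have "(\<integral>\<xi>. (norm (fourier h0 \<xi>))\<^sup>2 \<partial>lborel) = (L2_norm h0)\<^sup>2"
    unfolding L2_norm_square[symmetric] Plancherel[OF h0(1)] ..
  also have "(\<integral>\<xi>. ?w \<xi> \<partial>lborel) = exp c *
      ((1 + t) powr (- real CARD('n) / 2 - real ?k) * integral\<^sup>L lborel (gauss_moment ?k c :: real ^ 'n \<Rightarrow> real))"
    using gauss_moment_scaled[OF c, of "1 + t" ?k] t by simp
  finally show "(L2_norm h)\<^sup>2 \<le>
      C\<^sup>2 * ?Y\<^sup>2 * (exp c * ((1 + t) powr (- real CARD('n) / 2 - real ?k) * integral\<^sup>L lborel (gauss_moment ?k c :: real ^ 'n \<Rightarrow> real)))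
      + C\<^sup>2 * exp (- c * t) * (L2_norm h0)\<^sup>2" .
qed

text \<open>Sum the squared bounds over the lists of length \<open>k\<close>, then take the square
  root. This halves the exponents: n/2 + k becomes n/4 + k/2 and the rate \<open>c\<close> becomes
  c/2.\<close>

lemma deriv_L2_norm_decay:
  fixes u0 v :: "real ^ 'n \<Rightarrow> real ^ 'm"
  assumes u0: "Sobolev k u0" and u01: "integrable lborel u0" and v: "L2_fun v"
    and C: "C > 0" and c: "c > 0" and t: "t \<ge> 0"
    and decay: "AE \<xi> in lborel. norm (fourier v \<xi>) \<le> C * exp (- c * rho \<xi> * t) * norm (fourier u0 \<xi>)"
  defines "D \<equiv> C * (2 * pi) powr (- real CARD('n) / 2) *
    sqrt (real (card {js :: 'n list. length js = k}) * (exp c * integral\<^sup>L lborel (gauss_moment k c :: real ^ 'n \<Rightarrow> real)))"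
  shows "Sobolev k v"
    and "deriv_L2_norm k v \<le> D * (1 + t) powr (- real CARD('n) / 4 - real k / 2) * L1_norm u0
      + C * exp (- (c / 2) * t) * deriv_L2_norm k u0"
proof -
  have u0L2: "L2_fun u0" using u0 by (simp add: Sobolev_def)
  have ex0: "\<exists>g. L2_fun g \<and> is_weak_deriv js u0 g" if "length js \<le> k" for js
    using u0 that by (simp add: Sobolev_def)
  have w0: "L2_fun (weak_deriv js u0)" "is_weak_deriv js u0 (weak_deriv js u0)" if "length js \<le> k" for js
    using someI_ex[OF ex0[OF that]] unfolding weak_deriv_def by auto
  note dec = weak_deriv_decay[OF u0L2 u01 v w0 C c t decay]
  show "Sobolev k v" using dec(1) v by (simp add: Sobolev_def)
  have wv: "L2_fun (weak_deriv js v)" "is_weak_deriv js v (weak_deriv js v)" if "length js \<le> k" for js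
    using someI_ex[OF dec(1)[OF that that]] unfolding weak_deriv_def by auto
  let ?S = "{js :: 'n list. length js = k}"
  let ?c0 = "(2 * pi) powr (- real CARD('n) / 2)" and ?I = "integral\<^sup>L lborel (gauss_moment k c :: real ^ 'n \<Rightarrow> real)"
  let ?P = "(1 + t) powr (- real CARD('n) / 2 - real k)"
  have I0: "?I \<ge> 0" by (rule Bochner_Integration.integral_nonneg) (simp add: gauss_moment_def)
  have L1: "L1_norm u0 \<ge> 0" by (simp add: L1_norm_def)
  let ?a = "C\<^sup>2 * (?c0 * L1_norm u0)\<^sup>2 * (exp c * (?P * ?I))" and ?b = "C\<^sup>2 * exp (- c * t)"
  have "(\<Sum>js | length js = k. (L2_norm (weak_deriv js v))\<^sup>2) \<le> (\<Sum>js\<in>?S. ?a + ?b * (L2_norm (weak_deriv js u0))\<^sup>2)"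
  proof (rule sum_mono)
    fix js assume "js \<in> ?S"
    then have js: "length js = k" by simp
    show "(L2_norm (weak_deriv js v))\<^sup>2 \<le> ?a + ?b * (L2_norm (weak_deriv js u0))\<^sup>2"
      using dec(2)[of js, OF _ _ wv[of js]] js by simp
  qed
  also have "\<dots> = real (card ?S) * ?a + ?b * (\<Sum>js\<in>?S. (L2_norm (weak_deriv js u0))\<^sup>2)"
    by (simp add: sum.distrib sum_distrib_left)
  finally have "deriv_L2_norm k v \<le> sqrt (real (card ?S) * ?a + ?b * (\<Sum>js\<in>?S. (L2_norm (weak_deriv js u0))\<^sup>2))"
    unfolding deriv_L2_norm_def by (rule real_sqrt_le_mono)
  also have "\<dots> \<le> sqrt (real (card ?S) * ?a) + sqrt (?b * (\<Sum>js\<in>?S. (L2_norm (weak_deriv js u0))\<^sup>2))"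
    using I0 by (intro sqrt_add_le_add_sqrt) (auto intro!: mult_nonneg_nonneg sum_nonneg)
  also have "sqrt (?b * (\<Sum>js\<in>?S. (L2_norm (weak_deriv js u0))\<^sup>2)) = C * exp (- (c / 2) * t) * deriv_L2_norm k u0"
  proof -
    have "sqrt (exp (- c * t)) = exp (- (c / 2) * t)"
      by (rule real_sqrt_unique) (use exp_double[of "- (c / 2) * t"] in simp_all)
    then show ?thesis using C unfolding deriv_L2_norm_def real_sqrt_mult by simp
  qed
  also have "sqrt (real (card ?S) * ?a) = D * (1 + t) powr (- real CARD('n) / 4 - real k / 2) * L1_norm u0"
  proof -
    have P: "sqrt ?P = (1 + t) powr (- real CARD('n) / 4 - real k / 2)"
      using t by (simp add: powr_half_sqrt[symmetric] powr_powr field_simps)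
    have "real (card ?S) * ?a = (C * (?c0 * L1_norm u0))\<^sup>2 * (real (card ?S) * (exp c * ?I)) * ?P"
      by (simp add: power_mult_distrib ac_simps)
    then have "sqrt (real (card ?S) * ?a) = (C * (?c0 * L1_norm u0)) * sqrt (real (card ?S) * (exp c * ?I)) * sqrt ?P"
      using C L1 by (simp only: real_sqrt_mult real_sqrt_abs) simp
    then show ?thesis unfolding P D_def by (simp only: ac_simps)
  qed
  finally show "deriv_L2_norm k v \<le> D * (1 + t) powr (- real CARD('n) / 4 - real k / 2) * L1_norm u0
      + C * exp (- (c / 2) * t) * deriv_L2_norm k u0" .
qed

lemma Sobolev_mono: "Sobolev s f \<Longrightarrow> k \<le> s \<Longrightarrow> Sobolev k f"
  unfolding Sobolev_def using le_trans by blast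

text \<open>The Fourier image can be understood as a solution of the equation at one frequency or as
  the transform of a weak solution, which is determined up to null sets; both readings are covered,
  with the same constants. Membership of u(t) in H^k is asserted along with the estimate, because
  \<open>deriv_L2_norm\<close> has its meaning only then.\<close>

theorem theorem2p2:
  fixes A0 L S :: "real ^ 'm ^ 'm" and A :: "'n::finite \<Rightarrow> real ^ 'm ^ 'm"
  assumes "condition_A A0 A L"
    and "condition_S A0 L S"
    and "condition_S2 A S"
    and "condition_K A0 A L"
  shows "(\<exists>C>0. \<exists>c>0.
      (\<forall>\<xi> v t. Fourier_ODE A0 A L \<xi> v \<longrightarrow> t \<ge> 0 \<longrightarrow>
         norm (v t) \<le> C * exp (- c * rho \<xi> * t) * norm (v 0)) \<and>
      (\<forall>u0 u t. L2_fun u0 \<longrightarrow> Cauchy_solution A0 A L u0 u \<longrightarrow> t \<ge> 0 \<longrightarrow>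
         (AE \<xi> in lborel.
            norm (fourier (u t) \<xi>) \<le> C * exp (- c * rho \<xi> * t) * norm (fourier u0 \<xi>))))
    \<and> (\<forall>s. \<exists>C>0. \<exists>c>0. \<forall>u0 u.
         Sobolev s u0 \<longrightarrow> integrable lborel u0 \<longrightarrow> Cauchy_solution A0 A L u0 u \<longrightarrow>
         (\<forall>k\<le>s. \<forall>t\<ge>0. Sobolev k (u t) \<and>
            deriv_L2_norm k (u t) \<le>
              C * (1 + t) powr (- real CARD('n) / 4 - real k / 2) * L1_norm u0
              + C * exp (- c * t) * deriv_L2_norm k u0))"
proof (rule Lyapunov[OF assms])
  fix H :: "real ^ 'n \<Rightarrow> complex ^ 'm \<Rightarrow> complex ^ 'm" and a b c :: real
  assume abc: "a > 0" "b > 0" "c > 0"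
    and lin: "\<And>\<xi>. linear (H \<xi>)" and sym: "\<And>\<xi> z w. H \<xi> z \<bullet> w = z \<bullet> H \<xi> w"
    and low: "\<And>\<xi> z. a * (norm z)\<^sup>2 \<le> H \<xi> z \<bullet> z" and up: "\<And>\<xi> z. norm (H \<xi> z) \<le> b * norm z"
    and dissip: "\<And>\<xi> z w. mop A0 w + (\<i> * complex_of_real (norm \<xi>)) *s mop (symbol A (sgn \<xi>)) z + mop L z = 0 \<Longrightarrow>
      H \<xi> z \<bullet> w \<le> - c * rho \<xi> * (H \<xi> z \<bullet> z)"
    and meas: "\<And>V. V \<in> borel_measurable borel \<Longrightarrow> (\<lambda>\<xi>. H \<xi> (V \<xi>)) \<in> borel_measurable borel"
  define C where "C = sqrt (b / a)"
  have C: "C > 0" using abc by (simp add: C_def)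
  have ode: "norm (v t) \<le> C * exp (- c * rho \<xi> * t) * norm (v 0)" if v: "Fourier_ODE A0 A L \<xi> v" and t: "t \<ge> 0" for \<xi> v t
  proof -
    have "H \<xi> (v t) \<bullet> v t \<le> exp (- (2 * (c * rho \<xi>)) * t) * (H \<xi> (v 0) \<bullet> v 0)"
      by (rule Fourier_ODE_decay[OF lin sym _ v t]) (use dissip in simp)
    moreover have "H \<xi> (v 0) \<bullet> v 0 \<le> b * (norm (v 0))\<^sup>2"
      using norm_cauchy_schwarz[of "H \<xi> (v 0)" "v 0"] mult_right_mono[OF up[of \<xi> "v 0"] norm_ge_zero[of "v 0"]]
      by (simp add: power2_eq_square)
    ultimately have "norm (v t) \<le> sqrt (b / a) * exp (- (c * rho \<xi> * t)) * norm (v 0)"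
      by (intro norm_le_of_energy[OF abc(1,2) low[of "v t" \<xi>]]) (auto simp: mult.assoc)
    then show ?thesis by (simp add: C_def)
  qed
  have pde: "AE \<xi> in lborel. norm (fourier (u t) \<xi>) \<le> C * exp (- c * rho \<xi> * t) * norm (fourier u0 \<xi>)"
    if u0: "L2_fun u0" and sol: "Cauchy_solution A0 A L u0 u" and t: "t \<ge> 0" for u0 u t
    unfolding C_def
    by (rule fourier_pointwise_decay[OF sol u0 assms(1) abc lin sym low up _ meas t])
      (rule dissip, simp add: add.assoc)
  have "\<exists>C>0. \<exists>c>0. \<forall>u0 u. Sobolev s u0 \<longrightarrow> integrable lborel u0 \<longrightarrow> Cauchy_solution A0 A L u0 u \<longrightarrow>
         (\<forall>k\<le>s. \<forall>t\<ge>0. Sobolev k (u t) \<and>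
            deriv_L2_norm k (u t) \<le>
              C * (1 + t) powr (- real CARD('n) / 4 - real k / 2) * L1_norm u0
              + C * exp (- c * t) * deriv_L2_norm k u0)" for s
  proof -
    define D where "D k = C * (2 * pi) powr (- real CARD('n) / 2) *
      sqrt (real (card {js :: 'n list. length js = k}) * (exp c * integral\<^sup>L lborel (gauss_moment k c :: real ^ 'n \<Rightarrow> real)))" for k
    have D0: "D k \<ge> 0" for k
    proof -
      have "integral\<^sup>L lborel (gauss_moment k c :: real ^ 'n \<Rightarrow> real) \<ge> 0"
        by (rule Bochner_Integration.integral_nonneg) (simp add: gauss_moment_def)
      then show ?thesis using C by (simp add: D_def)
    qed
    \<comment> \<open>A single constant for all orders up to \<open>s\<close>: the sum dominates
      each \<open>D k\<close> as well as \<open>C\<close>.\<close>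
    define C' where "C' = C + (\<Sum>k\<le>s. D k)"
    have C': "C' > 0" using C sum_nonneg[of "{..s}" D] D0 by (simp add: C'_def add_pos_nonneg)
    have CC': "C \<le> C'" using sum_nonneg[of "{..s}" D] D0 by (simp add: C'_def)
    have DC': "D k \<le> C'" if "k \<le> s" for k
      using member_le_sum[of k "{..s}" D] that D0 C by (simp add: C'_def)
    have "Sobolev k (u t) \<and> deriv_L2_norm k (u t) \<le>
        C' * (1 + t) powr (- real CARD('n) / 4 - real k / 2) * L1_norm u0 + C' * exp (- (c / 2) * t) * deriv_L2_norm k u0"
      if u0: "Sobolev s u0" and u01: "integrable lborel u0" and sol: "Cauchy_solution A0 A L u0 u" and k: "k \<le> s" and t: "t \<ge> 0"
      for u0 u k t
    proof -
      have u0L2: "L2_fun u0" using u0 by (simp add: Sobolev_def)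
      have ut: "L2_fun (u t)" using sol t by (auto simp: Cauchy_solution_def)
      note dec = deriv_L2_norm_decay[OF Sobolev_mono[OF u0 k] u01 ut C abc(3) t pde[OF u0L2 sol t], folded D_def]
      have L1: "0 \<le> L1_norm u0" by (simp add: L1_norm_def)
      have d0: "0 \<le> deriv_L2_norm k u0" by (simp add: deriv_L2_norm_def sum_nonneg)
      have "D k * (1 + t) powr (- real CARD('n) / 4 - real k / 2) * L1_norm u0 \<le> C' * (1 + t) powr (- real CARD('n) / 4 - real k / 2) * L1_norm u0"
        by (intro mult_right_mono DC'[OF k] L1) simp
      moreover have "C * exp (- (c / 2) * t) * deriv_L2_norm k u0 \<le> C' * exp (- (c / 2) * t) * deriv_L2_norm k u0"
        by (intro mult_right_mono CC' d0) simp
      ultimately show ?thesis using dec by linarith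
    qed
    moreover have "c / 2 > 0" using abc by simp
    ultimately show ?thesis using C' by blast
  qed
  with ode pde C abc(3) show ?thesis by blast
qed

end
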